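(* Suppose that $0<1/n\ll\varepsilon_0\ll\varepsilon\ll\lambda,1/K\ll1$, that $0\le\phi\ll1$ and that $n/4,K,m,\lambda n/K^2,(n/2-1-\phi n)/(2K^2)\in\mathbb{N}$. Suppose that the following conditions hold: (i) $G$ is an $(n/2-1)$-regular graph on $n$ vertices. (ii) $\mathcal{P}$ is a $(K,m,\varepsilon_0)$-partition of $V(G)$ such that $\Delta(G[A',B'])\le n/4$ and $|A'|=|B'|=n/2$. (iii) $G_0$ is a subgraph of $G$ such that $G[A_0]+G[B_0]\subseteq G_0$ and $d_{G_0}(v)=\phi n$ for all $v\in V_0$. (iv) Let $G^{\diamond}:=G-G[A]-G[B]-G_0$. Then $e_{G^{\diamond}}(A',B')$ is even and $(G^{\diamond},\mathcal{P})$ is a $(K,m,\varepsilon_0,\varepsilon)$-exceptional scheme. (v) $\Delta(G^{\diamond}[A',B'])\le e_{G^{\diamond}}(A',B')/2\le (n/2-1-\phi n)/2$. Then there exists a set $\mathcal{J}$ consisting of $(n/2-1-\phi n)/2$ edge-disjoint exceptional systems with parameter $\varepsilon_0$ in $G^{\diamond}$ which satisfies the following properties: (a) Together the exceptional systems in $\mathcal{J}$ cover all edges of $G^{\diamond}$. Each $J$ in $\mathcal{J}$ is either a Hamilton exceptional system with $e_{J}(A',B')=2$ or a matching exceptional system. (b) For all $1\le i,i'\le K$, the set $\mathcal{J}$ contains $(n/2-1-(\phi+2\lambda)n)/(2K^2)$ $(i,i')$-ES.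
   Context: Constants. The hierarchy $0<1/n\ll\varepsilon_0\ll\varepsilon\ll\lambda,1/K\ll1$ means that constants are chosen from right to left: there are non-decreasing functions $(0,1]\to(0,1]$ such that the result holds whenever each constant is at most the corresponding function of the constant(s) to its right ($\varepsilon$ must be small with respect to both $\lambda$ and $1/K$, while $\lambda$ and $1/K$ are each at most some absolute constant, with no relation between them). $0\le\phi\ll1$ means that $\phi$ is non-negative and at most a sufficiently small absolute constant. $a=b\pm c$ means $b-c\le a\le b+c$. Graph notation. Graphs are finite and simple. $e(G)$ is the number of edges, $\Delta(G)$ the maximum degree; $d_G(v)$ is the degree of $v$ and $d_G(v,X)$ the number of neighbours of $v$ in $X$; $e_G(X)$ is the number of edges with both endvertices in $X$; $e_G(X,Y)$ is the number of edges with one endvertex in $X$ and the other in $Y$ (subscripts are omitted if clear). $G[X]$ is the induced subgraph on $X$; for disjoint $X,Y$, $G[X,Y]$ is the bipartite subgraph with classes $X,Y$ and all edges of $G$ between $X$ and $Y$. For edge-disjoint $G,H$, $G+H$ has vertex set $V(G)\cup V(H)$ and edge set $E(G)\cup E(H)$. $G-H$ is obtained from $G$ by deleting the edges in $E(G)\cap E(H)$. A path system is a graph which is a union of vertex-disjoint paths (some possibly trivial, i.e. single vertices). A set of edge-disjoint graphs is understood as an indexed family (so edgeless members may be repeated). Partitions. A $(K,m,\varepsilon_0)$-partition $\mathcal{P}$ of a vertex set $V$ is a partition of $V$ into sets $A_0,A_1,\dots,A_K$ and $B_0,B_1,\dots,B_K$ such that $|A_i|=|B_i|=m$ for all $i\ge1$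 and $|A_0\cup B_0|\le\varepsilon_0|V|$. Write $V_0:=A_0\cup B_0$, $A:=A_1\cup\dots\cup A_K$, $B:=B_1\cup\dots\cup B_K$, $A':=A_0\cup A$, $B':=B_0\cup B$. Exceptional schemes. For a graph $G$ on $n$ vertices and a partition $\mathcal{P}$ of $V(G)$, $(G,\mathcal{P})$ is a $(K,m,\varepsilon_0,\varepsilon)$-exceptional scheme if: (ESch1) $\mathcal{P}$ is a $(K,m,\varepsilon_0)$-partition of $V(G)$; (ESch2) $e(A)=e(B)=0$; (ESch3) if $v\in A$ then $d(v,B')<\varepsilon_0n$ and if $v\in B$ then $d(v,A')<\varepsilon_0n$; (ESch4) for all $v\in V(G)$ and all $1\le i\le K$, $d(v,A_i)=(d(v,A)\pm\varepsilon n)/K$ and $d(v,B_i)=(d(v,B)\pm\varepsilon n)/K$; (ESch5) for all $1\le i,i'\le K$: $e(A_0,A_i)=(e(A_0,A)\pm\varepsilon\max\{e(A_0,A),n\})/K$, $e(B_0,A_i)=(e(B_0,A)\pm\varepsilon\max\{e(B_0,A),n\})/K$, $e(A_0,B_i)=(e(A_0,B)\pm\varepsilon\max\{e(A_0,B),n\})/K$, $e(B_0,B_i)=(e(B_0,B)\pm\varepsilon\max\{e(B_0,B),n\})/K$, and $e(A_i,B_{i'})=(e(A,B)\pm\varepsilon\max\{e(A,B),n\})/K^2$. Exceptional systems. Let $A,A_0,B,B_0$ partition a set $V$ of $n$ vertices with $|A|=|B|$. An exceptional cover $J$ is a path system with $V_0\subseteq V(J)\subseteq V$, such that $d_J(v)=2$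 for every $v\in V_0$, $d_J(v)\le1$ for every $v\in V(J)\setminus V_0$, and $e_J(A)=e_J(B)=0$. An exceptional system (ES) with parameter $\varepsilon_0$ is an exceptional cover $J$ containing at most $\sqrt{\varepsilon_0}\,n$ $AB$-paths (paths with one endvertex in $A$ and the other in $B$; these are automatically components of $J$) such that one of the following holds: (HES) the number of $AB$-paths in $J$ is even and positive, in which case $J$ is called a Hamilton exceptional system; (MES) $e_J(A',B')=0$, in which case $J$ is called a matching exceptional system. For $1\le i,i'\le K$, an $(i,i')$-ES is an exceptional system $J$ with $V(J)\subseteq V_0\cup A_i\cup B_{i'}$. *)

theory Defs
  imports Complex_Main "HOL-Library.Disjoint_Sets"
begin

section \<open>Finite simple graphs\<close>

record 'a graph =
  verts :: "'a set"
  edges :: "'a set set"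

definition simple_graph :: "'a graph \<Rightarrow> bool" where
  "simple_graph G \<longleftrightarrow> finite (verts G) \<and> (\<forall>e\<in>edges G. e \<subseteq> verts G \<and> card e = 2)"

definition subgraph :: "'a graph \<Rightarrow> 'a graph \<Rightarrow> bool" where
  "subgraph H G \<longleftrightarrow> simple_graph H \<and> verts H \<subseteq> verts G \<and> edges H \<subseteq> edges G"

definition deg :: "'a graph \<Rightarrow> 'a \<Rightarrow> nat" where
  "deg G v = card {u. {v, u} \<in> edges G}"

definition deg_in :: "'a graph \<Rightarrow> 'a \<Rightarrow> 'a set \<Rightarrow> nat" where
  "deg_in G v X = card {u \<in> X. {v, u} \<in> edges G}"

definition max_deg :: "'a graph \<Rightarrow> nat" where
  "max_deg G = Max (insert 0 (deg G ` verts G))"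

definition num_edges_in :: "'a graph \<Rightarrow> 'a set \<Rightarrow> nat" where
  "num_edges_in G X = card {e \<in> edges G. e \<subseteq> X}"

definition num_edges_between :: "'a graph \<Rightarrow> 'a set \<Rightarrow> 'a set \<Rightarrow> nat" where
  "num_edges_between G X Y = card {e \<in> edges G. \<exists>x\<in>X. \<exists>y\<in>Y. e = {x, y}}"

definition induced :: "'a graph \<Rightarrow> 'a set \<Rightarrow> 'a graph" where
  "induced G X = \<lparr>verts = X, edges = {e \<in> edges G. e \<subseteq> X}\<rparr>"

definition bip_induced :: "'a graph \<Rightarrow> 'a set \<Rightarrow> 'a set \<Rightarrow> 'a graph" where
  "bip_induced G X Y =
     \<lparr>verts = X \<union> Y, edges = {e \<in> edges G. \<exists>x\<in>X. \<exists>y\<in>Y. e = {x, y}}\<rparr>"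

definition graph_plus :: "'a graph \<Rightarrow> 'a graph \<Rightarrow> 'a graph" where
  "graph_plus G H = \<lparr>verts = verts G \<union> verts H, edges = edges G \<union> edges H\<rparr>"

definition graph_minus :: "'a graph \<Rightarrow> 'a graph \<Rightarrow> 'a graph" where
  "graph_minus G H = \<lparr>verts = verts G, edges = edges G - edges H\<rparr>"

text \<open>A path is given by a nonempty list of distinct vertices; a list and its
  reversal describe the same graph, and a singleton list a trivial path.\<close>

definition path_graph :: "'a list \<Rightarrow> 'a graph" where
  "path_graph xs = \<lparr>verts = set xs, edges = {{xs ! i, xs ! Suc i} | i. Suc i < length xs}\<rparr>"

definition is_path :: "'a graph \<Rightarrow> bool" where
  "is_path P \<longleftrightarrow> (\<exists>xs. xs \<noteq> [] \<and> distinct xs \<and> P = path_graph xs)"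

definition path_system :: "'a graph \<Rightarrow> bool" where
  "path_system J \<longleftrightarrow> (\<exists>Ps. finite Ps \<and> (\<forall>P\<in>Ps. is_path P)
     \<and> disjoint_family_on verts Ps
     \<and> J = \<lparr>verts = (\<Union>P\<in>Ps. verts P), edges = (\<Union>P\<in>Ps. edges P)\<rparr>)"

text \<open>The paths in \<open>J\<close> with one endvertex in \<open>A\<close> and the other in \<open>B\<close>, as graphs.\<close>

definition AB_paths :: "'a set \<Rightarrow> 'a set \<Rightarrow> 'a graph \<Rightarrow> 'a graph set" where
  "AB_paths A B J = {P. subgraph P J \<and>
     (\<exists>xs. xs \<noteq> [] \<and> distinct xs \<and> P = path_graph xs \<and> hd xs \<in> A \<and> last xs \<in> B)}"


section \<open>Constants\<close>

text \<open>\<open>pm a b c\<close> is \<open>a = b \<plusminus> c\<close>. In particular \<open>a = (b \<plusminus> c) / K\<close> is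
  \<open>pm a (b / K) (c / K)\<close>.\<close>

definition pm :: "real \<Rightarrow> real \<Rightarrow> real \<Rightarrow> bool" where
  "pm a b c \<longleftrightarrow> b - c \<le> a \<and> a \<le> b + c"

text \<open>The functions \<open>(0,1] \<rightarrow> (0,1]\<close> implicit in a hierarchy of constants.\<close>

definition hierarchy_fun :: "(real \<Rightarrow> real) \<Rightarrow> bool" where
  "hierarchy_fun f \<longleftrightarrow> mono_on {0<..1} f \<and> f ` {0<..1} \<subseteq> {0<..1}"


section \<open>Partitions and exceptional schemes\<close>

text \<open>A partition into \<open>A\<^sub>0, \<dots>, A\<^sub>K\<close> and \<open>B\<^sub>0, \<dots>, B\<^sub>K\<close> is given by two functions on
  indices, of which only the values at \<open>0, \<dots>, K\<close> matter. For either of them,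
  \<open>core\<close> is the union over the positive indices (written \<open>A\<close>, \<open>B\<close> in the paper) and
  \<open>whole\<close> also includes the part of index 0 (written \<open>A'\<close>, \<open>B'\<close>).\<close>

definition core :: "nat \<Rightarrow> (nat \<Rightarrow> 'a set) \<Rightarrow> 'a set" where
  "core K A = (\<Union>i\<in>{1..K}. A i)"

definition whole :: "nat \<Rightarrow> (nat \<Rightarrow> 'a set) \<Rightarrow> 'a set" where
  "whole K A = A 0 \<union> core K A"

definition is_partition ::
    "nat \<Rightarrow> nat \<Rightarrow> real \<Rightarrow> 'a set \<Rightarrow> (nat \<Rightarrow> 'a set) \<Rightarrow> (nat \<Rightarrow> 'a set) \<Rightarrow> bool" where
  "is_partition K m \<epsilon>0 V A B \<longleftrightarrow>
     whole K A \<union> whole K B = V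
     \<and> disjoint_family_on A {0..K} \<and> disjoint_family_on B {0..K}
     \<and> whole K A \<inter> whole K B = {}
     \<and> (\<forall>i\<in>{1..K}. card (A i) = m \<and> card (B i) = m)
     \<and> real (card (A 0 \<union> B 0)) \<le> \<epsilon>0 * real (card V)"

definition exceptional_scheme ::
    "nat \<Rightarrow> nat \<Rightarrow> real \<Rightarrow> real \<Rightarrow> 'a graph \<Rightarrow> (nat \<Rightarrow> 'a set) \<Rightarrow> (nat \<Rightarrow> 'a set) \<Rightarrow> bool" where
  "exceptional_scheme K m \<epsilon>0 \<epsilon> G A B \<longleftrightarrow>
    (let n = real (card (verts G));
         d = (\<lambda>v X. real (deg_in G v X));
         e = (\<lambda>X Y. real (num_edges_between G X Y))
     in
       is_partition K m \<epsilon>0 (verts G) A B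
     \<and> num_edges_in G (core K A) = 0 \<and> num_edges_in G (core K B) = 0
     \<and> (\<forall>v\<in>core K A. d v (whole K B) < \<epsilon>0 * n)
     \<and> (\<forall>v\<in>core K B. d v (whole K A) < \<epsilon>0 * n)
     \<and> (\<forall>v\<in>verts G. \<forall>i\<in>{1..K}.
          pm (d v (A i)) (d v (core K A) / K) (\<epsilon> * n / K)
        \<and> pm (d v (B i)) (d v (core K B) / K) (\<epsilon> * n / K))
     \<and> (\<forall>i\<in>{1..K}. \<forall>i'\<in>{1..K}.
          pm (e (A 0) (A i)) (e (A 0) (core K A) / K) (\<epsilon> * max (e (A 0) (core K A)) n / K)
        \<and> pm (e (B 0) (A i)) (e (B 0) (core K A) / K) (\<epsilon> * max (e (B 0) (core K A)) n / K)
        \<and> pm (e (A 0) (B i)) (e (A 0) (core K B) / K) (\<epsilon> * max (e (A 0) (core K B)) n / K)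
        \<and> pm (e (B 0) (B i)) (e (B 0) (core K B) / K) (\<epsilon> * max (e (B 0) (core K B)) n / K)
        \<and> pm (e (A i) (B i')) (e (core K A) (core K B) / K^2)
             (\<epsilon> * max (e (core K A) (core K B)) n / K^2)))"


section \<open>Exceptional systems\<close>

text \<open>In this section \<open>A0\<close>, \<open>A\<close>, \<open>B0\<close>, \<open>B\<close> are understood to partition a finite vertex
  set \<open>V\<close>, with \<open>A\<close> and \<open>B\<close> of equal size; possibly \<open>A0\<close> or \<open>B0\<close> is empty.\<close>

definition exceptional_cover ::
    "'a set \<Rightarrow> 'a set \<Rightarrow> 'a set \<Rightarrow> 'a set \<Rightarrow> 'a graph \<Rightarrow> bool" where
  "exceptional_cover A0 A B0 B J \<longleftrightarrow>
     path_system J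
     \<and> A0 \<union> B0 \<subseteq> verts J \<and> verts J \<subseteq> A0 \<union> A \<union> B0 \<union> B
     \<and> (\<forall>v\<in>A0 \<union> B0. deg J v = 2)
     \<and> (\<forall>v\<in>verts J - (A0 \<union> B0). deg J v \<le> 1)
     \<and> num_edges_in J A = 0 \<and> num_edges_in J B = 0"

definition HES_condition :: "'a set \<Rightarrow> 'a set \<Rightarrow> 'a graph \<Rightarrow> bool" where
  "HES_condition A B J \<longleftrightarrow> even (card (AB_paths A B J)) \<and> card (AB_paths A B J) > 0"

definition MES_condition ::
    "'a set \<Rightarrow> 'a set \<Rightarrow> 'a set \<Rightarrow> 'a set \<Rightarrow> 'a graph \<Rightarrow> bool" where
  "MES_condition A0 A B0 B J \<longleftrightarrow> num_edges_between J (A0 \<union> A) (B0 \<union> B) = 0"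

definition exceptional_system ::
    "real \<Rightarrow> 'a set \<Rightarrow> 'a set \<Rightarrow> 'a set \<Rightarrow> 'a set \<Rightarrow> 'a graph \<Rightarrow> bool" where
  "exceptional_system \<epsilon>0 A0 A B0 B J \<longleftrightarrow>
     exceptional_cover A0 A B0 B J
     \<and> real (card (AB_paths A B J)) \<le> sqrt \<epsilon>0 * real (card (A0 \<union> A \<union> B0 \<union> B))
     \<and> (HES_condition A B J \<or> MES_condition A0 A B0 B J)"

definition hamilton_ES ::
    "real \<Rightarrow> 'a set \<Rightarrow> 'a set \<Rightarrow> 'a set \<Rightarrow> 'a set \<Rightarrow> 'a graph \<Rightarrow> bool" where
  "hamilton_ES \<epsilon>0 A0 A B0 B J \<longleftrightarrow>
     exceptional_system \<epsilon>0 A0 A B0 B J \<and> HES_condition A B J"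

definition matching_ES ::
    "real \<Rightarrow> 'a set \<Rightarrow> 'a set \<Rightarrow> 'a set \<Rightarrow> 'a set \<Rightarrow> 'a graph \<Rightarrow> bool" where
  "matching_ES \<epsilon>0 A0 A B0 B J \<longleftrightarrow>
     exceptional_system \<epsilon>0 A0 A B0 B J \<and> MES_condition A0 A B0 B J"

definition local_ES ::
    "real \<Rightarrow> nat \<Rightarrow> (nat \<Rightarrow> 'a set) \<Rightarrow> (nat \<Rightarrow> 'a set) \<Rightarrow> nat \<Rightarrow> nat \<Rightarrow> 'a graph \<Rightarrow> bool" where
  "local_ES \<epsilon>0 K A B i i' J \<longleftrightarrow>
     exceptional_system \<epsilon>0 (A 0) (core K A) (B 0) (core K B) J
     \<and> verts J \<subseteq> A 0 \<union> B 0 \<union> A i \<union> B i'"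

end

theory Submission
  imports Defs "HOL-Combinatorics.Transposition"
begin

text \<open>
  Write \<open>H\<close> for the bipartite graph formed by the edges of the scheme between \<open>A'\<close> and \<open>B'\<close>, the
  cross edges. Let \<open>2 * h\<close> be their number and \<open>N = (n/2 - 1 - \<phi> n) / 2\<close>; then \<open>h \<le> N\<close> and no
  vertex has degree above \<open>h\<close> in \<open>H\<close>. Every other edge joins \<open>A\<^sub>0\<close> to \<open>A\<close> or \<open>B\<^sub>0\<close> to \<open>B\<close>, and
  every exceptional vertex, that is, every vertex of \<open>A\<^sub>0 \<union> B\<^sub>0\<close>, has degree \<open>2 * N\<close>.

  Suppose that an exceptional cover consisting of edges of the scheme contains exactly two cross
  edges and that these are disjoint. The inner vertices of its paths are exceptional, and a path
  that follows an edge from \<open>A\<^sub>0\<close> to \<open>A\<close> or from \<open>B\<^sub>0\<close> to \<open>B\<close> ends there. So the two cross edges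
  lie in different paths, these are the only \<open>AB\<close>-paths, and the cover is a Hamilton exceptional
  system. A cover without cross edges is a matching exceptional system. It therefore suffices to
  colour all edges with \<open>N\<close> colours so that every exceptional vertex is on exactly two edges of
  each colour, every other vertex is on at most one, and each colour has either no cross edge or
  two disjoint ones (\<open>exceptional_J\<close>). To make many classes local, write \<open>N = K\<^sup>2 * L + \<Lambda>\<close> with
  \<open>\<Lambda> = \<lambda> n\<close>, reserve \<open>L\<close> colours for each pair \<open>(i, i')\<close>, to be used only on edges inside
  \<open>A\<^sub>0 \<union> A\<^sub>i \<union> B\<^sub>0 \<union> B\<^sub>i\<^sub>'\<close>, and leave \<open>\<Lambda>\<close> colours free.

  A bipartite graph with \<open>2 * s\<close> edges and maximum degree at most \<open>s\<close> splits into \<open>s\<close> pairs of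
  disjoint edges: in a pairing with as few intersecting pairs as possible, exchanging partners
  would remove an intersecting pair (\<open>matching_pairs\<close>). So if \<open>h \<le> \<Lambda>\<close>, all cross edges can take
  free colours. Otherwise \<open>H\<close> is cut into one part with \<open>2 * t\<close> edges for each \<open>(i, i')\<close>, where
  \<open>t \<le> L\<close>, and a rest with \<open>2 * r\<close> edges, where \<open>r \<le> \<Lambda>\<close>, such that no part has maximum degree
  above half its number of edges (\<open>type_assignment\<close>). Only vertices of degree linear in \<open>n\<close> can
  violate the degree condition; there are boundedly many, all are exceptional, and almost all
  their cross edges end in \<open>A \<union> B\<close>, spread evenly over the clusters. So one merely has to choose
  how many edges each of these vertices, and each of four classes of remaining edges, gives to
  every part. That is a problem about integers (\<open>packet_sizes\<close>), solvable because \<open>r\<close> is linear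
  in \<open>n\<close>, with a factor depending on \<open>\<lambda>\<close> and \<open>1/K\<close> only, whereas all errors are at most \<open>\<epsilon> n\<close>
  times such a factor.

  The edges from \<open>A\<^sub>0\<close> to \<open>A\<close> are then coloured one vertex \<open>v\<close> of \<open>A\<^sub>0\<close> at a time. Let \<open>x\<^sub>i\<close> be
  the number of cross edges at \<open>v\<close> in the colours reserved for \<open>A\<^sub>i\<close>. These colours still need
  \<open>2 * K * L - x\<^sub>i\<close> edges from \<open>v\<close> to \<open>A\<^sub>i\<close>. There are that many, since the cross edges were
  shared out with \<open>d\<^sub>H(v) \<le> K * x\<^sub>i + \<Lambda>\<close>; the other edges at \<open>v\<close> are exactly what the free
  colours need. Each edge is barred from few colours and each colour from few edges, so
  exchanging colours along an assignment with fewest clashes shows that there is one with none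
  (\<open>colouring_avoiding\<close>, \<open>extend_colouring\<close>). The edges from \<open>B\<^sub>0\<close> to \<open>B\<close> are treated in the
  same way.
\<close>

section \<open>Splitting numbers and sets\<close>

lemma sum_between:
  fixes l u :: "'i \<Rightarrow> nat"
  assumes "finite I" "\<And>i. i \<in> I \<Longrightarrow> l i \<le> u i" "sum l I \<le> T" "T \<le> sum u I"
  shows "\<exists>c. (\<forall>i\<in>I. l i \<le> c i \<and> c i \<le> u i) \<and> sum c I = T"
  using assms
proof (induction I arbitrary: T rule: finite_induct)
  case empty
  then show ?case by auto
next
  case (insert j I)
  define x where "x = max (l j) (T - sum u I)"
  have s: "sum l I \<le> sum u I" using insert.prems(1) by (simp add: sum_mono)
  have x: "l j \<le> x" "x \<le> u j" "sum l I \<le> T - x" "T - x \<le> sum u I" "x \<le> T"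
    using insert.prems insert.hyps s insert.prems(1)[of j] unfolding x_def by auto
  obtain c where c: "\<forall>i\<in>I. l i \<le> c i \<and> c i \<le> u i" "sum c I = T - x"
    using insert.IH[of "T - x"] insert.prems(1) x by auto
  have "sum (c(j := x)) I = sum c I" using insert.hyps by (intro sum.cong) auto
  then show ?case using c x insert.hyps
    by (intro exI[of _ "c(j := x)"]) auto
qed

text \<open>Only indices with the same label compete for the same elements, so a greedy choice succeeds.\<close>

lemma disjoint_choice:
  fixes f :: "'e \<Rightarrow> 'l" and q :: "'t \<Rightarrow> 'l"
  assumes "finite T" "finite S"
    and "\<And>l. (\<Sum>t\<in>{t\<in>T. q t = l}. c t) \<le> card {e\<in>S. f e = l}"
  shows "\<exists>E. (\<forall>t\<in>T. E t \<subseteq> {e\<in>S. f e = q t} \<and> card (E t) = (c t :: nat)) \<and> disjoint_family_on E T"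
  using assms
proof (induction T arbitrary: S rule: finite_induct)
  case empty
  then show ?case by (auto simp: disjoint_family_on_def)
next
  case (insert j T)
  have "c j \<le> card {e\<in>S. f e = q j}"
    using insert.prems(2)[of "q j"] insert.hyps(1,2) 
    by (metis (mono_tags, lifting) finite_insert finite_subset insertI1 le_trans mem_Collect_eq
        member_le_sum subsetI zero_le)
  then obtain Z where Z: "Z \<subseteq> {e\<in>S. f e = q j}" "card Z = c j"
    by (meson obtain_subset_with_card_n)
  have fZ: "finite Z" using Z insert.prems(1) finite_subset by fastforce
  have "(\<Sum>t\<in>{t\<in>T. q t = l}. c t) \<le> card {e\<in>S - Z. f e = l}" for l
  proof (cases "l = q j")
    case True
    have "{t \<in> insert j T. q t = l} = insert j {t\<in>T. q t = l}" using True by auto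
    then have "c j + (\<Sum>t\<in>{t\<in>T. q t = l}. c t) \<le> card {e\<in>S. f e = l}"
      using insert.prems(2)[of l] insert.hyps by simp
    moreover have "{e\<in>S - Z. f e = l} = {e\<in>S. f e = l} - Z" by auto
    moreover have "card ({e\<in>S. f e = l} - Z) = card {e\<in>S. f e = l} - card Z"
      using Z True fZ by (intro card_Diff_subset) auto
    ultimately show ?thesis using Z by simp
  next
    case False
    have "{t \<in> insert j T. q t = l} = {t\<in>T. q t = l}" using False by auto
    moreover have "{e\<in>S - Z. f e = l} = {e\<in>S. f e = l}" using Z False by auto
    ultimately show ?thesis using insert.prems(2)[of l] by simp
  qed
  then obtain E where E: "\<forall>t\<in>T. E t \<subseteq> {e\<in>S - Z. f e = q t} \<and> card (E t) = c t" "disjoint_family_on E T"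
    using insert.IH[of "S - Z"] insert.prems(1) by auto
  show ?case
  proof (intro exI[of _ "E(j := Z)"] conjI ballI)
    fix t assume "t \<in> insert j T"
    then show "(E(j := Z)) t \<subseteq> {e \<in> S. f e = q t}" using E Z by (cases "t = j") auto
  next
    fix t assume "t \<in> insert j T"
    then show "card ((E(j := Z)) t) = c t" using E Z by auto
  next
    have Zd: "E t \<inter> Z = {}" if "t \<in> T" for t using E(1) that by blast
    show "disjoint_family_on (E(j := Z)) (insert j T)"
      using E(2) Zd insert.hyps(2) unfolding disjoint_family_on_def by auto
  qed
qed

lemma disjoint_subsets_of_sizes:
  assumes "finite T" "finite S" "(\<Sum>t\<in>T. c t) \<le> card S"
  shows "\<exists>E. (\<forall>t\<in>T. E t \<subseteq> S \<and> card (E t) = (c t :: nat)) \<and> disjoint_family_on E T"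
proof -
  have "(\<Sum>t\<in>{t\<in>T. () = l}. c t) \<le> card {e\<in>S. () = l}" for l using assms by simp
  from disjoint_choice[where f="\<lambda>_. ()" and q="\<lambda>_. ()" and c=c, OF assms(1,2) this] show ?thesis by auto
qed

text \<open>The integer problem behind the distribution of the cross edges. Packet \<open>v\<close> consists of \<open>D v\<close>
  edges and gives \<open>c v\<close> of them to each of \<open>k\<close> parts with \<open>2 * t\<close> edges; a packet that gives
  anything has to keep \<open>s\<close> edges in reserve. The packets in \<open>Bg\<close> come from single vertices of
  degree \<open>d v\<close>, which may have degree at most \<open>t\<close> in each part and at most \<open>r\<close> in the rest.

  These conditions are lower bounds \<open>l\<close> and upper bounds \<open>u\<close> for \<open>c\<close>. The lower bounds sum to at
  most \<open>2 * t\<close>: each is at most \<open>t\<close>, since \<open>d v \<le> h = k * t + r\<close>, and three positive ones would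
  leave about \<open>3 * r\<close> in the rest, more than the \<open>2 * r\<close> that it holds. The upper bounds sum to
  at least \<open>2 * t\<close>: this is clear if \<open>t\<close> is the bound for two packets; if it is the bound for
  only one, the others still hold about \<open>h\<close> edges.\<close>

lemma packet_sizes:
  fixes D d :: "'i \<Rightarrow> nat" and h k t r s x X :: nat
  assumes fin: "finite I" and Bg: "Bg \<subseteq> I" and k: "k > 0"
    and d: "\<And>v. v \<in> Bg \<Longrightarrow> D v \<le> d v \<and> d v \<le> D v + x \<and> d v \<le> h"
    and tot: "sum D I \<le> 2 * h" "2 * h \<le> sum D I + X"
    and h: "h = k * t + r"
    and slack: "card I * (s + k + x) + X + 3 * k \<le> r"
    and s: "s + x \<le> r"
  shows "\<exists>c. sum c I = 2 * t \<and> (\<forall>v\<in>I. c v = 0 \<or> k * c v + s \<le> D v)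
          \<and> (\<forall>v\<in>Bg. c v \<le> t \<and> d v \<le> k * c v + r)"
proof -
  define u0 where "u0 v = (D v - s) div k" for v
  define u where "u v = (if v \<in> Bg then min t (u0 v) else u0 v)" for v
  define l where "l v = (if v \<in> Bg then (d v - r + (k - 1)) div k else 0)" for v
  have finB: "finite Bg" using fin Bg finite_subset by blast
  have u0: "D v \<le> k * u0 v + s + k" for v
  proof -
    have "D v - s = k * u0 v + (D v - s) mod k" unfolding u0_def by simp
    moreover have "(D v - s) mod k < k" using k by simp
    ultimately show ?thesis by linarith
  qed
  have u0': "u0 v = 0 \<or> k * u0 v + s \<le> D v" for v
  proof -
    have "k * u0 v \<le> D v - s" unfolding u0_def by simp
    moreover have "k * u0 v = 0 \<longleftrightarrow> u0 v = 0" using k by simp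
    ultimately show ?thesis by linarith
  qed
  have l1: "d v - r \<le> k * l v" "k * l v \<le> d v - r + (k - 1)" if "v \<in> Bg" for v
  proof -
    have "d v - r + (k - 1) = k * l v + (d v - r + (k - 1)) mod k" unfolding l_def using that by simp
    moreover have "(d v - r + (k - 1)) mod k < k" using k by simp
    ultimately show "d v - r \<le> k * l v" "k * l v \<le> d v - r + (k - 1)" by linarith+
  qed
  have lt: "l v \<le> t" if "v \<in> Bg" for v
  proof -
    have "k * l v \<le> k * t + (k - 1)" using l1(2)[OF that] d[OF that] h by linarith
    then have "k * l v < k * (t + 1)" using k by (simp add: algebra_simps)
    then show ?thesis using k by (metis Suc_eq_plus1 less_Suc_eq_le nat_mult_less_cancel1)
  qed
  have lu0: "l v \<le> u0 v" if "v \<in> Bg" for v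
  proof (cases "d v \<le> r")
    case True
    then have "l v = 0" unfolding l_def using k by simp
    then show ?thesis by simp
  next
    case False
    have "I \<noteq> {}" using that Bg by auto
    then have "1 \<le> card I" using fin by (simp add: Suc_leI card_gt_0_iff)
    then have "s + k + x \<le> card I * (s + k + x)" by simp
    then have "s + x + 4 * k \<le> r" using slack by linarith
    then have "k * l v \<le> D v - s" using l1(2)[OF that] False d[OF that] k by linarith
    then show ?thesis unfolding u0_def using k
      by (metis div_le_mono nonzero_mult_div_cancel_left not_gr_zero)
  qed
  have lu: "l v \<le> u v" if "v \<in> I" for v
    using lt lu0 unfolding u_def by (auto simp: l_def)
  have "sum l I \<le> 2 * t"
  proof -
    define P where "P = {v \<in> Bg. l v > 0}"
    have P: "P \<subseteq> I" "finite P" "P \<subseteq> Bg" using Bg fin finB unfolding P_def by auto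
    have sP: "sum l I = sum l P"
      using P fin by (intro sum.mono_neutral_right) (auto simp: P_def l_def)
    show ?thesis
    proof (cases "card P \<le> 2")
      case True
      have "sum l P \<le> card P * t" using sum_bounded_above[of P l t] lt P(3) by auto
      also have "\<dots> \<le> 2 * t" using True by simp
      finally show ?thesis using sP by simp
    next
      case False
      have a: "k * l v + (r - k) \<le> D v + x" if "v \<in> P" for v
      proof -
        have v: "v \<in> Bg" "l v > 0" using that P_def by auto
        have "d v > r"
        proof (rule ccontr)
          assume "\<not> d v > r"
          then have "l v = 0" unfolding l_def using k by simp
          then show False using v by simp
        qed
        then show ?thesis using l1(2)[OF v(1)] d[OF v(1)] slack by linarith
      qed
      have "k * sum l P + card P * (r - k) \<le> sum D P + card P * x"
        using sum_mono[of P "\<lambda>v. k * l v + (r - k)" "\<lambda>v. D v + x"] a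
        by (simp add: sum.distrib sum_distrib_left)
      moreover have "sum D P \<le> sum D I" using P fin by (intro sum_mono2) auto
      moreover have "card P * x \<le> card I * (s + k + x)"
        using card_mono[OF fin P(1)] by (intro mult_mono) auto
      moreover have "3 * (r - k) \<le> card P * (r - k)" using False by (intro mult_right_mono) auto
      ultimately have "k * sum l P \<le> 2 * (k * t)" using slack h tot by linarith
      then show ?thesis using k sP by simp
    qed
  qed
  moreover have "2 * t \<le> sum u I"
  proof -
    define C where "C = {v \<in> Bg. t \<le> u0 v}"
    have C: "C \<subseteq> I" "finite C" using Bg fin finB unfolding C_def by auto
    have uC: "u v = t" if "v \<in> C" for v using that unfolding C_def u_def by auto
    have unC: "u v = u0 v" if "v \<notin> C" for v using that unfolding C_def u_def by auto
    have b: "sum D (I - C) \<le> k * sum u (I - C) + card I * (s + k + x)"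
    proof -
      have "sum D (I - C) \<le> (\<Sum>v\<in>I - C. k * u v + (s + k))"
        using u0 unC by (intro sum_mono) (simp add: add.assoc)
      also have "\<dots> = k * sum u (I - C) + card (I - C) * (s + k)"
        by (simp add: sum.distrib sum_distrib_left)
      also have "card (I - C) * (s + k) \<le> card I * (s + k + x)"
        using card_mono[OF fin, of "I - C"] by (intro mult_mono) auto
      finally show ?thesis by simp
    qed
    have sU: "sum u I = sum u C + sum u (I - C)" "sum D I = sum D C + sum D (I - C)"
      using C fin by (metis add.commute sum.subset_diff)+
    have uCt: "sum u C = card C * t" using uC by simp
    consider "card C = 0" | "card C = 1" | "card C \<ge> 2" by linarith
    then show ?thesis
    proof cases
      case 1
      then have "C = {}" using C by simp
      then have "sum D I \<le> k * sum u I + card I * (s + k + x)" using b by simp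
      then have "k * (2 * t) \<le> k * sum u I" using tot slack h by linarith
      then show ?thesis using k by simp
    next
      case 2
      then obtain v where v: "C = {v}" by (auto simp: card_1_singleton_iff)
      have "D v \<le> h" using d[of v] v unfolding C_def by fastforce
      then have "sum D I \<le> h + (k * sum u (I - C) + card I * (s + k + x))" using b sU(2) v by simp
      then have "h \<le> k * sum u (I - C) + r" using tot slack by linarith
      then have "k * t \<le> k * sum u (I - C)" using h by simp
      then have "t \<le> sum u (I - C)" using k by simp
      then show ?thesis using sU uCt 2 by simp
    next
      case 3
      then have "2 * t \<le> sum u C" unfolding uCt by (intro mult_right_mono) auto
      then show ?thesis using sU by simp
    qed
  qed
  ultimately obtain c where c: "\<forall>i\<in>I. l i \<le> c i \<and> c i \<le> u i" "sum c I = 2 * t"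
    using sum_between[OF fin, of l u "2 * t"] lu by blast
  have "c v = 0 \<or> k * c v + s \<le> D v" if "v \<in> I" for v
  proof -
    have "c v \<le> u0 v" using c(1) that unfolding u_def by (force split: if_splits)
    then have "k * c v \<le> k * u0 v" by simp
    then show ?thesis using u0'[of v] \<open>c v \<le> u0 v\<close> by linarith
  qed
  moreover have "c v \<le> t \<and> d v \<le> k * c v + r" if "v \<in> Bg" for v
  proof -
    have vI: "v \<in> I" using that Bg by auto
    have "c v \<le> t" using c(1) vI that unfolding u_def by (force split: if_splits)
    moreover have "k * l v \<le> k * c v" using c(1) vI by simp
    ultimately show ?thesis using l1(1)[OF that] by linarith
  qed
  ultimately show ?thesis using c(2) by blast
qed

section \<open>Switching arguments\<close>

lemma card_fibre_transpose:
  assumes "x \<in> X" "x' \<in> X"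
  shows "card {y\<in>X. (col \<circ> transpose x x') y = k} = card {y\<in>X. col y = k}"
proof -
  have "{y\<in>X. (col \<circ> transpose x x') y = k} = transpose x x' ` {y\<in>X. col y = k}"
  proof (intro set_eqI iffI)
    fix y assume "y \<in> {y\<in>X. (col \<circ> transpose x x') y = k}"
    then have "transpose x x' y \<in> {y\<in>X. col y = k}"
      using assms by (auto simp: transpose_def)
    then show "y \<in> transpose x x' ` {y\<in>X. col y = k}"
      by (metis image_eqI transpose_involutory)
  next
    fix y assume "y \<in> transpose x x' ` {y\<in>X. col y = k}"
    then show "y \<in> {y\<in>X. (col \<circ> transpose x x') y = k}"
      using assms by (auto simp: transpose_def)
  qed
  moreover have "inj_on (transpose x x') {y\<in>X. col y = k}"
    by (rule inj_onI) (metis transpose_involutory)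
  ultimately show ?thesis by (simp only: card_image)
qed

lemma fibre_function:
  assumes "finite X" "finite C" "(\<Sum>k\<in>C. r k) = card X"
  shows "\<exists>col. (\<forall>x\<in>X. col x \<in> C) \<and> (\<forall>k\<in>C. card {x\<in>X. col x = k} = (r k :: nat))"
proof -
  obtain E where E: "\<forall>k\<in>C. E k \<subseteq> X \<and> card (E k) = r k" "disjoint_family_on E C"
    using disjoint_subsets_of_sizes[OF assms(2,1), of r] assms(3) by auto
  have fE: "finite (E k)" if "k \<in> C" for k using E that assms(1) finite_subset by blast
  have "card (\<Union>k\<in>C. E k) = (\<Sum>k\<in>C. card (E k))"
    using E(2) fE assms(2) by (intro card_UN_disjoint) (auto simp: disjoint_family_on_def)
  also have "\<dots> = card X" using E assms(3) by simp
  finally have U: "(\<Union>k\<in>C. E k) = X" using E assms(1) by (intro card_subset_eq) auto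
  define col where "col x = (SOME k. k \<in> C \<and> x \<in> E k)" for x
  have col: "col x \<in> C \<and> x \<in> E (col x)" if "x \<in> X" for x
    using that U unfolding col_def by (metis (mono_tags, lifting) UN_E someI_ex)
  have "{x\<in>X. col x = k} = E k" if "k \<in> C" for k
    using col E that unfolding disjoint_family_on_def by blast
  then show ?thesis using col E by (intro exI[of _ col]) auto
qed

text \<open>Among the colourings with the prescribed class sizes, one with the fewest bad points has none:
  at most \<open>p + q\<close> points are unsuitable for exchanging colours with a bad point \<open>x\<close>, so some
  exchange repairs \<open>x\<close> and spoils nothing.\<close>

lemma colouring_avoiding:
  fixes bad :: "'x \<Rightarrow> 'c \<Rightarrow> bool"
  assumes fX: "finite X" and fC: "finite C" and sum: "(\<Sum>k\<in>C. r k) = card X"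
    and p: "\<And>x. x \<in> X \<Longrightarrow> (\<Sum>k\<in>{k\<in>C. bad x k}. r k) \<le> p"
    and q: "\<And>k. k \<in> C \<Longrightarrow> card {x\<in>X. bad x k} \<le> q"
    and pq: "p + q < card X"
  shows "\<exists>col. (\<forall>x\<in>X. col x \<in> C \<and> \<not> bad x (col x)) \<and> (\<forall>k\<in>C. card {x\<in>X. col x = k} = (r k :: nat))"
proof -
  define good where "good col \<longleftrightarrow> (\<forall>x\<in>X. col x \<in> C) \<and> (\<forall>k\<in>C. card {x\<in>X. col x = k} = r k)" for col
  define B where "B col = {x\<in>X. bad x (col x)}" for col
  obtain col where col: "good col" "\<And>col'. good col' \<Longrightarrow> card (B col) \<le> card (B col')"
    using fibre_function[OF fX fC sum] ex_has_least_nat[of good _ "\<lambda>col. card (B col)"]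
    unfolding good_def by blast
  have "\<not> bad x (col x)" if x: "x \<in> X" for x
  proof
    assume bx: "bad x (col x)"
    define Y1 where "Y1 = {y\<in>X. bad x (col y)}"
    define Y2 where "Y2 = {y\<in>X. bad y (col x)}"
    have "Y1 = (\<Union>k\<in>{k\<in>C. bad x k}. {y\<in>X. col y = k})"
      using col(1) unfolding Y1_def good_def by auto
    then have "card Y1 \<le> (\<Sum>k\<in>{k\<in>C. bad x k}. card {y\<in>X. col y = k})"
      using fC card_UN_le[of "{k\<in>C. bad x k}"] by auto
    also have "\<dots> = (\<Sum>k\<in>{k\<in>C. bad x k}. r k)"
      using col(1) unfolding good_def by (intro sum.cong) auto
    finally have "card Y1 \<le> p" using p[OF x] by linarith
    moreover have "card Y2 \<le> q" using q[of "col x"] col(1) x unfolding Y2_def good_def by auto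
    ultimately have "card (Y1 \<union> Y2) < card X" using pq card_Un_le[of Y1 Y2] by linarith
    moreover have "finite (Y1 \<union> Y2)" using fX unfolding Y1_def Y2_def by auto
    ultimately have "\<not> X \<subseteq> Y1 \<union> Y2" using card_mono leD by blast
    then obtain y where y: "y \<in> X" "y \<notin> Y1" "y \<notin> Y2" by blast
    define col' where "col' = col \<circ> transpose x y"
    have "good col'"
      using col(1) card_fibre_transpose[OF x y(1), of col] x y(1)
      unfolding good_def col'_def by (auto simp: transpose_def)
    moreover have "B col' \<subset> B col"
    proof -
      have "x \<in> B col" using x bx unfolding B_def by auto
      moreover have "x \<notin> B col'" using y unfolding B_def col'_def Y1_def by auto
      moreover have "y \<notin> B col'" using y x unfolding B_def col'_def Y2_def by auto
      moreover have "z \<in> B col" if "z \<in> B col'" "z \<noteq> x" "z \<noteq> y" for z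
        using that unfolding B_def col'_def by (auto simp: transpose_def)
      ultimately show ?thesis by blast
    qed
    moreover have "finite (B col)" using fX unfolding B_def by auto
    ultimately show False using col(2)[of col'] psubset_card_mono by (metis leD)
  qed
  then show ?thesis using col(1) unfolding good_def by blast
qed

text \<open>With \<open>fst\<close> and \<open>snd\<close> for \<open>\<alpha>\<close> and \<open>\<beta>\<close> this says that the edges of a bipartite graph in \<open>F\<close> form a
  matching. The maps are left abstract so that the two vertex classes can be interchanged.\<close>

definition matched :: "('e \<Rightarrow> 'v) \<Rightarrow> ('e \<Rightarrow> 'w) \<Rightarrow> 'e set \<Rightarrow> bool" where
  "matched \<alpha> \<beta> F \<longleftrightarrow> (\<forall>e\<in>F. \<forall>f\<in>F. e \<noteq> f \<longrightarrow> \<alpha> e \<noteq> \<alpha> f \<and> \<beta> e \<noteq> \<beta> f)"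

lemma matched_commute: "matched \<alpha> \<beta> F \<longleftrightarrow> matched \<beta> \<alpha> F"
  unfolding matched_def by auto

text \<open>Let \<open>f\<close> and \<open>g\<close> be a pair with a common end \<open>v\<close>. Since \<open>v\<close> is on at most \<open>s\<close> edges, some other
  pair \<open>p, q\<close> avoids \<open>v\<close>. Then \<open>f, p\<close> and \<open>g, q\<close> can only intersect at their other ends, and one
  of the two ways of naming the edges \<open>p\<close> and \<open>q\<close> makes both new pairs disjoint, unless \<open>p\<close> and
  \<open>q\<close> intersect themselves; in that case two intersecting pairs become at most one.\<close>

lemma repairing_step:
  fixes \<alpha> :: "'e \<Rightarrow> 'v" and \<beta> :: "'e \<Rightarrow> 'w"
  assumes fS: "finite S" and inj: "\<And>e f. e \<in> S \<Longrightarrow> f \<in> S \<Longrightarrow> \<alpha> e = \<alpha> f \<Longrightarrow> \<beta> e = \<beta> f \<Longrightarrow> e = f"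
    and d: "\<And>v. card {e\<in>S. \<alpha> e = v} \<le> s"
    and rng: "\<And>e. e \<in> S \<Longrightarrow> col e < s"
    and two: "\<And>j. j < s \<Longrightarrow> card {e\<in>S. col e = j} = 2"
    and fg: "f \<in> S" "g \<in> S" "f \<noteq> g" "col f = col g" "\<alpha> f = \<alpha> g"
  shows "\<exists>p\<in>S. {j. j < s \<and> \<not> matched \<alpha> \<beta> {e\<in>S. (col \<circ> transpose g p) e = j}}
               \<subset> {j. j < s \<and> \<not> matched \<alpha> \<beta> {e\<in>S. col e = j}}"
proof -
  define F where "F c j = {e\<in>S. c e = j}" for c :: "'e \<Rightarrow> nat" and j
  define Bad where "Bad c = {j. j < s \<and> \<not> matched \<alpha> \<beta> (F c j)}" for c
  define j where "j = col f"
  have js: "j < s" using rng fg j_def by auto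
  have Fj: "F col j = {f, g}"
    using two[OF js] fg unfolding F_def j_def
    by (intro card_subset_eq[symmetric]) (auto simp: fS)
  have jbad: "j \<in> Bad col" using js Fj fg unfolding Bad_def matched_def by auto
  have bfg: "\<beta> f \<noteq> \<beta> g" using inj fg by blast
  \<comment> \<open>Apart from \<open>f\<close> and \<open>g\<close> at most \<open>s - 2\<close> edges meet their common end, so one of the other \<open>s - 1\<close> pairs avoids it.\<close>
  define Y where "Y = {e\<in>S. \<alpha> e = \<alpha> f} - {g}"
  have "card Y < card {e\<in>S. \<alpha> e = \<alpha> f}" unfolding Y_def
    by (rule card_Diff1_less) (use fg fS in auto)
  then have "card Y < s" using d[of "\<alpha> f"] by linarith
  then have "card (col ` Y) < card {..<s}"
    using card_image_le[of Y col] fS unfolding Y_def by auto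
  moreover have "finite (col ` Y)" using fS unfolding Y_def by auto
  ultimately have "\<not> {..<s} \<subseteq> col ` Y" using card_mono leD by blast
  then obtain i where i: "i < s" "i \<notin> col ` Y" by blast
  have fY: "f \<in> Y" using fg unfolding Y_def by auto
  then have ij: "i \<noteq> j" using i(2) unfolding j_def by blast
  obtain p0 q0 where pq0: "F col i = {p0, q0}" "p0 \<noteq> q0"
    using two[OF i(1)] unfolding F_def by (auto simp: card_2_iff)
  have av: "\<alpha> e \<noteq> \<alpha> f" if "e \<in> F col i" for e
    using that i ij fg unfolding F_def Y_def j_def by auto
  have "\<exists>p q. F col i = {p, q} \<and> p \<noteq> q \<and>
       ((\<beta> f \<noteq> \<beta> p \<and> \<beta> g \<noteq> \<beta> q) \<or> (\<beta> p = \<beta> q \<and> (\<beta> f \<noteq> \<beta> p \<or> \<beta> g \<noteq> \<beta> q)))"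
  proof (cases "(\<beta> f \<noteq> \<beta> p0 \<and> \<beta> g \<noteq> \<beta> q0) \<or> (\<beta> p0 = \<beta> q0 \<and> (\<beta> f \<noteq> \<beta> p0 \<or> \<beta> g \<noteq> \<beta> q0))")
    case True
    then show ?thesis using pq0 by blast
  next
    case False
    then have "\<beta> f \<noteq> \<beta> q0 \<and> \<beta> g \<noteq> \<beta> p0" using bfg by metis
    then show ?thesis using pq0 by (intro exI[of _ q0] exI[of _ p0]) auto
  qed
  then obtain p q where pq: "F col i = {p, q}" "p \<noteq> q"
    and cs: "(\<beta> f \<noteq> \<beta> p \<and> \<beta> g \<noteq> \<beta> q) \<or> (\<beta> p = \<beta> q \<and> (\<beta> f \<noteq> \<beta> p \<or> \<beta> g \<noteq> \<beta> q))" by blast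
  have pS: "p \<in> S" "q \<in> S" "col p = i" "col q = i" using pq unfolding F_def by auto
  have apq: "\<alpha> p \<noteq> \<alpha> f" "\<alpha> q \<noteq> \<alpha> f" using av pq by auto
  have ne: "p \<noteq> f" "p \<noteq> g" "q \<noteq> f" "q \<noteq> g" using apq fg by auto
  define col' where "col' = col \<circ> transpose g p"
  have col': "col' e = (if e = g then i else if e = p then j else col e)" for e
    unfolding col'_def using pS fg by (auto simp: transpose_def j_def)
  have F': "F col' j = {f, p}" "F col' i = {g, q}"
  proof -
    have "e \<in> F col' j \<longleftrightarrow> e = f \<or> e = p" for e
      using Fj pS ij fg unfolding F_def col' j_def by auto
    then show "F col' j = {f, p}" by auto
    have "e \<in> F col' i \<longleftrightarrow> e = g \<or> e = q" for e
    proof -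
      have "e \<in> F col i \<longleftrightarrow> e = p \<or> e = q" using pq by auto
      then show ?thesis using pS ij fg ne pq(2) unfolding F_def col' j_def by auto
    qed
    then show "F col' i = {g, q}" by auto
  qed
  have Fo: "F col' l = F col l" if "l \<noteq> i" "l \<noteq> j" for l
    using that pS fg unfolding F_def col' j_def by auto
  have mj: "matched \<alpha> \<beta> (F col' j) \<longleftrightarrow> \<beta> f \<noteq> \<beta> p"
    unfolding F' matched_def using apq ne by auto
  have mi: "matched \<alpha> \<beta> (F col' i) \<longleftrightarrow> \<beta> g \<noteq> \<beta> q"
    unfolding F' matched_def using apq ne fg by auto
  have ibad: "\<beta> p = \<beta> q \<Longrightarrow> i \<in> Bad col"
    using pq i unfolding Bad_def matched_def by auto
  have "Bad col' \<subset> Bad col"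
  proof -
    have "Bad col' - {i, j} = Bad col - {i, j}" using Fo unfolding Bad_def by auto
    moreover have "i \<in> Bad col' \<longleftrightarrow> \<not> \<beta> g \<noteq> \<beta> q" "j \<in> Bad col' \<longleftrightarrow> \<not> \<beta> f \<noteq> \<beta> p"
      using mi mj i js unfolding Bad_def by auto
    ultimately show ?thesis using cs ibad jbad by blast
  qed
  then show ?thesis using pS(1) unfolding Bad_def F_def col'_def by auto
qed

lemma matching_pairs_exact:
  fixes \<alpha> :: "'e \<Rightarrow> 'v" and \<beta> :: "'e \<Rightarrow> 'w"
  assumes fS: "finite S" and inj: "\<And>e f. e \<in> S \<Longrightarrow> f \<in> S \<Longrightarrow> \<alpha> e = \<alpha> f \<Longrightarrow> \<beta> e = \<beta> f \<Longrightarrow> e = f"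
    and d: "\<And>v. card {e\<in>S. \<alpha> e = v} \<le> s" "\<And>w. card {e\<in>S. \<beta> e = w} \<le> s"
    and card: "card S = 2 * s"
  shows "\<exists>col. (\<forall>e\<in>S. col e < s) \<and> (\<forall>j<s. card {e\<in>S. col e = j} = 2 \<and> matched \<alpha> \<beta> {e\<in>S. col e = j})"
proof -
  define good where "good col \<longleftrightarrow> (\<forall>e\<in>S. col e \<in> {..<s}) \<and> (\<forall>j\<in>{..<s}. card {e\<in>S. col e = j} = 2)" for col
  define Bad where "Bad col = {j. j < s \<and> \<not> matched \<alpha> \<beta> {e\<in>S. col e = j}}" for col
  have fB: "finite (Bad col)" for col unfolding Bad_def by auto
  have "\<exists>col. good col"
    using fibre_function[OF fS, of "{..<s}" "\<lambda>_. 2"] card unfolding good_def by auto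
  then obtain col where col: "good col" "\<And>col'. good col' \<Longrightarrow> card (Bad col) \<le> card (Bad col')"
    using ex_has_least_nat[of good _ "\<lambda>col. card (Bad col)"] by blast
  have sw: "good (col \<circ> transpose g p)" if "g \<in> S" "p \<in> S" for g p
    using col(1) card_fibre_transpose[OF that, of col] that
    unfolding good_def by (auto simp: transpose_def)
  have no: False if "p \<in> S" "g \<in> S" "Bad (col \<circ> transpose g p) \<subset> Bad col" for p g
    using col(2)[OF sw[OF that(2,1)]] psubset_card_mono[OF fB that(3)] by linarith
  have "matched \<alpha> \<beta> {e\<in>S. col e = j}" if "j < s" for j
  proof (rule ccontr)
    assume "\<not> matched \<alpha> \<beta> {e\<in>S. col e = j}"
    then obtain f g where fg: "f \<in> S" "g \<in> S" "f \<noteq> g" "col f = col g" "\<alpha> f = \<alpha> g \<or> \<beta> f = \<beta> g"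
      unfolding matched_def by auto
    show False
    proof (cases "\<alpha> f = \<alpha> g")
      case True
      have "\<exists>p\<in>S. Bad (col \<circ> transpose g p) \<subset> Bad col"
        unfolding Bad_def
        by (rule repairing_step[where f=f and g=g and S=S and s=s and col=col])
          (use fS inj d fg True col(1) in \<open>auto simp: good_def\<close>)
      then show False using no fg(2) by blast
    next
      case False
      have "\<exists>p\<in>S. Bad (col \<circ> transpose g p) \<subset> Bad col"
        unfolding Bad_def matched_commute[of \<alpha> \<beta>]
        by (rule repairing_step[where f=f and g=g and S=S and s=s and col=col])
          (use fS inj d fg False col(1) in \<open>auto simp: good_def\<close>)
      then show False using no fg(2) by blast
    qed
  qed
  then show ?thesis using col(1) unfolding good_def by (intro exI[of _ col]) auto
qed

lemma matching_pairs:
  fixes \<alpha> :: "'e \<Rightarrow> 'v" and \<beta> :: "'e \<Rightarrow> 'w"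
  assumes fS: "finite S" and inj: "\<And>e f. e \<in> S \<Longrightarrow> f \<in> S \<Longrightarrow> \<alpha> e = \<alpha> f \<Longrightarrow> \<beta> e = \<beta> f \<Longrightarrow> e = f"
    and d: "\<And>v. card {e\<in>S. \<alpha> e = v} \<le> s" "\<And>w. card {e\<in>S. \<beta> e = w} \<le> s"
    and card: "card S = 2 * s" and C: "finite C" "s \<le> card C"
  shows "\<exists>col. (\<forall>e\<in>S. col e \<in> C) \<and> (\<forall>k\<in>C. card {e\<in>S. col e = k} \<in> {0, 2} \<and> matched \<alpha> \<beta> {e\<in>S. col e = k})"
proof -
  obtain col where col: "\<forall>e\<in>S. col e < s" 
    "\<forall>j<s. card {e\<in>S. col e = j} = 2 \<and> matched \<alpha> \<beta> {e\<in>S. col e = j}"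
    using matching_pairs_exact[OF assms(1-5)] by blast
  obtain C' where C': "C' \<subseteq> C" "card C' = s" using C by (meson obtain_subset_with_card_n)
  then obtain g where g: "bij_betw g {..<s} C'"
    using C(1) finite_subset by (metis ex_bij_betw_nat_finite lessThan_atLeast0)
  have "card {e\<in>S. g (col e) = k} \<in> {0, 2} \<and> matched \<alpha> \<beta> {e\<in>S. g (col e) = k}" for k
  proof (cases "k \<in> C'")
    case True
    then obtain j where j: "j < s" "g j = k" using g unfolding bij_betw_def by auto
    have "{e\<in>S. g (col e) = k} = {e\<in>S. col e = j}"
      using j g col(1) unfolding bij_betw_def inj_on_def by auto
    then show ?thesis using col(2) j by simp
  next
    case False
    then have e: "{e\<in>S. g (col e) = k} = {}" using g col(1) unfolding bij_betw_def by auto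
    show ?thesis unfolding e by (simp add: matched_def)
  qed
  moreover have "\<forall>e\<in>S. g (col e) \<in> C" using g col(1) C' unfolding bij_betw_def by auto
  ultimately show ?thesis by (intro exI[of _ "\<lambda>e. g (col e)"]) auto
qed

section \<open>Sharing out the cross edges\<close>

text \<open>The degree of \<open>v\<close>, if \<open>S\<close> is a set of oriented edges and \<open>\<pi>\<close> selects one of the two ends. Having
  \<open>\<pi>\<close> as a parameter lets one argument serve both sides.\<close>

definition incid :: "('a \<times> 'a \<Rightarrow> 'a) \<Rightarrow> ('a \<times> 'a) set \<Rightarrow> 'a \<Rightarrow> nat" where
  "incid \<pi> S v = card {e\<in>S. \<pi> e = v}"

abbreviation "fdeg \<equiv> incid fst"

abbreviation "sdeg \<equiv> incid snd"

abbreviation cells :: "nat \<Rightarrow> (nat \<times> nat) set" where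
  "cells K \<equiv> {1..K} \<times> {1..K}"

text \<open>The cross edge \<open>e\<close> may receive a colour reserved for the pair of clusters \<open>\<tau>\<close>. Here \<open>a\<close> and \<open>b\<close>
  give the cluster index of a vertex, and index 0 stands for the exceptional vertices, which are
  allowed in every part.\<close>

definition fits :: "('a \<Rightarrow> nat) \<Rightarrow> ('a \<Rightarrow> nat) \<Rightarrow> nat \<times> nat \<Rightarrow> 'a \<times> 'a \<Rightarrow> bool" where
  "fits a b \<tau> e \<longleftrightarrow> a (fst e) \<in> {0, fst \<tau>} \<and> b (snd e) \<in> {0, snd \<tau>}"

lemma incid_mono: "finite S \<Longrightarrow> R \<subseteq> S \<Longrightarrow> incid \<pi> R v \<le> incid \<pi> S v"
  unfolding incid_def by (intro card_mono) auto

lemma card_cells: "card (cells K) = K^2"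
  by (simp add: card_cartesian_product power2_eq_square)

lemma card_cells_line:
  assumes "q = fst \<or> q = snd" "i \<in> {1..K}" shows "card {\<tau>\<in>cells K. q \<tau> = i} = K"
proof -
  have "{\<tau>\<in>cells K. q \<tau> = i} = {i} \<times> {1..K} \<or> {\<tau>\<in>cells K. q \<tau> = i} = {1..K} \<times> {i}"
    using assms by auto
  then show ?thesis by (auto simp: card_cartesian_product)
qed

text \<open>From \<open>D\<close> every pair of clusters can be given any number \<open>c\<close> of fitting edges, as long as \<open>s\<close>
  edges are kept in reserve. The case \<open>c = 0\<close> is separate because \<open>D\<close> may have fewer than \<open>s\<close>
  edges.\<close>

definition spreadable :: "nat \<Rightarrow> ('a \<Rightarrow> nat) \<Rightarrow> ('a \<Rightarrow> nat) \<Rightarrow> nat \<Rightarrow> ('a \<times> 'a) set \<Rightarrow> bool" where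
  "spreadable K a b s D \<longleftrightarrow> (\<forall>c. c = 0 \<or> K^2 * c + s \<le> card D \<longrightarrow>
     (\<exists>E. (\<forall>\<tau>\<in>cells K. E \<tau> \<subseteq> D \<and> card (E \<tau>) = c \<and> (\<forall>e\<in>E \<tau>. fits a b \<tau> e))
        \<and> disjoint_family_on E (cells K)))"

text \<open>The labels \<open>f\<close> and \<open>q\<close> record which clusters an edge of \<open>D\<close> has to respect: none for edges
  between exceptional vertices, one or two for the others. Pairs of clusters with different
  labels draw on disjoint sets of edges.\<close>

lemma spreadable_by_label:
  assumes "finite D"
    and fit: "\<And>e \<tau>. e \<in> D \<Longrightarrow> \<tau> \<in> cells K \<Longrightarrow> f e = q \<tau> \<Longrightarrow> fits a b \<tau> e"
    and cell: "\<And>c \<tau>. \<tau> \<in> cells K \<Longrightarrow> K^2 * c + s \<le> card D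
          \<Longrightarrow> card {\<sigma>\<in>cells K. q \<sigma> = q \<tau>} * c \<le> card {e\<in>D. f e = q \<tau>}"
  shows "spreadable K a b s D"
  unfolding spreadable_def
proof (intro allI impI)
  fix c assume c: "c = 0 \<or> K^2 * c + s \<le> card D"
  let ?T = "cells K"
  have "(\<Sum>t\<in>{t\<in>?T. q t = l}. c) \<le> card {e\<in>D. f e = l}" for l
  proof (cases "\<exists>\<tau>\<in>?T. q \<tau> = l")
    case True
    then show ?thesis using cell[of _ c] c by auto
  next
    case False
    then have "{t\<in>?T. q t = l} = {}" by auto
    then show ?thesis by (simp only: sum.empty)
  qed
  from disjoint_choice[where T="?T" and S=D and q=q and c="\<lambda>_. c" and f=f, OF _ assms(1) this]
  obtain E where "\<forall>t\<in>?T. E t \<subseteq> {e \<in> D. f e = q t} \<and> card (E t) = c" "disjoint_family_on E ?T"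
    by auto
  then show "\<exists>E. (\<forall>\<tau>\<in>?T. E \<tau> \<subseteq> D \<and> card (E \<tau>) = c \<and> (\<forall>e\<in>E \<tau>. fits a b \<tau> e)) \<and> disjoint_family_on E ?T"
    using fit by (intro exI[of _ E]) blast
qed

lemma spreadable_00:
  assumes "finite D" "\<And>e. e \<in> D \<Longrightarrow> a (fst e) = 0 \<and> b (snd e) = 0"
  shows "spreadable K a b s D"
  by (rule spreadable_by_label[where f="\<lambda>_. ()" and q="\<lambda>_. ()"])
    (use assms in \<open>auto simp: fits_def power2_eq_square\<close>)

lemma spreadable_one_side:
  assumes "finite D" and q: "q = fst \<or> q = snd"
    and "\<And>e \<tau>. e \<in> D \<Longrightarrow> \<tau> \<in> cells K \<Longrightarrow> f e = q \<tau> \<Longrightarrow> fits a b \<tau> e"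
    and bal: "\<And>j. j \<in> {1..K} \<Longrightarrow> card D \<le> K * card {e\<in>D. f e = j} + s"
  shows "spreadable K a b s D"
proof (rule spreadable_by_label[where f=f and q=q])
  fix c and \<tau> :: "nat \<times> nat"
  assume \<tau>: "\<tau> \<in> cells K" and c: "K\<^sup>2 * c + s \<le> card D"
  have q\<tau>: "q \<tau> \<in> {1..K}" using \<tau> q by auto
  have "K\<^sup>2 * c = K * (K * c)" by (simp add: power2_eq_square)
  then have "K * (K * c) \<le> K * card {e\<in>D. f e = q \<tau>}" using c bal[OF q\<tau>] by linarith
  moreover have "K > 0" using \<tau> by auto
  ultimately show "card {\<sigma> \<in> cells K. q \<sigma> = q \<tau>} * c \<le> card {e \<in> D. f e = q \<tau>}"
    using card_cells_line[OF q q\<tau>] by simp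
qed (use assms in auto)

lemma spreadable_AB:
  assumes "finite D"
    and "\<And>i j. i \<in> {1..K} \<Longrightarrow> j \<in> {1..K} \<Longrightarrow> card D \<le> K^2 * card {e\<in>D. a (fst e) = i \<and> b (snd e) = j} + s"
  shows "spreadable K a b s D"
proof (rule spreadable_by_label[where f="\<lambda>e. (a (fst e), b (snd e))" and q="\<lambda>\<tau>. \<tau>"])
  fix c and \<tau> :: "nat \<times> nat"
  assume \<tau>: "\<tau> \<in> cells K" and c: "K\<^sup>2 * c + s \<le> card D"
  have "{\<sigma> \<in> cells K. \<sigma> = \<tau>} = {\<tau>}" using \<tau> by auto
  then have k: "card {\<sigma> \<in> cells K. \<sigma> = \<tau>} = 1" by simp
  obtain i j where ij: "\<tau> = (i, j)" by (cases \<tau>)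
  have "card D \<le> K^2 * card {e\<in>D. a (fst e) = i \<and> b (snd e) = j} + s"
    using assms(2)[of i j] \<tau> ij by auto
  then have "K^2 * c \<le> K^2 * card {e\<in>D. a (fst e) = i \<and> b (snd e) = j}" using c by linarith
  moreover have "K^2 > 0" using \<tau> by auto
  ultimately show "card {\<sigma> \<in> cells K. \<sigma> = \<tau>} * c \<le> card {e \<in> D. (a (fst e), b (snd e)) = \<tau>}"
    using k ij by simp
qed (use assms in \<open>auto simp: fits_def\<close>)

text \<open>The classes into which the cross edges are sorted: for a single exceptional vertex of large
  degree, its edges to the core of the other side, and for the edges without such a vertex, four
  classes according to whether their ends in \<open>A'\<close> and \<open>B'\<close> are exceptional or in the core.\<close>

datatype 'a packet = StarA 'a | StarB 'a | ExcExc | ExcB | CoreExc | CoreCore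

lemma card_filter_disjoint_Union:
  assumes "finite T" "\<And>\<tau>. \<tau> \<in> T \<Longrightarrow> finite (E \<tau>)" "disjoint_family_on E T"
  shows "card (\<Union>\<tau>\<in>T. {e\<in>E \<tau>. P e}) = (\<Sum>\<tau>\<in>T. card {e\<in>E \<tau>. P e})"
proof (rule card_UN_disjoint)
  show "\<forall>\<tau>\<in>T. \<forall>\<tau>'\<in>T. \<tau> \<noteq> \<tau>' \<longrightarrow> {e\<in>E \<tau>. P e} \<inter> {e\<in>E \<tau>'. P e} = {}"
    using assms(3) unfolding disjoint_family_on_def by blast
qed (use assms in auto)

lemma card_vertex_fibres:
  assumes "finite S" "finite U"
  shows "card {e\<in>S. \<pi> e \<in> U \<and> P e} = (\<Sum>v\<in>U. card {e\<in>S. \<pi> e = v \<and> P e})"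
proof -
  have "{e\<in>S. \<pi> e \<in> U \<and> P e} = (\<Union>v\<in>U. {e\<in>S. \<pi> e = v \<and> P e})" by auto
  then show ?thesis using assms by (simp only:) (intro card_UN_disjoint, auto)
qed

lemma incid_parts:
  assumes "finite H" "finite T" "\<And>\<tau>. \<tau> \<in> T \<Longrightarrow> E \<tau> \<subseteq> H" "disjoint_family_on E T"
  shows "incid \<pi> H v = incid \<pi> (H - (\<Union>\<tau>\<in>T. E \<tau>)) v + (\<Sum>\<tau>\<in>T. incid \<pi> (E \<tau>) v)"
proof -
  let ?R = "H - (\<Union>\<tau>\<in>T. E \<tau>)"
  have fE: "finite (E \<tau>)" if "\<tau> \<in> T" for \<tau> using assms(3)[OF that] assms(1) by (rule finite_subset)
  have e: "{e\<in>H. \<pi> e = v} = {e\<in>?R. \<pi> e = v} \<union> (\<Union>\<tau>\<in>T. {e\<in>E \<tau>. \<pi> e = v})" using assms(3) by blast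
  have "card (\<Union>\<tau>\<in>T. {e\<in>E \<tau>. \<pi> e = v}) = (\<Sum>\<tau>\<in>T. card {e\<in>E \<tau>. \<pi> e = v})"
    by (rule card_filter_disjoint_Union[OF assms(2) fE assms(4)])
  moreover have "card ({e\<in>?R. \<pi> e = v} \<union> (\<Union>\<tau>\<in>T. {e\<in>E \<tau>. \<pi> e = v}))
      = card {e\<in>?R. \<pi> e = v} + card (\<Union>\<tau>\<in>T. {e\<in>E \<tau>. \<pi> e = v})"
    using assms(1,2) fE by (intro card_Un_disjoint) auto
  ultimately show ?thesis unfolding incid_def e by simp
qed

text \<open>Here \<open>Q\<close> selects the edges to one cluster and \<open>P\<close> those to all clusters. Removing the few
  vertices of \<open>U1\<close> preserves an even distribution over the clusters, at the cost of one error
  \<open>\<sigma>\<close> for each of them.\<close>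

lemma balanced_without_vertices:
  assumes "finite H" "finite U" "U1 \<subseteq> U" "card U1 \<le> nb"
    and "card {e\<in>H. \<pi> e \<in> U \<and> P e} \<le> K * card {e\<in>H. \<pi> e \<in> U \<and> Q e} + \<sigma>"
    and v: "\<And>v. v \<in> U1 \<Longrightarrow> K * card {e\<in>H. \<pi> e = v \<and> Q e} \<le> card {e\<in>H. \<pi> e = v \<and> P e} + \<sigma>"
  shows "card {e\<in>H. \<pi> e \<in> U - U1 \<and> P e} \<le> K * card {e\<in>H. \<pi> e \<in> U - U1 \<and> Q e} + (nb + 1) * \<sigma>"
proof -
  have fU1: "finite U1" using assms(2,3) finite_subset by blast
  have split: "card {e\<in>H. \<pi> e \<in> U \<and> R e} = card {e\<in>H. \<pi> e \<in> U - U1 \<and> R e} + (\<Sum>v\<in>U1. card {e\<in>H. \<pi> e = v \<and> R e})" for R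
  proof -
    have "{e\<in>H. \<pi> e \<in> U \<and> R e} = {e\<in>H. \<pi> e \<in> U - U1 \<and> R e} \<union> {e\<in>H. \<pi> e \<in> U1 \<and> R e}"
      using assms(3) by auto
    then have "card {e\<in>H. \<pi> e \<in> U \<and> R e} = card {e\<in>H. \<pi> e \<in> U - U1 \<and> R e} + card {e\<in>H. \<pi> e \<in> U1 \<and> R e}"
      using assms(1) by (simp only:) (intro card_Un_disjoint, auto)
    then show ?thesis using card_vertex_fibres[OF assms(1) fU1, of \<pi> R] by simp
  qed
  have "K * (\<Sum>v\<in>U1. card {e\<in>H. \<pi> e = v \<and> Q e}) \<le> (\<Sum>v\<in>U1. card {e\<in>H. \<pi> e = v \<and> P e} + \<sigma>)"
    unfolding sum_distrib_left using v by (intro sum_mono) auto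
  also have "\<dots> = (\<Sum>v\<in>U1. card {e\<in>H. \<pi> e = v \<and> P e}) + card U1 * \<sigma>" by (simp add: sum.distrib)
  also have "card U1 * \<sigma> \<le> nb * \<sigma>" using assms(4) by simp
  finally show ?thesis using assms(5) unfolding split[of P] split[of Q] by (simp add: algebra_simps)
qed

lemma star_size:
  fixes b :: "'a \<Rightarrow> nat" and \<pi> :: "'a \<times> 'a \<Rightarrow> 'a"
  assumes "finite H" "\<And>e f. \<pi> e = \<pi> f \<Longrightarrow> \<omega> e = \<omega> f \<Longrightarrow> e = f"
    and W: "\<And>e. e \<in> H \<Longrightarrow> \<omega> e \<in> W \<longleftrightarrow> b (\<omega> e) = 0" "finite W" "card W \<le> x"
  shows "card {e\<in>H. \<pi> e = v \<and> b (\<omega> e) > 0} \<le> incid \<pi> H v"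
    "incid \<pi> H v \<le> card {e\<in>H. \<pi> e = v \<and> b (\<omega> e) > 0} + (x :: nat)"
proof -
  let ?S = "{e\<in>H. \<pi> e = v \<and> b (\<omega> e) > 0}" and ?X = "{e\<in>H. \<pi> e = v \<and> \<omega> e \<in> W}"
  show "card ?S \<le> incid \<pi> H v" unfolding incid_def using assms(1) by (intro card_mono) auto
  have u: "{e\<in>H. \<pi> e = v} = ?S \<union> ?X" using W(1) by auto
  have "incid \<pi> H v \<le> card ?S + card ?X" unfolding incid_def u by (rule card_Un_le)
  moreover have "card ?X \<le> card W" using assms(2) W(2) by (intro card_inj_on_le[of \<omega>]) (auto simp: inj_on_def)
  ultimately show "incid \<pi> H v \<le> card ?S + x" using W(3) by linarith
qed

text \<open>The division of the cross edges into parts \<open>E \<tau>\<close> and a rest. The clauses on degrees make it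
  possible to split each part and the rest into pairs of disjoint edges; the last two clauses
  say that each exceptional vertex has nearly its fair share of cross edges in the parts for
  each cluster, so that enough edges to the cluster are left for it.\<close>

definition sharing ::
    "nat \<Rightarrow> ('a \<Rightarrow> nat) \<Rightarrow> ('a \<Rightarrow> nat) \<Rightarrow> 'a set \<Rightarrow> 'a set \<Rightarrow> ('a \<times> 'a) set \<Rightarrow> nat \<Rightarrow> nat \<Rightarrow> nat \<Rightarrow> (nat \<times> nat \<Rightarrow> ('a \<times> 'a) set) \<Rightarrow> bool" where
  "sharing K a b U W H t r \<Lambda> E \<longleftrightarrow>
     (\<forall>\<tau>\<in>cells K. E \<tau> \<subseteq> H \<and> card (E \<tau>) = 2 * t \<and> (\<forall>e\<in>E \<tau>. fits a b \<tau> e)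
         \<and> (\<forall>v. fdeg (E \<tau>) v \<le> t \<and> sdeg (E \<tau>) v \<le> t))
     \<and> disjoint_family_on E (cells K)
     \<and> (\<forall>v. fdeg (H - (\<Union>\<tau>\<in>cells K. E \<tau>)) v \<le> r \<and> sdeg (H - (\<Union>\<tau>\<in>cells K. E \<tau>)) v \<le> r)
     \<and> (\<forall>v\<in>U. \<forall>i\<in>{1..K}. fdeg H v \<le> K * (\<Sum>\<tau>\<in>{\<tau>\<in>cells K. fst \<tau> = i}. fdeg (E \<tau>) v) + \<Lambda>)
     \<and> (\<forall>w\<in>W. \<forall>j\<in>{1..K}. sdeg H w \<le> K * (\<Sum>\<tau>\<in>{\<tau>\<in>cells K. snd \<tau> = j}. sdeg (E \<tau>) w) + \<Lambda>)"

lemma sharing_part: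
  assumes "sharing K a b U W H t r \<Lambda> E" "\<tau> \<in> cells K"
  shows "E \<tau> \<subseteq> H" "card (E \<tau>) = 2 * t" "e \<in> E \<tau> \<Longrightarrow> fits a b \<tau> e" "fdeg (E \<tau>) v \<le> t" "sdeg (E \<tau>) v \<le> t"
  using assms unfolding sharing_def by blast+

text \<open>Vertices of degree at most \<open>\<theta>\<close> satisfy all degree conditions whatever part their edges are put
  in, and the vertices of larger degree are exceptional. For the latter the choice of \<open>c\<close> in
  \<open>packet_sizes\<close> determines the degrees exactly, because edges between such a vertex and another
  exceptional vertex all go into the rest. The last two clauses of \<open>sharing\<close> hold because such a
  vertex gives the same number of edges to every part and has degree at most \<open>r \<le> \<Lambda>\<close> in the
  rest.\<close>

lemma type_assignment:
  fixes H :: "('a \<times> 'a) set" and a b :: "'a \<Rightarrow> nat" and K t r h \<theta> \<sigma> x nb \<Lambda> :: nat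
  assumes fH: "finite H" and K: "K > 0"
    and U: "finite U" "\<And>e. e \<in> H \<Longrightarrow> fst e \<in> U \<longleftrightarrow> a (fst e) = 0" "\<And>v. v \<in> U \<Longrightarrow> a v = 0" "card U \<le> x"
    and W: "finite W" "\<And>e. e \<in> H \<Longrightarrow> snd e \<in> W \<longleftrightarrow> b (snd e) = 0" "\<And>w. w \<in> W \<Longrightarrow> b w = 0" "card W \<le> x"
    and cH: "card H = 2 * h" and dh: "\<And>v. fdeg H v \<le> h" "\<And>v. sdeg H v \<le> h"
    and h: "h = K^2 * t + r"
    and balA: "\<And>v j. v \<in> U \<Longrightarrow> j \<in> {1..K} \<Longrightarrow>
        card {e\<in>H. fst e = v \<and> b (snd e) > 0} \<le> K * card {e\<in>H. fst e = v \<and> b (snd e) = j} + \<sigma>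
      \<and> K * card {e\<in>H. fst e = v \<and> b (snd e) = j} \<le> card {e\<in>H. fst e = v \<and> b (snd e) > 0} + \<sigma>"
    and balB: "\<And>w i. w \<in> W \<Longrightarrow> i \<in> {1..K} \<Longrightarrow>
        card {e\<in>H. snd e = w \<and> a (fst e) > 0} \<le> K * card {e\<in>H. snd e = w \<and> a (fst e) = i} + \<sigma>
      \<and> K * card {e\<in>H. snd e = w \<and> a (fst e) = i} \<le> card {e\<in>H. snd e = w \<and> a (fst e) > 0} + \<sigma>"
    and bal0B: "\<And>j. j \<in> {1..K} \<Longrightarrow>
        card {e\<in>H. fst e \<in> U \<and> b (snd e) > 0} \<le> K * card {e\<in>H. fst e \<in> U \<and> b (snd e) = j} + \<sigma>"
    and balA0: "\<And>i. i \<in> {1..K} \<Longrightarrow>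
        card {e\<in>H. snd e \<in> W \<and> a (fst e) > 0} \<le> K * card {e\<in>H. snd e \<in> W \<and> a (fst e) = i} + \<sigma>"
    and balAB: "\<And>i j. i \<in> {1..K} \<Longrightarrow> j \<in> {1..K} \<Longrightarrow>
        card {e\<in>H. a (fst e) > 0 \<and> b (snd e) > 0} \<le> K^2 * card {e\<in>H. a (fst e) = i \<and> b (snd e) = j} + \<sigma>"
    and small: "\<And>v. v \<notin> U \<Longrightarrow> fdeg H v \<le> \<theta>" "\<And>v. v \<notin> W \<Longrightarrow> sdeg H v \<le> \<theta>"
    and \<theta>: "\<theta> \<le> t" "\<theta> \<le> r" and r: "r \<le> \<Lambda>"
    and nb: "card {v\<in>U. fdeg H v > \<theta>} + card {w\<in>W. sdeg H w > \<theta>} \<le> nb"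
    and slack: "(nb + 4) * ((nb + 1) * \<sigma> + K^2 + x) + nb * x + 3 * K^2 \<le> r"
  shows "\<exists>E. sharing K a b U W H t r \<Lambda> E"
proof -
  define T where "T = cells K"
  define U1 where "U1 = {v\<in>U. fdeg H v > \<theta>}"
  define W1 where "W1 = {w\<in>W. sdeg H w > \<theta>}"
  have fU1: "finite U1" "finite W1" "U1 \<subseteq> U" "W1 \<subseteq> W" using U W unfolding U1_def W1_def by auto
  have exc: "\<And>v. v \<in> U1 \<Longrightarrow> a v = 0" "\<And>w. w \<in> W1 \<Longrightarrow> b w = 0"
    using U(3) W(3) fU1 by blast+
  define s where "s = (nb + 1) * \<sigma>"
  define D where "D \<beta> = (case \<beta> of
      StarA v \<Rightarrow> {e\<in>H. fst e = v \<and> b (snd e) > 0}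
    | StarB w \<Rightarrow> {e\<in>H. snd e = w \<and> a (fst e) > 0}
    | ExcExc \<Rightarrow> {e\<in>H. fst e \<in> U - U1 \<and> snd e \<in> W - W1}
    | ExcB \<Rightarrow> {e\<in>H. fst e \<in> U - U1 \<and> b (snd e) > 0}
    | CoreExc \<Rightarrow> {e\<in>H. snd e \<in> W - W1 \<and> a (fst e) > 0}
    | CoreCore \<Rightarrow> {e\<in>H. a (fst e) > 0 \<and> b (snd e) > 0})" for \<beta>
  define Bg where "Bg = StarA ` U1 \<union> StarB ` W1"
  define Mid :: "'a packet set" where "Mid = {ExcExc, ExcB, CoreExc, CoreCore}"
  define I where "I = Bg \<union> Mid"
  define d where "d \<beta> = (case \<beta> of StarA v \<Rightarrow> fdeg H v | StarB w \<Rightarrow> sdeg H w | _ \<Rightarrow> 0)" for \<beta>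
  \<comment> \<open>Edges between two exceptional vertices of which one has large degree belong to no packet. They stay in the rest.\<close>
  define X where "X = {e\<in>H. (fst e \<in> U1 \<and> snd e \<in> W) \<or> (fst e \<in> U \<and> snd e \<in> W1)}"
  note HU = U(2) W(2)
  have nb1: "card U1 + card W1 \<le> nb" using nb unfolding U1_def W1_def .
  have finI: "finite I" unfolding I_def Mid_def Bg_def using fU1 by auto
  have cI: "card I \<le> nb + 4"
  proof -
    have "card Bg \<le> card U1 + card W1"
      unfolding Bg_def using fU1 by (metis (no_types, lifting) add_mono card_Un_le card_image_le le_trans)
    moreover have "card I \<le> card Bg + card Mid"
      unfolding I_def by (rule card_Un_le)
    moreover have "card Mid \<le> 4" unfolding Mid_def by (simp add: card_insert_if)
    ultimately show ?thesis using nb1 by linarith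
  qed
  have fD: "finite (D \<beta>)" "D \<beta> \<subseteq> H" for \<beta>
    unfolding D_def using fH by (auto split: packet.splits)
  have disD: "disjoint_family_on D I"
    unfolding disjoint_family_on_def I_def Mid_def Bg_def D_def using HU fU1 by (auto dest: exc)
  have cover: "H = (\<Union>\<beta>\<in>I. D \<beta>) \<union> X"
  proof
    show "H \<subseteq> (\<Union>\<beta>\<in>I. D \<beta>) \<union> X"
    proof
      fix e assume e: "e \<in> H"
      consider "e \<in> X" | "e \<notin> X" "fst e \<in> U1" | "e \<notin> X" "snd e \<in> W1" 
        | "fst e \<notin> U1" "snd e \<notin> W1" by blast
      then show "e \<in> (\<Union>\<beta>\<in>I. D \<beta>) \<union> X"
      proof cases
        case 2
        then have "e \<in> D (StarA (fst e))" "StarA (fst e) \<in> I"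
          using e HU[OF e] unfolding X_def D_def I_def Mid_def Bg_def by auto
        then show ?thesis by blast
      next
        case 3
        then have "e \<in> D (StarB (snd e))" "StarB (snd e) \<in> I"
          using e HU[OF e] unfolding X_def D_def I_def Mid_def Bg_def by auto
        then show ?thesis by blast
      next
        case 4
        then have "e \<in> D ExcExc \<union> D ExcB \<union> D CoreExc \<union> D CoreCore"
          using e HU[OF e] unfolding D_def by auto
        then show ?thesis unfolding I_def Mid_def by blast
      qed auto
    qed
    show "(\<Union>\<beta>\<in>I. D \<beta>) \<union> X \<subseteq> H" using fD unfolding X_def by blast
  qed
  have cX: "card X \<le> nb * x"
  proof -
    have "X \<subseteq> U1 \<times> W \<union> U \<times> W1" unfolding X_def by auto
    then have "card X \<le> card (U1 \<times> W) + card (U \<times> W1)"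
      using U W fU1 by (meson card_Un_le card_mono finite_SigmaI finite_UnI le_trans)
    also have "\<dots> \<le> card U1 * x + x * card W1"
      using U W by (simp add: card_cartesian_product add_mono mult_le_mono)
    also have "\<dots> = (card U1 + card W1) * x" by (simp add: algebra_simps)
    also have "\<dots> \<le> nb * x" using nb1 by simp
    finally show ?thesis .
  qed
  have cUn: "card (\<Union>\<beta>\<in>I. D \<beta>) = (\<Sum>\<beta>\<in>I. card (D \<beta>))"
    using disD finI fD by (intro card_UN_disjoint) (auto simp: disjoint_family_on_def)
  have tot: "(\<Sum>\<beta>\<in>I. card (D \<beta>)) \<le> 2 * h" "2 * h \<le> (\<Sum>\<beta>\<in>I. card (D \<beta>)) + nb * x"
  proof -
    show "(\<Sum>\<beta>\<in>I. card (D \<beta>)) \<le> 2 * h"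
      unfolding cUn[symmetric] cH[symmetric] using fD fH by (intro card_mono) auto
    have "card H \<le> card (\<Union>\<beta>\<in>I. D \<beta>) + card X" using cover card_Un_le by metis
    then show "2 * h \<le> (\<Sum>\<beta>\<in>I. card (D \<beta>)) + nb * x" using cUn cH cX by linarith
  qed
  have dD: "card (D \<beta>) \<le> d \<beta> \<and> d \<beta> \<le> card (D \<beta>) + x \<and> d \<beta> \<le> h" if \<beta>Bg: "\<beta> \<in> Bg" for \<beta>
  proof -
    have "d \<beta> \<le> h" using dh unfolding d_def by (cases \<beta>) auto
    moreover have "card (D \<beta>) \<le> d \<beta> \<and> d \<beta> \<le> card (D \<beta>) + x"
      using \<beta>Bg star_size[where \<pi>=fst and \<omega>=snd and b=b, OF fH _ W(2,1,4)]
        star_size[where \<pi>=snd and \<omega>=fst and b=a, OF fH _ U(2,1,4)]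
      unfolding Bg_def D_def d_def by (auto simp: prod_eq_iff)
    ultimately show ?thesis by simp
  qed
  have spr: "spreadable K a b s (D \<beta>)" if \<beta>: "\<beta> \<in> I" for \<beta>
  proof (cases \<beta>)
    case (StarA v)
    then have v: "v \<in> U" using \<beta> fU1 unfolding I_def Mid_def Bg_def by auto
    have s: "\<sigma> \<le> s" unfolding s_def by simp
    show ?thesis
    proof (rule spreadable_one_side[where f="\<lambda>e. b (snd e)" and q=snd])
      fix j assume j: "j \<in> {1..K}"
      have "{e \<in> D \<beta>. b (snd e) = j} = {e \<in> H. fst e = v \<and> b (snd e) = j}"
        unfolding StarA D_def using j by auto
      then show "card (D \<beta>) \<le> K * card {e \<in> D \<beta>. b (snd e) = j} + s"
        using balA[OF v j] s unfolding StarA D_def by auto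
    qed (use fH StarA HU v in \<open>auto simp: D_def fits_def\<close>)
  next
    case (StarB w)
    then have w: "w \<in> W" using \<beta> fU1 unfolding I_def Mid_def Bg_def by auto
    have s: "\<sigma> \<le> s" unfolding s_def by simp
    show ?thesis
    proof (rule spreadable_one_side[where f="\<lambda>e. a (fst e)" and q=fst])
      fix j assume j: "j \<in> {1..K}"
      have "{e \<in> D \<beta>. a (fst e) = j} = {e \<in> H. snd e = w \<and> a (fst e) = j}"
        unfolding StarB D_def using j by auto
      then show "card (D \<beta>) \<le> K * card {e \<in> D \<beta>. a (fst e) = j} + s"
        using balB[OF w j] s unfolding StarB D_def by auto
    qed (use fH StarB HU w in \<open>auto simp: D_def fits_def\<close>)
  next
    case ExcExc
    show ?thesis by (rule spreadable_00) (use fH ExcExc HU in \<open>auto simp: D_def\<close>)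
  next
    case ExcB
    show ?thesis
    proof (rule spreadable_one_side[where f="\<lambda>e. b (snd e)" and q=snd])
      fix j assume j: "j \<in> {1..K}"
      have "{e \<in> D \<beta>. b (snd e) = j} = {e \<in> H. fst e \<in> U - U1 \<and> b (snd e) = j}"
        unfolding ExcB D_def using j by auto
      moreover have "card {e\<in>H. fst e \<in> U - U1 \<and> b (snd e) > 0}
          \<le> K * card {e\<in>H. fst e \<in> U - U1 \<and> b (snd e) = j} + (nb + 1) * \<sigma>"
        by (rule balanced_without_vertices[OF fH U(1) fU1(3) _ bal0B[OF j]]) (use balA j fU1 nb1 in auto)
      ultimately show "card (D \<beta>) \<le> K * card {e \<in> D \<beta>. b (snd e) = j} + s"
        unfolding s_def ExcB D_def by auto
    qed (use fH ExcB HU in \<open>auto simp: D_def fits_def\<close>)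
  next
    case CoreExc
    show ?thesis
    proof (rule spreadable_one_side[where f="\<lambda>e. a (fst e)" and q=fst])
      fix j assume j: "j \<in> {1..K}"
      have "{e \<in> D \<beta>. a (fst e) = j} = {e \<in> H. snd e \<in> W - W1 \<and> a (fst e) = j}"
        unfolding CoreExc D_def using j by auto
      moreover have "card {e\<in>H. snd e \<in> W - W1 \<and> a (fst e) > 0}
          \<le> K * card {e\<in>H. snd e \<in> W - W1 \<and> a (fst e) = j} + (nb + 1) * \<sigma>"
        by (rule balanced_without_vertices[OF fH W(1) fU1(4) _ balA0[OF j]]) (use balB j fU1 nb1 in auto)
      ultimately show "card (D \<beta>) \<le> K * card {e \<in> D \<beta>. a (fst e) = j} + s"
        unfolding s_def CoreExc D_def by auto
    qed (use fH CoreExc HU in \<open>auto simp: D_def fits_def\<close>)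
  next
    case CoreCore
    have s: "\<sigma> \<le> s" unfolding s_def by simp
    show ?thesis
    proof (rule spreadable_AB)
      fix i j assume ij: "i \<in> {1..K}" "j \<in> {1..K}"
      have "{e \<in> D \<beta>. a (fst e) = i \<and> b (snd e) = j} = {e \<in> H. a (fst e) = i \<and> b (snd e) = j}"
        unfolding CoreCore D_def using ij by auto
      then show "card (D \<beta>) \<le> K\<^sup>2 * card {e \<in> D \<beta>. a (fst e) = i \<and> b (snd e) = j} + s"
        using balAB[OF ij] s unfolding CoreCore D_def by auto
    qed (use fD in auto)
  qed
  have sl: "card I * (s + K^2 + x) + nb * x + 3 * K^2 \<le> r"
    using slack mult_right_mono[OF cI, of "s + K^2 + x"] unfolding s_def by linarith
  have "s + K^2 + x \<le> (nb + 4) * (s + K^2 + x)" by simp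
  then have sxr: "s + x \<le> r" using slack unfolding s_def by linarith
  have BgI: "Bg \<subseteq> I" unfolding I_def by auto
  have K2: "K^2 > 0" using K by simp
  obtain c where c: "sum c I = 2 * t" "\<And>\<beta>. \<beta> \<in> I \<Longrightarrow> c \<beta> = 0 \<or> K^2 * c \<beta> + s \<le> card (D \<beta>)"
    "\<And>\<beta>. \<beta> \<in> Bg \<Longrightarrow> c \<beta> \<le> t \<and> d \<beta> \<le> K^2 * c \<beta> + r"
    using packet_sizes[OF finI BgI K2 dD tot h sl sxr] by blast
  have "\<exists>E. (\<forall>\<tau>\<in>T. E \<tau> \<subseteq> D \<beta> \<and> card (E \<tau>) = c \<beta> \<and> (\<forall>e\<in>E \<tau>. fits a b \<tau> e))
        \<and> disjoint_family_on E T" if "\<beta> \<in> I" for \<beta>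
    using spr[OF that] c(2)[OF that] unfolding spreadable_def T_def by blast
  then obtain EE where EE: "\<And>\<beta> \<tau>. \<beta> \<in> I \<Longrightarrow> \<tau> \<in> T \<Longrightarrow> EE \<beta> \<tau> \<subseteq> D \<beta> \<and> card (EE \<beta> \<tau>) = c \<beta> \<and> (\<forall>e\<in>EE \<beta> \<tau>. fits a b \<tau> e)"
    "\<And>\<beta>. \<beta> \<in> I \<Longrightarrow> disjoint_family_on (EE \<beta>) T"
    by metis
  define E where "E \<tau> = (\<Union>\<beta>\<in>I. EE \<beta> \<tau>)" for \<tau>
  have EH: "E \<tau> \<subseteq> H" if "\<tau> \<in> T" for \<tau> using EE(1)[OF _ that] fD unfolding E_def by blast
  have finE: "finite (E \<tau>)" if "\<tau> \<in> T" for \<tau> using EH[OF that] fH finite_subset by blast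
  have finT: "finite T" unfolding T_def by auto
  have inD: "EE \<beta> \<tau> = E \<tau> \<inter> D \<beta>" if "\<beta> \<in> I" "\<tau> \<in> T" for \<beta> \<tau>
  proof
    show "EE \<beta> \<tau> \<subseteq> E \<tau> \<inter> D \<beta>" using EE(1)[OF that] that unfolding E_def by blast
    show "E \<tau> \<inter> D \<beta> \<subseteq> EE \<beta> \<tau>"
    proof
      fix e assume e: "e \<in> E \<tau> \<inter> D \<beta>"
      then obtain \<beta>' where \<beta>': "\<beta>' \<in> I" "e \<in> EE \<beta>' \<tau>" unfolding E_def by auto
      then have "e \<in> D \<beta>'" using EE(1)[OF \<beta>'(1) that(2)] by blast
      then have "\<beta>' = \<beta>" using disD e \<beta>'(1) that(1) unfolding disjoint_family_on_def by blast
      then show "e \<in> EE \<beta> \<tau>" using \<beta>' by simp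
    qed
  qed
  have cE: "card (E \<tau>) = 2 * t" if "\<tau> \<in> T" for \<tau>
  proof -
    have fEE: "finite (EE \<beta> \<tau>)" if "\<beta> \<in> I" for \<beta>
      using EE(1)[OF that \<open>\<tau> \<in> T\<close>] fD finite_subset by blast
    have "EE \<beta> \<tau> \<inter> EE \<beta>' \<tau> = {}" if "\<beta> \<in> I" "\<beta>' \<in> I" "\<beta> \<noteq> \<beta>'" for \<beta> \<beta>'
    proof -
      have "D \<beta> \<inter> D \<beta>' = {}" using disD that unfolding disjoint_family_on_def by blast
      then show ?thesis using EE(1)[OF that(1) \<open>\<tau> \<in> T\<close>] EE(1)[OF that(2) \<open>\<tau> \<in> T\<close>] by blast
    qed
    then have "card (E \<tau>) = (\<Sum>\<beta>\<in>I. card (EE \<beta> \<tau>))"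
      unfolding E_def using finI fEE by (intro card_UN_disjoint) auto
    then show ?thesis using EE(1) that c(1) by simp
  qed
  have disE: "disjoint_family_on E T"
    unfolding disjoint_family_on_def
  proof (intro ballI impI)
    fix \<tau> \<tau>' assume tt: "\<tau> \<in> T" "\<tau>' \<in> T" "\<tau> \<noteq> \<tau>'"
    have "e \<notin> E \<tau>'" if e: "e \<in> E \<tau>" for e
    proof
      assume "e \<in> E \<tau>'"
      obtain \<beta> where \<beta>: "\<beta> \<in> I" "e \<in> EE \<beta> \<tau>" using e unfolding E_def by auto
      then have "e \<in> EE \<beta> \<tau>'" using inD tt \<open>e \<in> E \<tau>'\<close> by blast
      then show False using EE(2)[OF \<beta>(1)] \<beta>(2) tt unfolding disjoint_family_on_def by blast
    qed
    then show "E \<tau> \<inter> E \<tau>' = {}" by blast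
  qed
  have star: "incid \<pi> (E \<tau>) v = c \<beta>"
    if I: "\<beta> \<in> I" and \<tau>: "\<tau> \<in> T" and \<pi>: "\<And>e \<beta>'. \<beta>' \<in> I \<Longrightarrow> e \<in> D \<beta>' \<Longrightarrow> \<pi> e = v \<longleftrightarrow> \<beta>' = \<beta>" for \<pi> v \<beta> \<tau>
  proof -
    have "{e\<in>E \<tau>. \<pi> e = v} = EE \<beta> \<tau>"
    proof
      show "{e\<in>E \<tau>. \<pi> e = v} \<subseteq> EE \<beta> \<tau>" using EE(1)[OF _ \<tau>] \<pi> unfolding E_def by blast
      show "EE \<beta> \<tau> \<subseteq> {e\<in>E \<tau>. \<pi> e = v}" using EE(1)[OF I \<tau>] \<pi>[OF I] I unfolding E_def by blast
    qed
    then show ?thesis unfolding incid_def using EE(1)[OF I \<tau>] by simp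
  qed
  let ?R = "H - (\<Union>\<tau>\<in>T. E \<tau>)"
  have degrees: "(\<forall>\<tau>\<in>T. incid \<pi> (E \<tau>) v \<le> t) \<and> incid \<pi> ?R v \<le> r
      \<and> (\<forall>X\<subseteq>T. card X = K \<longrightarrow> incid \<pi> H v \<le> K * (\<Sum>\<tau>\<in>X. incid \<pi> (E \<tau>) v) + \<Lambda>)"
    if "incid \<pi> H v \<le> \<theta> \<or> (\<exists>\<beta>\<in>Bg. d \<beta> = incid \<pi> H v \<and> (\<forall>\<tau>\<in>T. incid \<pi> (E \<tau>) v = c \<beta>))" for \<pi> v
  proof -
    have parts: "incid \<pi> H v = incid \<pi> ?R v + (\<Sum>\<tau>\<in>T. incid \<pi> (E \<tau>) v)"
      by (rule incid_parts[OF fH finT EH disE])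
    show ?thesis using that
    proof
      assume s: "incid \<pi> H v \<le> \<theta>"
      have "incid \<pi> (E \<tau>) v \<le> t" if "\<tau> \<in> T" for \<tau>
        using s \<theta>(1) incid_mono[OF fH EH[OF that], of \<pi> v] by linarith
      moreover have "incid \<pi> ?R v \<le> r" using s \<theta>(2) parts by linarith
      moreover have "incid \<pi> H v \<le> y + \<Lambda>" for y using s \<theta>(2) r by linarith
      ultimately show ?thesis by blast
    next
      assume "\<exists>\<beta>\<in>Bg. d \<beta> = incid \<pi> H v \<and> (\<forall>\<tau>\<in>T. incid \<pi> (E \<tau>) v = c \<beta>)"
      then obtain \<beta> where \<beta>: "\<beta> \<in> Bg" "d \<beta> = incid \<pi> H v" "\<And>\<tau>. \<tau> \<in> T \<Longrightarrow> incid \<pi> (E \<tau>) v = c \<beta>" by blast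
      have "incid \<pi> H v \<le> K * (\<Sum>\<tau>\<in>X. incid \<pi> (E \<tau>) v) + \<Lambda>" if X: "X \<subseteq> T" "card X = K" for X
      proof -
        have "incid \<pi> (E \<tau>) v = c \<beta>" if "\<tau> \<in> X" for \<tau> using that X(1) \<beta>(3) by blast
        then have "(\<Sum>\<tau>\<in>X. incid \<pi> (E \<tau>) v) = K * c \<beta>" using X(2) by simp
        then show ?thesis using c(3)[OF \<beta>(1)] \<beta>(2) r by (simp add: power2_eq_square algebra_simps)
      qed
      moreover have "(\<Sum>\<tau>\<in>T. incid \<pi> (E \<tau>) v) = K^2 * c \<beta>" 
        using \<beta>(3) card_cells[of K] unfolding T_def by simp
      ultimately show ?thesis using c(3)[OF \<beta>(1)] \<beta>(2,3) parts by auto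
    qed
  qed
  have dA: "fdeg H v \<le> \<theta> \<or> (\<exists>\<beta>\<in>Bg. d \<beta> = fdeg H v \<and> (\<forall>\<tau>\<in>T. fdeg (E \<tau>) v = c \<beta>))" for v
  proof (cases "v \<in> U1")
    case True
    then have "fdeg (E \<tau>) v = c (StarA v)" if "\<tau> \<in> T" for \<tau>
      using that exc fU1 HU by (intro star) (auto simp: I_def Mid_def Bg_def D_def)
    then show ?thesis using True unfolding Bg_def d_def by force
  next
    case False
    then show ?thesis using small(1)[of v] unfolding U1_def by auto
  qed
  have dB: "sdeg H v \<le> \<theta> \<or> (\<exists>\<beta>\<in>Bg. d \<beta> = sdeg H v \<and> (\<forall>\<tau>\<in>T. sdeg (E \<tau>) v = c \<beta>))" for v
  proof (cases "v \<in> W1")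
    case True
    then have "sdeg (E \<tau>) v = c (StarB v)" if "\<tau> \<in> T" for \<tau>
      using that exc fU1 HU by (intro star) (auto simp: I_def Mid_def Bg_def D_def)
    then show ?thesis using True unfolding Bg_def d_def by force
  next
    case False
    then show ?thesis using small(2)[of v] unfolding W1_def by auto
  qed
  have lines: "{\<tau>\<in>T. q \<tau> = i} \<subseteq> T \<and> card {\<tau>\<in>T. q \<tau> = i} = K" if "q = fst \<or> q = snd" "i \<in> {1..K}" for q i
    using card_cells_line[OF that] unfolding T_def by auto
  have fit: "fits a b \<tau> e" if "\<tau> \<in> T" "e \<in> E \<tau>" for \<tau> e
    using that EE(1) unfolding E_def by blast
  note gA = degrees[OF dA] and gB = degrees[OF dB]
  have "sharing K a b U W H t r \<Lambda> E"
    unfolding sharing_def T_def[symmetric]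
  proof (intro conjI ballI allI)
    fix \<tau> v assume "\<tau> \<in> T"
    then show "E \<tau> \<subseteq> H" "card (E \<tau>) = 2 * t" "fdeg (E \<tau>) v \<le> t" "sdeg (E \<tau>) v \<le> t"
      using EH cE gA[of v] gB[of v] by simp_all
  next
    fix v i assume "i \<in> {1..K}"
    then show "fdeg H v \<le> K * (\<Sum>\<tau>\<in>{\<tau>\<in>T. fst \<tau> = i}. fdeg (E \<tau>) v) + \<Lambda>"
      "sdeg H v \<le> K * (\<Sum>\<tau>\<in>{\<tau>\<in>T. snd \<tau> = i}. sdeg (E \<tau>) v) + \<Lambda>"
      using gA[of v] gB[of v] lines[of fst i] lines[of snd i] by simp_all
  qed (use fit disE gA gB in simp_all)
  then show ?thesis by blast
qed

section \<open>Colouring all edges\<close>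

text \<open>Here \<open>ty k\<close> is the pair of clusters for which the colour \<open>k\<close> is reserved, and \<open>None\<close> if \<open>k\<close> is
  free. Every part is paired up inside its own set of colours.\<close>

lemma cross_colouring:
  fixes K :: nat and H :: "('a \<times> 'a) set" and ty :: "nat \<Rightarrow> (nat \<times> nat) option"
  assumes fH: "finite H" and cH: "card H = 2 * h" and h: "h = K^2 * t + r"
    and ty: "\<And>\<tau>. \<tau> \<in> cells K \<Longrightarrow> card {k. k < N \<and> ty k = Some \<tau>} = L"
      "card {k. k < N \<and> ty k = None} = \<Lambda>"
    and tL: "t \<le> L" "r \<le> \<Lambda>"
    and sh: "sharing K a b U W H t r \<Lambda> E"
  shows "\<exists>mc. (\<forall>e\<in>H. mc e < N) \<and> (\<forall>k<N. card {e\<in>H. mc e = k} \<in> {0, 2} \<and> matched fst snd {e\<in>H. mc e = k})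
          \<and> (\<forall>\<tau>\<in>cells K. {e\<in>H. ty (mc e) = Some \<tau>} = E \<tau>)
          \<and> (\<forall>e\<in>H. ty (mc e) \<in> insert None (Some ` cells K))"
proof -
  define T where "T = cells K"
  note ty = ty[folded T_def]
  have E: "E \<tau> \<subseteq> H \<and> card (E \<tau>) = 2 * t \<and> (\<forall>v. fdeg (E \<tau>) v \<le> t \<and> sdeg (E \<tau>) v \<le> t)" if "\<tau> \<in> T" for \<tau>
    using sharing_part[OF sh] that unfolding T_def by blast
  have dis: "disjoint_family_on E T" using sh unfolding sharing_def T_def by blast
  have rest: "fdeg (H - (\<Union>\<tau>\<in>T. E \<tau>)) v \<le> r \<and> sdeg (H - (\<Union>\<tau>\<in>T. E \<tau>)) v \<le> r" for v
    using sh unfolding sharing_def T_def by blast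
  define F where "F \<tau>o = (case \<tau>o of None \<Rightarrow> H - (\<Union>\<tau>\<in>T. E \<tau>) | Some \<tau> \<Rightarrow> E \<tau>)" for \<tau>o
  define O1 where "O1 = insert None (Some ` T)"
  have finT: "finite T" "card T = K^2"
    unfolding T_def by (auto simp: power2_eq_square)
  have EH: "E \<tau> \<subseteq> H" if "\<tau> \<in> T" for \<tau> using E[OF that] by blast
  then have FH: "F o1 \<subseteq> H" if "o1 \<in> O1" for o1 using that unfolding O1_def F_def by (auto split: option.splits)
  have dF: "F o1 \<inter> F o2 = {}" if "o1 \<in> O1" "o2 \<in> O1" "o1 \<noteq> o2" for o1 o2
  proof (cases o1)
    case None
    then show ?thesis using that unfolding O1_def F_def by auto
  next
    case s1: (Some \<tau>1)
    show ?thesis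
    proof (cases o2)
      case None
      then show ?thesis using that unfolding O1_def F_def by auto
    next
      case (Some \<tau>2)
      then have "\<tau>1 \<in> T" "\<tau>2 \<in> T" "\<tau>1 \<noteq> \<tau>2" using that s1 unfolding O1_def by auto
      then have "E \<tau>1 \<inter> E \<tau>2 = {}" using dis unfolding disjoint_family_on_def by blast
      then show ?thesis using s1 Some unfolding F_def by simp
    qed
  qed
  have UF: "(\<Union>o1\<in>O1. F o1) = H"
  proof
    show "(\<Union>o1\<in>O1. F o1) \<subseteq> H" using FH by blast
    show "H \<subseteq> (\<Union>o1\<in>O1. F o1)" unfolding O1_def F_def by auto
  qed
  have cR: "card (H - (\<Union>\<tau>\<in>T. E \<tau>)) = 2 * r"
  proof -
    have finE: "finite (E \<tau>)" if "\<tau> \<in> T" for \<tau> using EH[OF that] fH by (rule finite_subset)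
    have "card (\<Union>\<tau>\<in>T. E \<tau>) = (\<Sum>\<tau>\<in>T. card (E \<tau>))"
      using card_filter_disjoint_Union[OF finT(1) finE dis, of "\<lambda>_. True"] by simp
    also have "\<dots> = K^2 * (2 * t)" using E finT by simp
    finally have "card (\<Union>\<tau>\<in>T. E \<tau>) = K^2 * (2 * t)" .
    moreover have "(\<Union>\<tau>\<in>T. E \<tau>) \<subseteq> H" using EH by blast
    ultimately show ?thesis using cH h fH by (simp add: card_Diff_subset finite_subset algebra_simps)
  qed
  have ex: "\<exists>col. (\<forall>e\<in>F o1. col e \<in> {k. k < N \<and> ty k = o1})
     \<and> (\<forall>k\<in>{k. k < N \<and> ty k = o1}. card {e\<in>F o1. col e = k} \<in> {0, 2} \<and> matched fst snd {e\<in>F o1. col e = k})"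
    if o1: "o1 \<in> O1" for o1
  proof (cases o1)
    case None
    show ?thesis
      by (rule matching_pairs[where s=r])
        (use fH FH[OF o1] finite_subset rest cR ty tL None in \<open>auto simp: F_def incid_def prod_eq_iff\<close>)
  next
    case (Some \<tau>)
    then have \<tau>: "\<tau> \<in> T" using o1 unfolding O1_def by auto
    show ?thesis
      by (rule matching_pairs[where s=t])
        (use fH FH[OF o1] finite_subset E[OF \<tau>] ty(1)[OF \<tau>] tL Some in \<open>auto simp: F_def incid_def prod_eq_iff\<close>)
  qed
  have "\<forall>o1. \<exists>col. o1 \<in> O1 \<longrightarrow> (\<forall>e\<in>F o1. col e \<in> {k. k < N \<and> ty k = o1})
     \<and> (\<forall>k\<in>{k. k < N \<and> ty k = o1}. card {e\<in>F o1. col e = k} \<in> {0, 2} \<and> matched fst snd {e\<in>F o1. col e = k})"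
    using ex by blast
  from choice[OF this] obtain C where C0: "\<forall>o1. o1 \<in> O1 \<longrightarrow> (\<forall>e\<in>F o1. C o1 e \<in> {k. k < N \<and> ty k = o1})
     \<and> (\<forall>k\<in>{k. k < N \<and> ty k = o1}. card {e\<in>F o1. C o1 e = k} \<in> {0, 2} \<and> matched fst snd {e\<in>F o1. C o1 e = k})"
    by blast
  have C1: "C o1 e < N \<and> ty (C o1 e) = o1" if "o1 \<in> O1" "e \<in> F o1" for o1 e
    using C0 that by blast
  have C2: "card {e\<in>F o1. C o1 e = k} \<in> {0, 2} \<and> matched fst snd {e\<in>F o1. C o1 e = k}"
    if "o1 \<in> O1" "k < N" "ty k = o1" for o1 k
  proof -
    have k: "k \<in> {k. k < N \<and> ty k = o1}" using that by simp
    show ?thesis by (rule bspec[OF conjunct2[OF mp[OF spec[OF C0] that(1)]] k])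
  qed
  define lab where "lab e = (SOME o1. o1 \<in> O1 \<and> e \<in> F o1)" for e
  have lab: "lab e \<in> O1 \<and> e \<in> F (lab e)" if "e \<in> H" for e
    using that UF unfolding lab_def by (metis (mono_tags, lifting) UN_E someI_ex)
  have lab_eq: "lab e = o1" if "o1 \<in> O1" "e \<in> F o1" for e o1
    using lab[of e] dF[of "lab e" o1] FH[OF that(1)] that by blast
  define mc where "mc e = C (lab e) e" for e
  have mc: "mc e < N \<and> ty (mc e) = lab e" if "e \<in> H" for e
    using lab[OF that] C1 unfolding mc_def by blast
  have "card {e\<in>H. mc e = k} \<in> {0, 2} \<and> matched fst snd {e\<in>H. mc e = k}" if k: "k < N" for k
  proof (cases "ty k \<in> O1")
    case True
    have "{e\<in>H. mc e = k} = {e\<in>F (ty k). C (ty k) e = k}"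
    proof (intro set_eqI iffI)
      fix e assume "e \<in> {e\<in>H. mc e = k}"
      then have e: "e \<in> H" "mc e = k" by auto
      then have "lab e = ty k" using mc[OF e(1)] by simp
      then show "e \<in> {e\<in>F (ty k). C (ty k) e = k}"
        using lab[OF e(1)] e(2) unfolding mc_def by simp
    next
      fix e assume "e \<in> {e\<in>F (ty k). C (ty k) e = k}"
      then have e: "e \<in> F (ty k)" "C (ty k) e = k" by auto
      then have "lab e = ty k" "e \<in> H" using lab_eq[OF True e(1)] FH[OF True] by auto
      then show "e \<in> {e\<in>H. mc e = k}" using e unfolding mc_def by simp
    qed
    then show ?thesis using C2[OF True k refl] by simp
  next
    case False
    then have e: "{e\<in>H. mc e = k} = {}" using mc lab by auto
    show ?thesis unfolding e by (simp add: matched_def)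
  qed
  moreover have "{e\<in>H. ty (mc e) = Some \<tau>} = E \<tau>" if "\<tau> \<in> T" for \<tau>
  proof -
    have o1: "Some \<tau> \<in> O1" using that unfolding O1_def by auto
    have "{e\<in>H. ty (mc e) = Some \<tau>} = {e\<in>H. lab e = Some \<tau>}"
      using mc by (metis (lifting))
    also have "\<dots> = F (Some \<tau>)"
    proof (intro set_eqI iffI)
      fix e assume "e \<in> {e\<in>H. lab e = Some \<tau>}"
      then show "e \<in> F (Some \<tau>)" using lab[of e] by simp
    next
      fix e assume "e \<in> F (Some \<tau>)"
      then show "e \<in> {e\<in>H. lab e = Some \<tau>}" using lab_eq[OF o1] FH[OF o1] by auto
    qed
    finally show ?thesis unfolding F_def by simp
  qed
  moreover have "ty (mc e) \<in> insert None (Some ` T)" if "e \<in> H" for e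
    using mc[OF that] lab[OF that] unfolding O1_def by auto
  ultimately show ?thesis unfolding T_def[symmetric] using mc by (intro exI[of _ mc]) auto
qed

text \<open>\<open>Y\<close> are the neighbours of one exceptional vertex, \<open>r k\<close> is the number of edges of colour \<open>k\<close>
  that this vertex still needs, and \<open>ct k\<close> is the cluster for which \<open>k\<close> is reserved, or 0 if \<open>k\<close>
  is free. Setting aside the right number of neighbours in each cluster, and leaving the others
  to the free colours, reduces the claim to one application of \<open>colouring_avoiding\<close> for each
  value of \<open>ct\<close>.\<close>

lemma extend_at_vertex:
  fixes bad :: "'a \<Rightarrow> nat \<Rightarrow> bool" and a :: "'a \<Rightarrow> nat" and ct :: "nat \<Rightarrow> nat"
  assumes fN: "finite Y" and a: "\<And>y. y \<in> Y \<Longrightarrow> a y \<in> {1..K}" and ct: "\<And>k. k < N \<Longrightarrow> ct k \<le> K"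
    and sum: "(\<Sum>k<N. r k) = card Y"
    and room: "\<And>i. i \<in> {1..K} \<Longrightarrow> (\<Sum>k\<in>{k. k < N \<and> ct k = i}. r k) \<le> card {y\<in>Y. a y = i}"
    and p: "\<And>y. y \<in> Y \<Longrightarrow> (\<Sum>k\<in>{k. k < N \<and> bad y k}. r k) \<le> p"
    and q: "\<And>k. k < N \<Longrightarrow> card {y\<in>Y. bad y k} \<le> q"
    and pq: "\<And>i. i \<le> K \<Longrightarrow> p + q < (\<Sum>k\<in>{k. k < N \<and> ct k = i}. r k)"
  shows "\<exists>col. (\<forall>y\<in>Y. col y < N \<and> \<not> bad y (col y) \<and> ct (col y) \<in> {0, a y})
           \<and> (\<forall>k<N. card {y\<in>Y. col y = k} = (r k :: nat))"
proof -
  define s where "s i = (\<Sum>k\<in>{k. k < N \<and> ct k = i}. r k)" for i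
  have "(\<Sum>t\<in>{t\<in>{1..K}. t = l}. s t) \<le> card {y\<in>Y. a y = l}" for l
  proof (cases "l \<in> {1..K}")
    case True
    then have "{t\<in>{1..K}. t = l} = {l}" by auto
    then show ?thesis using room[OF True] unfolding s_def by simp
  next
    case False
    then have "{t\<in>{1..K}. t = l} = {}" by auto
    then show ?thesis by (simp only: sum.empty)
  qed
  from disjoint_choice[where T="{1..K}" and S=Y and q="\<lambda>i. i" and f=a and c=s, OF finite_atLeastAtMost fN this]
  obtain X where X0: "\<forall>i\<in>{1..K}. X i \<subseteq> {y\<in>Y. a y = i} \<and> card (X i) = s i"
    and dX: "disjoint_family_on X {1..K}"
    by blast
  have X: "\<And>i. i \<in> {1..K} \<Longrightarrow> X i \<subseteq> {y\<in>Y. a y = i} \<and> card (X i) = s i"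
    "disjoint_family_on X {1..K}"
    using X0 dX by blast+
  have fX: "finite (X i)" if "i \<in> {1..K}" for i using X(1)[OF that] fN finite_subset by fastforce
  \<comment> \<open>Block 0 consists of the neighbours that are left for the free colours.\<close>
  define Z where "Z i = (if i = 0 then Y - (\<Union>i\<in>{1..K}. X i) else X i)" for i
  have ZY: "Z i \<subseteq> Y" if "i \<le> K" for i using X(1)[of i] that unfolding Z_def by auto
  have fZ: "finite (Z i)" if "i \<le> K" for i using ZY[OF that] fN finite_subset by blast
  have "card (\<Union>i\<in>{1..K}. X i) = (\<Sum>i\<in>{1..K}. s i)"
    using X fX card_UN_disjoint[of "{1..K}" X] unfolding disjoint_family_on_def by auto
  moreover have "(\<Union>i\<in>{1..K}. X i) \<subseteq> Y" using X by blast
  moreover have "(\<Sum>i\<le>K. s i) = card Y"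
  proof -
    have "(\<Sum>i\<le>K. s i) = (\<Sum>k<N. r k)"
      unfolding s_def using sum.group[of "{..<N}" "{..K}" ct r] ct by (auto simp: lessThan_def)
    then show ?thesis using sum by simp
  qed
  moreover have "{..K} = insert 0 {1..K}" by auto
  ultimately have "card (Z 0) = s 0" unfolding Z_def using fN by (simp add: card_Diff_subset finite_subset)
  then have cZ: "card (Z i) = s i" if "i \<le> K" for i using X(1)[of i] that by (cases "i = 0") (auto simp: Z_def)
  have UZ: "\<exists>i\<le>K. y \<in> Z i" if "y \<in> Y" for y
  proof (cases "y \<in> (\<Union>i\<in>{1..K}. X i)")
    case True
    then obtain i where "i \<in> {1..K}" "y \<in> X i" by auto
    then show ?thesis by (intro exI[of _ i]) (auto simp: Z_def)
  next
    case False
    then show ?thesis using that by (intro exI[of _ 0]) (auto simp: Z_def)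
  qed
  have dZ: "i = j" if "y \<in> Z i" "y \<in> Z j" "i \<le> K" "j \<le> K" for i j y
    using that X(1)[of i] X(1)[of j] unfolding Z_def by (auto split: if_splits)
  have ex: "\<exists>col. (\<forall>y\<in>Z i. col y \<in> {k. k < N \<and> ct k = i} \<and> \<not> bad y (col y)) \<and>
          (\<forall>k\<in>{k. k < N \<and> ct k = i}. card {y\<in>Z i. col y = k} = r k)" if i: "i \<le> K" for i
  proof (rule colouring_avoiding[OF fZ[OF i] _ _ _ _ ])
    show "(\<Sum>k\<in>{k. k < N \<and> ct k = i}. r k) = card (Z i)" using cZ[OF i] unfolding s_def by simp
    show "p + q < card (Z i)" using pq[OF i] cZ[OF i] unfolding s_def by simp
    fix y assume "y \<in> Z i"
    then have "(\<Sum>k\<in>{k. k < N \<and> bad y k}. r k) \<le> p" using p ZY[OF i] by auto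
    moreover have "(\<Sum>k\<in>{k \<in> {k. k < N \<and> ct k = i}. bad y k}. r k) \<le> (\<Sum>k\<in>{k. k < N \<and> bad y k}. r k)"
      by (intro sum_mono2) auto
    ultimately show "(\<Sum>k\<in>{k \<in> {k. k < N \<and> ct k = i}. bad y k}. r k) \<le> p" by linarith
  next
    fix k assume k: "k \<in> {k. k < N \<and> ct k = i}"
    have "card {y\<in>Z i. bad y k} \<le> card {y\<in>Y. bad y k}"
      using ZY[OF i] fN by (intro card_mono) auto
    then show "card {y\<in>Z i. bad y k} \<le> q" using q[of k] k by simp
  qed auto
  have "\<forall>i. \<exists>col. i \<le> K \<longrightarrow> (\<forall>y\<in>Z i. col y \<in> {k. k < N \<and> ct k = i} \<and> \<not> bad y (col y)) \<and>
          (\<forall>k\<in>{k. k < N \<and> ct k = i}. card {y\<in>Z i. col y = k} = r k)"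
    using ex by blast
  from choice[OF this] obtain C where C0: "\<forall>i. i \<le> K \<longrightarrow> (\<forall>y\<in>Z i. C i y \<in> {k. k < N \<and> ct k = i} \<and> \<not> bad y (C i y)) \<and>
          (\<forall>k\<in>{k. k < N \<and> ct k = i}. card {y\<in>Z i. C i y = k} = r k)" by blast
  have C: "\<And>i y. i \<le> K \<Longrightarrow> y \<in> Z i \<Longrightarrow> C i y < N \<and> ct (C i y) = i \<and> \<not> bad y (C i y)"
    "\<And>i k. i \<le> K \<Longrightarrow> k < N \<Longrightarrow> ct k = i \<Longrightarrow> card {y\<in>Z i. C i y = k} = r k"
    using C0 by blast+
  define g where "g y = (SOME i. i \<le> K \<and> y \<in> Z i)" for y
  have g: "g y \<le> K \<and> y \<in> Z (g y)" if "y \<in> Y" for y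
    using UZ[OF that] unfolding g_def by (metis (mono_tags, lifting) someI_ex)
  define col where "col y = C (g y) y" for y
  have col: "col y < N \<and> ct (col y) = g y \<and> \<not> bad y (col y)" if "y \<in> Y" for y
    using C(1) g[OF that] unfolding col_def by auto
  have "g y \<in> {0, a y}" if "y \<in> Y" for y
    using g[OF that] X(1)[of "g y"] unfolding Z_def by (auto split: if_splits)
  moreover have "card {y\<in>Y. col y = k} = r k" if k: "k < N" for k
  proof -
    have "{y\<in>Y. col y = k} = {y\<in>Z (ct k). C (ct k) y = k}"
    proof (intro set_eqI iffI)
      fix y assume "y \<in> {y\<in>Y. col y = k}"
      then show "y \<in> {y\<in>Z (ct k). C (ct k) y = k}"
        using col g unfolding col_def by auto
    next
      fix y assume y: "y \<in> {y\<in>Z (ct k). C (ct k) y = k}"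
      then have "y \<in> Y" using ZY ct[OF k] by auto
      moreover have "g y = ct k" using dZ[of y "g y" "ct k"] g[OF \<open>y \<in> Y\<close>] y ct[OF k] by auto
      ultimately show "y \<in> {y\<in>Y. col y = k}" using y unfolding col_def by auto
    qed
    then show ?thesis using C(2)[OF ct[OF k] k] by simp
  qed
  ultimately show ?thesis using col by (intro exI[of _ col]) auto
qed

text \<open>\<open>P k\<close> are the vertices on the cross edges of colour \<open>k\<close>. A neighbour \<open>y\<close> of the current vertex
  is barred from the at most \<open>z\<close> colours of its cross edges and from those of its edges to
  earlier vertices of \<open>U\<close>; a colour is barred from at most two neighbours for its cross edges
  and from two more for each earlier vertex.\<close>

lemma extend_colouring:
  fixes P :: "nat \<Rightarrow> 'a set" and Y :: "'a \<Rightarrow> 'a set" and a :: "'a \<Rightarrow> nat" and ct :: "nat \<Rightarrow> nat"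
  defines "r \<equiv> \<lambda>v k. if v \<in> P k then 1 else 2 :: nat"
  assumes fU: "finite U" and fY: "\<And>v. v \<in> U \<Longrightarrow> finite (Y v)"
    and a: "\<And>v y. v \<in> U \<Longrightarrow> y \<in> Y v \<Longrightarrow> a y \<in> {1..K}" and ct: "\<And>k. k < N \<Longrightarrow> ct k \<le> K"
    and sum: "\<And>v. v \<in> U \<Longrightarrow> (\<Sum>k<N. r v k) = card (Y v)"
    and room: "\<And>v i. v \<in> U \<Longrightarrow> i \<in> {1..K} \<Longrightarrow>
        (\<Sum>k\<in>{k. k < N \<and> ct k = i}. r v k) \<le> card {y\<in>Y v. a y = i}"
    and P: "\<And>k. k < N \<Longrightarrow> finite (P k) \<and> card (P k) \<le> 2"
    and z: "\<And>v y. v \<in> U \<Longrightarrow> y \<in> Y v \<Longrightarrow> card {k. k < N \<and> y \<in> P k} \<le> z"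
    and large: "\<And>v i. v \<in> U \<Longrightarrow> i \<le> K \<Longrightarrow> 4 * card U + 2 * z + 2 < (\<Sum>k\<in>{k. k < N \<and> ct k = i}. r v k)"
  shows "\<exists>col. (\<forall>v\<in>U. (\<forall>y\<in>Y v. col v y < N \<and> y \<notin> P (col v y) \<and> ct (col v y) \<in> {0, a y})
              \<and> (\<forall>k<N. card {y\<in>Y v. col v y = k} = r v k))
           \<and> (\<forall>v\<in>U. \<forall>w\<in>U. \<forall>y. v \<noteq> w \<longrightarrow> y \<in> Y v \<longrightarrow> y \<in> Y w \<longrightarrow> col v y \<noteq> col w y)"
proof -
  have "\<exists>col. (\<forall>v\<in>F. (\<forall>y\<in>Y v. col v y < N \<and> y \<notin> P (col v y) \<and> ct (col v y) \<in> {0, a y})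
              \<and> (\<forall>k<N. card {y\<in>Y v. col v y = k} = r v k))
           \<and> (\<forall>v\<in>F. \<forall>w\<in>F. \<forall>y. v \<noteq> w \<longrightarrow> y \<in> Y v \<longrightarrow> y \<in> Y w \<longrightarrow> col v y \<noteq> col w y)"
    if "F \<subseteq> U" for F
    using finite_subset[OF that fU] that
  proof (induction F rule: finite_induct)
    case empty
    then show ?case by auto
  next
    case (insert v F)
    then have "F \<subseteq> U" by blast
    from insert.IH[OF this] obtain col
      where col0: "\<forall>v\<in>F. (\<forall>y\<in>Y v. col v y < N \<and> y \<notin> P (col v y) \<and> ct (col v y) \<in> {0, a y})
              \<and> (\<forall>k<N. card {y\<in>Y v. col v y = k} = r v k)"
        and col1: "\<forall>v\<in>F. \<forall>w\<in>F. \<forall>y. v \<noteq> w \<longrightarrow> y \<in> Y v \<longrightarrow> y \<in> Y w \<longrightarrow> col v y \<noteq> col w y"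
      by blast
    have col: "\<And>w y. w \<in> F \<Longrightarrow> y \<in> Y w \<Longrightarrow> col w y < N \<and> y \<notin> P (col w y) \<and> ct (col w y) \<in> {0, a y}"
      "\<And>w k. w \<in> F \<Longrightarrow> k < N \<Longrightarrow> card {y\<in>Y w. col w y = k} = r w k"
      "\<And>v w y. v \<in> F \<Longrightarrow> w \<in> F \<Longrightarrow> v \<noteq> w \<Longrightarrow> y \<in> Y v \<Longrightarrow> y \<in> Y w \<Longrightarrow> col v y \<noteq> col w y"
      using col0 col1 by blast+
    have v: "v \<in> U" and cF: "card F \<le> card U" using insert.prems fU card_mono[of U F] by auto
    define bad where "bad y k \<longleftrightarrow> y \<in> P k \<or> (\<exists>w\<in>F. y \<in> Y w \<and> col w y = k)" for y k
    have "\<exists>c. (\<forall>y\<in>Y v. c y < N \<and> \<not> bad y (c y) \<and> ct (c y) \<in> {0, a y})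
           \<and> (\<forall>k<N. card {y\<in>Y v. c y = k} = r v k)"
    proof (rule extend_at_vertex[where p="2 * (z + card U)" and q="2 * card U + 2" and K=K])
      fix y assume y: "y \<in> Y v"
      have "{k. k < N \<and> bad y k} \<subseteq> {k. k < N \<and> y \<in> P k} \<union> (\<lambda>w. col w y) ` F"
        unfolding bad_def by auto
      then have "card {k. k < N \<and> bad y k} \<le> card ({k. k < N \<and> y \<in> P k} \<union> (\<lambda>w. col w y) ` F)"
        using insert.hyps(1) by (intro card_mono) auto
      also have "\<dots> \<le> z + card U"
        using z[OF v y] cF card_image_le[OF insert.hyps(1), of "\<lambda>w. col w y"]
          card_Un_le[of "{k. k < N \<and> y \<in> P k}" "(\<lambda>w. col w y) ` F"] by linarith
      finally have "card {k. k < N \<and> bad y k} * 2 \<le> 2 * (z + card U)" by simp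
      moreover have "(\<Sum>k\<in>{k. k < N \<and> bad y k}. r v k) \<le> card {k. k < N \<and> bad y k} * 2"
        using sum_bounded_above[of "{k. k < N \<and> bad y k}" "r v" 2] unfolding r_def by auto
      ultimately show "(\<Sum>k\<in>{k. k < N \<and> bad y k}. r v k) \<le> 2 * (z + card U)" by linarith
    next
      fix k assume k: "k < N"
      have fin: "finite {y\<in>Y w. col w y = k}" if "w \<in> F" for w using fY insert.prems that by auto
      have "{y\<in>Y v. bad y k} \<subseteq> P k \<union> (\<Union>w\<in>F. {y\<in>Y w. col w y = k})"
        unfolding bad_def by auto
      then have "card {y\<in>Y v. bad y k} \<le> card (P k \<union> (\<Union>w\<in>F. {y\<in>Y w. col w y = k}))"
        using P[OF k] insert.hyps(1) fin by (intro card_mono) auto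
      also have "\<dots> \<le> card (P k) + card (\<Union>w\<in>F. {y\<in>Y w. col w y = k})" by (rule card_Un_le)
      also have "card (\<Union>w\<in>F. {y\<in>Y w. col w y = k}) \<le> (\<Sum>w\<in>F. card {y\<in>Y w. col w y = k})"
        by (rule card_UN_le[OF insert.hyps(1)])
      also have "\<dots> \<le> card F * 2"
        using sum_bounded_above[of F "\<lambda>w. card {y\<in>Y w. col w y = k}" 2] col(2) k unfolding r_def by auto
      finally show "card {y\<in>Y v. bad y k} \<le> 2 * card U + 2" using P[OF k] cF by linarith
    next
      fix i assume "i \<le> K"
      then show "2 * (z + card U) + (2 * card U + 2) < (\<Sum>k\<in>{k. k < N \<and> ct k = i}. r v k)"
        using large[OF v] by fastforce
    qed (use fY v a ct sum room in auto)
    then obtain c where c: "\<And>y. y \<in> Y v \<Longrightarrow> c y < N \<and> \<not> bad y (c y) \<and> ct (c y) \<in> {0, a y}"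
      "\<And>k. k < N \<Longrightarrow> card {y\<in>Y v. c y = k} = r v k" by blast
    define col' where "col' = col(v := c)"
    have n: "w \<noteq> v" if "w \<in> F" for w using that insert.hyps by auto
    have A: "(\<forall>y\<in>Y w. col' w y < N \<and> y \<notin> P (col' w y) \<and> ct (col' w y) \<in> {0, a y})
              \<and> (\<forall>k<N. card {y\<in>Y w. col' w y = k} = r w k)" if "w \<in> insert v F" for w
    proof (cases "w = v")
      case True
      then show ?thesis using c unfolding col'_def bad_def by auto
    next
      case False
      then show ?thesis using col(1,2) that unfolding col'_def by auto
    qed
    have B: "col' u y \<noteq> col' w y"
      if "u \<in> insert v F" "w \<in> insert v F" "u \<noteq> w" "y \<in> Y u" "y \<in> Y w" for u w y
      using that col(3)[of u w y] c(1)[of y] n unfolding col'_def bad_def by auto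
    show ?case
    proof (intro exI[of _ col'] conjI)
      show "\<forall>w\<in>insert v F. (\<forall>y\<in>Y w. col' w y < N \<and> y \<notin> P (col' w y) \<and> ct (col' w y) \<in> {0, a y})
              \<and> (\<forall>k<N. card {y\<in>Y w. col' w y = k} = r w k)"
        using A by (rule ballI)
      show "\<forall>u\<in>insert v F. \<forall>w\<in>insert v F. \<forall>y. u \<noteq> w \<longrightarrow> y \<in> Y u \<longrightarrow> y \<in> Y w \<longrightarrow> col' u y \<noteq> col' w y"
        by (intro ballI allI impI, rule B)
    qed
  qed
  then show ?thesis by blast
qed

section \<open>Exceptional systems from their edges\<close>

lemma edges_path_graph_single: "edges (path_graph [x]) = {}"
  by (simp add: path_graph_def)

lemma edges_path_graph_Cons: "edges (path_graph (x # y # zs)) = insert {x, y} (edges (path_graph (y # zs)))"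
proof -
  have "{{(x # y # zs) ! i, (x # y # zs) ! Suc i} | i. Suc i < length (x # y # zs)}
      = insert {x, y} {{(y # zs) ! i, (y # zs) ! Suc i} | i. Suc i < length (y # zs)}" (is "?L = ?R")
  proof
    show "?L \<subseteq> ?R"
    proof
      fix e assume "e \<in> ?L"
      then obtain i where i: "e = {(x # y # zs) ! i, (x # y # zs) ! Suc i}" "Suc i < length (x # y # zs)" by auto
      then show "e \<in> ?R" by (cases i) auto
    qed
    show "?R \<subseteq> ?L"
    proof
      fix e assume "e \<in> ?R"
      then consider "e = {x, y}" | i where "e = {(y # zs) ! i, (y # zs) ! Suc i}" "Suc i < length (y # zs)" by auto
      then show "e \<in> ?L"
      proof cases
        case 1
        then show ?thesis by (intro CollectI exI[of _ 0]) auto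
      next
        case 2
        then show ?thesis by (intro CollectI exI[of _ "Suc i"]) auto
      qed
    qed
  qed
  then show ?thesis by (simp add: path_graph_def)
qed

lemmas edges_path_graph = edges_path_graph_single edges_path_graph_Cons

lemma verts_path_graph: "verts (path_graph xs) = set xs"
  by (simp add: path_graph_def)

text \<open>One side of an exceptional system: \<open>C0\<close> are the exceptional vertices of this side, \<open>C\<close> its core,
  \<open>X\<close> the ends of the cross edges on this side, and \<open>F\<close> the edges from \<open>C0\<close> to \<open>C\<close>.\<close>

locale half_system =
  fixes C0 C X :: "'a set" and F :: "('a \<times> 'a) set"
  assumes F: "F \<subseteq> C0 \<times> C" and disj: "C0 \<inter> C = {}" and X: "X \<subseteq> C0 \<union> C"
    and degF: "\<And>v. v \<in> C0 \<Longrightarrow> card {y. (v, y) \<in> F} = (if v \<in> X then 1 else 2)"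
    and FX: "\<And>v y. (v, y) \<in> F \<Longrightarrow> y \<notin> X"
    and injF: "\<And>v w y. (v, y) \<in> F \<Longrightarrow> (w, y) \<in> F \<Longrightarrow> v = w"
begin

definition nb :: "'a \<Rightarrow> 'a" where "nb v = (SOME y. (v, y) \<in> F)"

definition nb' :: "'a \<Rightarrow> 'a" where "nb' v = (SOME y. (v, y) \<in> F \<and> y \<noteq> nb v)"

lemma F_hit: assumes "v \<in> C0" "v \<in> X" shows "(v, y) \<in> F \<longleftrightarrow> y = nb v"
proof -
  obtain z where z: "{y. (v, y) \<in> F} = {z}"
    using degF[OF assms(1)] assms(2) by (auto simp: card_1_singleton_iff)
  then have "nb v = z" unfolding nb_def by auto
  then show ?thesis using z by auto
qed

lemma F_free: assumes "v \<in> C0" "v \<notin> X" shows "(v, y) \<in> F \<longleftrightarrow> y = nb v \<or> y = nb' v" "nb v \<noteq> nb' v"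
proof -
  obtain z z' where z: "{y. (v, y) \<in> F} = {z, z'}" "z \<noteq> z'"
    using degF[OF assms(1)] assms(2) by (auto simp: card_2_iff)
  then have mem: "(v, y) \<in> F \<longleftrightarrow> y = z \<or> y = z'" for y by auto
  have n: "nb v = z \<or> nb v = z'" unfolding nb_def mem by (rule someI_ex) blast
  have "(nb' v = z \<or> nb' v = z') \<and> nb' v \<noteq> nb v"
    unfolding nb'_def mem by (rule someI_ex) (use z(2) n in blast)
  then show "(v, y) \<in> F \<longleftrightarrow> y = nb v \<or> y = nb' v" "nb v \<noteq> nb' v" using n mem by auto
qed

text \<open>The part on this side of the path through a cross edge with end \<open>x\<close>, listed towards \<open>x\<close>.\<close>

definition arm :: "'a \<Rightarrow> 'a list" where
  "arm x = (if x \<in> C0 then [nb x, x] else [x])"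

text \<open>The path of an exceptional vertex that is on no cross edge.\<close>

definition loop :: "'a \<Rightarrow> 'a list" where
  "loop v = [nb v, v, nb' v]"

text \<open>The vertex of \<open>C0 \<union> X\<close> in whose arm or loop \<open>z\<close> lies.\<close>

definition root :: "'a \<Rightarrow> 'a" where
  "root z = (if z \<in> C0 \<union> X then z else (THE v. (v, z) \<in> F))"

lemma nb_in: "v \<in> C0 \<Longrightarrow> nb v \<in> C - X" "v \<in> C0 \<Longrightarrow> v \<notin> X \<Longrightarrow> nb' v \<in> C - X"
  using F_hit[of v "nb v"] F_free(1)[of v "nb v"] F_free(1)[of v "nb' v"] F FX by blast+

lemma root_F: "(v, z) \<in> F \<Longrightarrow> root z = v"
  using F FX disj injF unfolding root_def by (auto intro!: the_equality)

lemma set_arm: assumes "x \<in> X" shows "set (arm x) \<subseteq> C0 \<union> C" "z \<in> set (arm x) \<Longrightarrow> root z = x"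
proof -
  show "set (arm x) \<subseteq> C0 \<union> C" using nb_in[of x] assms X unfolding arm_def by auto
  show "root z = x" if "z \<in> set (arm x)"
    using that root_F[of x z] F_hit[of x z] assms unfolding arm_def
    by (auto split: if_splits simp: root_def)
qed

lemma distinct_arm: "x \<in> X \<Longrightarrow> distinct (arm x)"
  using nb_in(1)[of x] unfolding arm_def by auto

lemma set_loop: assumes "v \<in> C0 - X" shows "set (loop v) \<subseteq> C0 \<union> C" "z \<in> set (loop v) \<Longrightarrow> root z = v"
proof -
  show "set (loop v) \<subseteq> C0 \<union> C" using nb_in[of v] assms unfolding loop_def by auto
  show "root z = v" if "z \<in> set (loop v)"
    using that root_F[of v z] F_free(1)[of v z] assms unfolding loop_def by (auto simp: root_def)
qed

lemma distinct_loop: "v \<in> C0 - X \<Longrightarrow> distinct (loop v)"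
  using nb_in[of v] F_free(2)[of v] disj unfolding loop_def by auto

lemma edges_arm: "edges (path_graph (arm x)) = (if x \<in> C0 then {{x, nb x}} else {})"
  unfolding arm_def by (simp add: edges_path_graph insert_commute)

lemma edges_loop: "edges (path_graph (loop v)) = {{v, nb v}, {v, nb' v}}"
  unfolding loop_def by (simp add: edges_path_graph insert_commute)

lemma F_edges:
  "(\<lambda>e. {fst e, snd e}) ` F = (\<Union>x\<in>X. edges (path_graph (arm x))) \<union> (\<Union>v\<in>C0 - X. edges (path_graph (loop v)))"
proof -
  have "{y. (v, y) \<in> F} = (if v \<in> X then {nb v} else {nb v, nb' v})" if "v \<in> C0" for v
    using F_hit[OF that] F_free(1)[OF that] by auto
  moreover have "F = (\<Union>v\<in>C0. Pair v ` {y. (v, y) \<in> F})" using F by auto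
  ultimately have "F = (\<Union>v\<in>C0. Pair v ` (if v \<in> X then {nb v} else {nb v, nb' v}))" by simp
  also have "\<dots> = (\<Union>v\<in>C0 \<inter> X. {(v, nb v)}) \<union> (\<Union>v\<in>C0 - X. {(v, nb v), (v, nb' v)})"
    by (auto split: if_splits)
  finally have e: "F = (\<Union>v\<in>C0 \<inter> X. {(v, nb v)}) \<union> (\<Union>v\<in>C0 - X. {(v, nb v), (v, nb' v)})" .
  show ?thesis unfolding edges_arm edges_loop by (subst e) (auto simp: image_Un image_UN)
qed

text \<open>The end of a cross edge at position \<open>j\<close> of a path that starts in the core has only one possible
  predecessor, namely its neighbour along \<open>F\<close>, and that neighbour has no further edge.\<close>

lemma arm_is_prefix:
  assumes d: "distinct xs" and j: "Suc j < length xs" and h: "xs ! 0 \<in> C" and x: "xs ! j \<in> X"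
    and adj: "\<And>i. Suc i < length xs \<Longrightarrow> adj (xs ! i) (xs ! Suc i)" and sym: "\<And>u v. adj u v \<Longrightarrow> adj v u"
    and nx: "\<And>u. adj (xs ! j) u \<Longrightarrow> u = xs ! Suc j \<or> (xs ! j, u) \<in> F"
    and na: "\<And>v y u. (v, y) \<in> F \<Longrightarrow> adj y u \<Longrightarrow> u = v"
  shows "take (Suc j) xs = arm (xs ! j)"
proof -
  have prev: "(xs ! j, xs ! (j - 1)) \<in> F" if "j > 0"
  proof -
    have "adj (xs ! (j - 1)) (xs ! j)" using adj[of "j - 1"] j that by auto
    moreover have "xs ! (j - 1) \<noteq> xs ! Suc j" using d j that by (auto simp: nth_eq_iff_index_eq)
    ultimately show ?thesis using sym nx by blast
  qed
  show ?thesis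
  proof (cases "xs ! j \<in> C0")
    case False
    have "j = 0"
    proof (rule ccontr)
      assume "j \<noteq> 0"
      then show False using prev F False by auto
    qed
    then show ?thesis using False j unfolding arm_def by (cases xs) auto
  next
    case True
    then have j0: "j > 0" using h disj by (cases j) auto
    have p: "xs ! (j - 1) = nb (xs ! j)" using prev[OF j0] F_hit[OF True x] by auto
    have "j = 1"
    proof (rule ccontr)
      assume "j \<noteq> 1"
      then have j2: "j \<ge> 2" using j0 by auto
      have "adj (xs ! (j - 2)) (xs ! Suc (j - 2))" using adj[of "j - 2"] j j2 by auto
      then have "adj (xs ! (j - 1)) (xs ! (j - 2))" using sym j2 by (metis Suc_1 Suc_diff_Suc Suc_le_lessD)
      then have "xs ! (j - 2) = xs ! j" using na[OF prev[OF j0]] by blast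
      then show False using d j j2 by (auto simp: nth_eq_iff_index_eq)
    qed
    moreover from this have "take (Suc j) xs = [xs ! 0, xs ! Suc 0]"
      using j by (cases xs; cases "tl xs") auto
    ultimately show ?thesis using True p unfolding arm_def by simp
  qed
qed

end

text \<open>The edges of one colour: the cross edges \<open>M\<close>, as pairs with first component in \<open>A'\<close>, and the
  edges \<open>F\<close> from \<open>A0\<close> to \<open>A\<close> and \<open>F'\<close> from \<open>B0\<close> to \<open>B\<close>.\<close>

locale exc_pieces =
  L: half_system A0 A "fst ` M" F + R: half_system B0 B "snd ` M" F'
  for A0 A B0 B :: "'a set" and M F F' :: "('a \<times> 'a) set" +
  assumes sides: "(A0 \<union> A) \<inter> (B0 \<union> B) = {}" and finV: "finite (A0 \<union> A \<union> B0 \<union> B)"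
    and M: "card M \<in> {0, 2}" "finite M" "matched fst snd M"
begin

definition S where "S = M \<union> F \<union> F'"

definition J :: "'a graph" where
  "J = \<lparr>verts = A0 \<union> B0 \<union> fst ` S \<union> snd ` S, edges = (\<lambda>e. {fst e, snd e}) ` S\<rparr>"

definition pth :: "'a \<times> 'a \<Rightarrow> 'a list" where
  "pth e = L.arm (fst e) @ rev (R.arm (snd e))"

lemma not_both_sides: "x \<in> A0 \<union> A \<Longrightarrow> x \<notin> B0 \<union> B"
  using sides by blast

lemma Msides: "(x, y) \<in> M \<Longrightarrow> x \<in> A0 \<union> A \<and> y \<in> B0 \<union> B"
  using L.X R.X by force

lemma edge_J: "{u, v} \<in> edges J \<longleftrightarrow> (u, v) \<in> S \<or> (v, u) \<in> S"
  unfolding J_def by (auto simp: doubleton_eq_iff image_iff Bex_def)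

lemma M_inj: "(x, y) \<in> M \<Longrightarrow> (x, y') \<in> M \<Longrightarrow> y = y'" "(x, y) \<in> M \<Longrightarrow> (x', y) \<in> M \<Longrightarrow> x = x'"
  using M(3) unfolding matched_def by fastforce+

lemma M_eqI: "e \<in> M \<Longrightarrow> f \<in> M \<Longrightarrow> fst e = fst f \<or> snd e = snd f \<Longrightarrow> e = f"
  using M(3) unfolding matched_def by blast

lemma nbrs_A: assumes "x \<in> A0 \<union> A"
  shows "{x, u} \<in> edges J \<longleftrightarrow> (x, u) \<in> M \<or> (x, u) \<in> F \<or> (u, x) \<in> F"
  using assms sides L.F R.F Msides unfolding edge_J S_def by blast

lemma nbrs_B: assumes "y \<in> B0 \<union> B"
  shows "{y, u} \<in> edges J \<longleftrightarrow> (u, y) \<in> M \<or> (y, u) \<in> F' \<or> (u, y) \<in> F'"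
  using assms sides L.F R.F Msides unfolding edge_J S_def by blast

lemma simple_J: "simple_graph J"
proof -
  have "S \<subseteq> (A0 \<union> A \<union> B0 \<union> B) \<times> (A0 \<union> A \<union> B0 \<union> B)"
    using L.F R.F Msides unfolding S_def by auto
  moreover from this have "finite S" using finV finite_subset by blast
  moreover have "x \<noteq> y" if "(x, y) \<in> S" for x y
    using that L.F R.F L.disj R.disj sides Msides unfolding S_def by blast
  moreover have "finite A0" "finite B0" using finV by auto
  ultimately show ?thesis unfolding simple_graph_def J_def by (auto simp: card_2_iff) blast
qed

lemma verts_J: "A0 \<union> B0 \<subseteq> verts J" "verts J \<subseteq> A0 \<union> A \<union> B0 \<union> B"
proof -
  show "A0 \<union> B0 \<subseteq> verts J" unfolding J_def by auto
  have "S \<subseteq> (A0 \<union> A \<union> B0 \<union> B) \<times> (A0 \<union> A \<union> B0 \<union> B)"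
    using L.F R.F Msides unfolding S_def by auto
  then show "verts J \<subseteq> A0 \<union> A \<union> B0 \<union> B" unfolding J_def by auto
qed

lemma pth: assumes "e \<in> M"
  shows "distinct (pth e)" "pth e \<noteq> []" "hd (pth e) \<in> A" "last (pth e) \<in> B"
    "set (pth e) \<subseteq> A0 \<union> A \<union> B0 \<union> B"
    "edges (path_graph (pth e)) = {{fst e, snd e}} \<union> edges (path_graph (L.arm (fst e))) \<union> edges (path_graph (R.arm (snd e)))"
proof -
  have e: "fst e \<in> fst ` M" "snd e \<in> snd ` M" using assms by auto
  show "distinct (pth e)"
    using L.distinct_arm[OF e(1)] R.distinct_arm[OF e(2)] L.set_arm(1)[OF e(1)] R.set_arm(1)[OF e(2)] sides
    unfolding pth_def by auto
  show "pth e \<noteq> []" unfolding pth_def L.arm_def by auto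
  show "hd (pth e) \<in> A" using L.nb_in[of "fst e"] L.X e(1) unfolding pth_def L.arm_def by auto
  show "last (pth e) \<in> B" using R.nb_in[of "snd e"] R.X e(2) unfolding pth_def R.arm_def by auto
  show "set (pth e) \<subseteq> A0 \<union> A \<union> B0 \<union> B"
    using L.set_arm(1)[OF e(1)] R.set_arm(1)[OF e(2)] unfolding pth_def by auto
  show "edges (path_graph (pth e)) = {{fst e, snd e}} \<union> edges (path_graph (L.arm (fst e))) \<union> edges (path_graph (R.arm (snd e)))"
    unfolding pth_def L.arm_def R.arm_def by (auto simp: edges_path_graph insert_commute)
qed

definition Ps :: "'a graph set" where
  "Ps = (\<lambda>e. path_graph (pth e)) ` M \<union> (\<lambda>v. path_graph (L.loop v)) ` (A0 - fst ` M)
      \<union> (\<lambda>v. path_graph (R.loop v)) ` (B0 - snd ` M)"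

text \<open>The path that contains the vertex \<open>z\<close>. That each path of \<open>Ps\<close> can be recovered from any of its
  vertices makes the paths disjoint.\<close>

definition comp :: "'a \<Rightarrow> 'a graph" where
  "comp z = (if z \<in> A0 \<union> A
     then if L.root z \<in> fst ` M then path_graph (pth (THE e. e \<in> M \<and> fst e = L.root z)) else path_graph (L.loop (L.root z))
     else if R.root z \<in> snd ` M then path_graph (pth (THE e. e \<in> M \<and> snd e = R.root z)) else path_graph (R.loop (R.root z)))"

lemma comp: assumes "P \<in> Ps" "z \<in> verts P" shows "comp z = P"
proof -
  consider e where "e \<in> M" "P = path_graph (pth e)" | v where "v \<in> A0 - fst ` M" "P = path_graph (L.loop v)"
    | v where "v \<in> B0 - snd ` M" "P = path_graph (R.loop v)" using assms(1) unfolding Ps_def by blast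
  then show ?thesis
  proof cases
    case (1 e)
    have e: "fst e \<in> fst ` M" "snd e \<in> snd ` M" using 1 by auto
    have u: "(THE e'. e' \<in> M \<and> fst e' = fst e) = e" "(THE e'. e' \<in> M \<and> snd e' = snd e) = e"
      using 1(1) M_eqI by (blast intro: the_equality)+
    have "z \<in> set (L.arm (fst e)) \<or> z \<in> set (R.arm (snd e))"
      using assms(2) 1 by (auto simp: verts_path_graph pth_def)
    then show ?thesis
    proof
      assume z: "z \<in> set (L.arm (fst e))"
      then have "z \<in> A0 \<union> A" "L.root z = fst e" using L.set_arm[OF e(1)] by blast+
      then show ?thesis using 1 e u unfolding comp_def by simp
    next
      assume z: "z \<in> set (R.arm (snd e))"
      then have "z \<in> B0 \<union> B" "R.root z = snd e" using R.set_arm[OF e(2)] by blast+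
      moreover from this have "z \<notin> A0 \<union> A" using sides by blast
      ultimately show ?thesis using 1 e u unfolding comp_def by simp
    qed
  next
    case (2 v)
    have "z \<in> set (L.loop v)" using assms(2) 2 by (simp add: verts_path_graph)
    then have "z \<in> A0 \<union> A" "L.root z = v" using L.set_loop[OF 2(1)] by blast+
    then show ?thesis using 2 unfolding comp_def by simp
  next
    case (3 v)
    have "z \<in> set (R.loop v)" using assms(2) 3 by (simp add: verts_path_graph)
    then have "z \<in> B0 \<union> B" "R.root z = v" using R.set_loop[OF 3(1)] by blast+
    moreover from this have "z \<notin> A0 \<union> A" using sides by blast
    ultimately show ?thesis using 3 unfolding comp_def by simp
  qed
qed

lemma edges_Ps: "(\<Union>P\<in>Ps. edges P) = edges J"
proof -
  let ?d = "\<lambda>e::'a \<times> 'a. {fst e, snd e}"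
  have 1: "(\<Union>e\<in>M. edges (path_graph (pth e))) = ?d ` M \<union> (\<Union>x\<in>fst ` M. edges (path_graph (L.arm x)))
      \<union> (\<Union>y\<in>snd ` M. edges (path_graph (R.arm y)))"
    using pth(6) by auto
  have 2: "(\<Union>P\<in>Ps. edges P) = (\<Union>e\<in>M. edges (path_graph (pth e)))
      \<union> (\<Union>v\<in>A0 - fst ` M. edges (path_graph (L.loop v))) \<union> (\<Union>v\<in>B0 - snd ` M. edges (path_graph (R.loop v)))"
    unfolding Ps_def by auto
  have 3: "edges J = ?d ` M \<union> ?d ` F \<union> ?d ` F'" unfolding J_def S_def by (simp add: image_Un)
  show ?thesis unfolding 1 2 3 L.F_edges R.F_edges by (simp only: Un_ac)
qed

lemma verts_path_union: "length xs \<ge> 2 \<Longrightarrow> \<Union> (edges (path_graph xs)) = set xs"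
proof (induction xs rule: induct_list012)
  case (3 x y zs)
  then show ?case by (cases zs) (auto simp: edges_path_graph)
qed auto

lemma verts_Ps: "(\<Union>P\<in>Ps. verts P) = verts J"
proof -
  have "verts P = \<Union> (edges P)" if "P \<in> Ps" for P
  proof -
    have "length (pth e) \<ge> 2" for e unfolding pth_def L.arm_def R.arm_def by auto
    moreover have "length (L.loop v) \<ge> 2" "length (R.loop v) \<ge> 2" for v
      unfolding L.loop_def R.loop_def by auto
    ultimately have "\<exists>xs. length xs \<ge> 2 \<and> P = path_graph xs" using that unfolding Ps_def by blast
    then show ?thesis using verts_path_union verts_path_graph by metis
  qed
  then have "(\<Union>P\<in>Ps. verts P) = \<Union> (\<Union>P\<in>Ps. edges P)" by auto
  also have "\<dots> = fst ` S \<union> snd ` S" unfolding edges_Ps by (auto simp: J_def)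
  also have "\<dots> = verts J"
  proof -
    have "v \<in> fst ` S" if "v \<in> A0" for v
    proof -
      have "(v, L.nb v) \<in> F" using that L.F_hit[of v] L.F_free[of v] by blast
      then show ?thesis unfolding S_def by force
    qed
    moreover have "v \<in> fst ` S" if "v \<in> B0" for v
    proof -
      have "(v, R.nb v) \<in> F'" using that R.F_hit[of v] R.F_free[of v] by blast
      then show ?thesis unfolding S_def by force
    qed
    ultimately show ?thesis unfolding J_def by auto
  qed
  finally show ?thesis .
qed

lemma path_system_J: "path_system J"
  unfolding path_system_def
proof (intro exI[of _ Ps] conjI ballI)
  show "finite Ps" using M(2) finV unfolding Ps_def by auto
  show "is_path P" if "P \<in> Ps" for P
    using that pth(1,2) L.distinct_loop R.distinct_loop unfolding Ps_def is_path_def L.loop_def R.loop_def by blast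
  show "disjoint_family_on verts Ps"
    unfolding disjoint_family_on_def using comp by blast
  show "J = \<lparr>verts = \<Union> (verts ` Ps), edges = \<Union> (edges ` Ps)\<rparr>"
    using edges_Ps verts_Ps by simp
qed

lemma deg_exceptional: assumes "v \<in> A0 \<union> B0" shows "deg J v = 2"
proof -
  have c: "card Q = (if Q = {} then 0 else 1)" if "\<And>u u'. u \<in> Q \<Longrightarrow> u' \<in> Q \<Longrightarrow> u = u'" for Q :: "'a set"
  proof (cases "Q = {}")
    case False
    then obtain u where "u \<in> Q" by blast
    then have "Q = {u}" using that by blast
    then show ?thesis by simp
  qed simp
  show ?thesis
  proof (cases "v \<in> A0")
    case True
    then have "v \<notin> A" using L.disj by auto
    then have "{u. {v, u} \<in> edges J} = {u. (v, u) \<in> M} \<union> {u. (v, u) \<in> F}"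
      using nbrs_A[of v] True L.F by auto
    moreover have "{u. (v, u) \<in> M} \<inter> {u. (v, u) \<in> F} = {}" using Msides L.F sides by blast
    moreover have "finite {u. (v, u) \<in> M}" by (rule finite_subset[of _ "snd ` M"]) (use M(2) in force)+
    moreover have "card {u. (v, u) \<in> M} = (if v \<in> fst ` M then 1 else 0)"
      using c[of "{u. (v, u) \<in> M}"] M_inj(1) by force
    ultimately show ?thesis unfolding deg_def using L.degF[OF True]
      by (simp add: card_Un_disjoint card_ge_0_finite split: if_splits)
  next
    case False
    then have v: "v \<in> B0" "v \<notin> B" using assms R.disj by auto
    then have "{u. {v, u} \<in> edges J} = {u. (u, v) \<in> M} \<union> {u. (v, u) \<in> F'}"
      using nbrs_B[of v] R.F by auto
    moreover have "{u. (u, v) \<in> M} \<inter> {u. (v, u) \<in> F'} = {}" using Msides R.F sides by blast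
    moreover have "finite {u. (u, v) \<in> M}" by (rule finite_subset[of _ "fst ` M"]) (use M(2) in force)+
    moreover have "card {u. (u, v) \<in> M} = (if v \<in> snd ` M then 1 else 0)"
      using c[of "{u. (u, v) \<in> M}"] M_inj(2) by force
    ultimately show ?thesis unfolding deg_def using R.degF[OF v(1)]
      by (simp add: card_Un_disjoint card_ge_0_finite split: if_splits)
  qed
qed

lemma nbrs_core:
  assumes "v \<in> A \<union> B" "{v, u} \<in> edges J" "{v, u'} \<in> edges J" shows "u = u'"
proof -
  consider "v \<in> A" "v \<notin> A0" | "v \<in> B" "v \<notin> B0" using assms(1) L.disj R.disj by blast
  then show ?thesis
  proof cases
    case 1
    then have "(v, u) \<in> M \<or> (u, v) \<in> F" "(v, u') \<in> M \<or> (u', v) \<in> F"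
      using nbrs_A[of v] assms L.F by auto
    then show ?thesis using M_inj(1) L.injF L.FX by (metis fst_conv image_eqI)
  next
    case 2
    then have "(u, v) \<in> M \<or> (u, v) \<in> F'" "(u', v) \<in> M \<or> (u', v) \<in> F'"
      using nbrs_B[of v] assms R.F by auto
    then show ?thesis using M_inj(2) R.injF R.FX by (metis snd_conv image_eqI)
  qed
qed

lemma deg_core: assumes "v \<in> A \<union> B" shows "deg J v \<le> 1"
proof (cases "\<exists>u. {v, u} \<in> edges J")
  case True
  then obtain u where "{v, u} \<in> edges J" by auto
  then have "{u. {v, u} \<in> edges J} = {u}" using nbrs_core[OF assms] by auto
  then show ?thesis unfolding deg_def by simp
next
  case False
  then show ?thesis unfolding deg_def by simp
qed

lemma exceptional_cover_J: "exceptional_cover A0 A B0 B J"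
proof -
  have "\<not> e \<subseteq> A \<and> \<not> e \<subseteq> B" if e: "e \<in> edges J" for e
  proof -
    obtain x y where xy: "(x, y) \<in> S" "e = {x, y}" using e unfolding J_def by force
    consider "(x, y) \<in> M" | "(x, y) \<in> F" | "(x, y) \<in> F'" using xy(1) unfolding S_def by blast
    then show ?thesis
    proof cases
      case 1
      then show ?thesis using Msides[OF 1] sides xy(2) by blast
    next
      case 2
      then show ?thesis using L.F L.disj sides xy(2) by blast
    next
      case 3
      then show ?thesis using R.F R.disj sides xy(2) by blast
    qed
  qed
  then have "num_edges_in J A = 0" "num_edges_in J B = 0"
    unfolding num_edges_in_def by (simp_all add: card_eq_0_iff)
  moreover have "deg J v \<le> 1" if "v \<in> verts J - (A0 \<union> B0)" for v
    using that verts_J(2) deg_core[of v] by blast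
  ultimately show ?thesis
    unfolding exceptional_cover_def using path_system_J verts_J deg_exceptional by blast
qed

lemma subgraph_pth: assumes "e \<in> M" shows "subgraph (path_graph (pth e)) J"
proof -
  have P: "path_graph (pth e) \<in> Ps" using assms unfolding Ps_def by auto
  have v: "verts (path_graph (pth e)) \<subseteq> verts J" using P verts_Ps by blast
  have E: "edges (path_graph (pth e)) \<subseteq> edges J" using P edges_Ps by blast
  have "length (pth e) \<ge> 2" unfolding pth_def L.arm_def R.arm_def by auto
  then have "\<Union> (edges (path_graph (pth e))) = verts (path_graph (pth e))"
    using verts_path_union by (simp add: verts_path_graph)
  then have "simple_graph (path_graph (pth e))"
    using simple_J v E finite_subset unfolding simple_graph_def by blast
  then show ?thesis using v E unfolding subgraph_def by blast
qed

text \<open>The step of the path from \<open>A'\<close> to \<open>B'\<close> uses a cross edge; what precedes it is an arm, and so,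
  read backwards, is what follows it.\<close>

lemma AB_path_is_pth:
  assumes d: "distinct xs" and ne: "xs \<noteq> []" and sub: "edges (path_graph xs) \<subseteq> edges J" 
    and vs: "set xs \<subseteq> verts J"
    and h: "hd xs \<in> A" and l: "last xs \<in> B"
  shows "\<exists>e\<in>M. xs = pth e"
proof -
  have adj: "{xs ! i, xs ! Suc i} \<in> edges J" if "Suc i < length xs" for i
    using sub that unfolding path_graph_def by auto
  have side: "xs ! i \<in> (A0 \<union> A) \<union> (B0 \<union> B)" if "i < length xs" for i
    using vs verts_J(2) that nth_mem by blast
  define i where "i = (LEAST i. i < length xs \<and> xs ! i \<in> B0 \<union> B)"
  have ex: "length xs - 1 < length xs \<and> xs ! (length xs - 1) \<in> B0 \<union> B"
    using ne l by (simp add: last_conv_nth)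
  have i: "i < length xs \<and> xs ! i \<in> B0 \<union> B" unfolding i_def using ex by (rule LeastI)
  have "i \<noteq> 0" using i h ne sides by (metis UnI2 disjoint_iff hd_conv_nth)
  then obtain j where j: "i = Suc j" by (cases i) auto
  have "xs ! j \<notin> B0 \<union> B" using not_less_Least[of j "\<lambda>i. i < length xs \<and> xs ! i \<in> B0 \<union> B"] i j unfolding i_def by auto
  then have xj: "xs ! j \<in> A0 \<union> A" using side[of j] i j by auto
  have e: "(xs ! j, xs ! i) \<in> M"
    using adj[of j] i j nbrs_A[OF xj, of "xs ! i"] L.F sides xj by blast
  have jl: "Suc j < length xs" using i j by auto
  have A1: "take (Suc j) xs = L.arm (xs ! j)"
  proof (rule L.arm_is_prefix[OF d jl, where adj="\<lambda>u v. {u, v} \<in> edges J"])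
    show "xs ! 0 \<in> A" using h ne by (simp add: hd_conv_nth)
    show "xs ! j \<in> fst ` M" using e by force
    show "{v, u} \<in> edges J" if "{u, v} \<in> edges J" for u v using that by (simp add: insert_commute)
    show "u = xs ! Suc j \<or> (xs ! j, u) \<in> F" if "{xs ! j, u} \<in> edges J" for u
      using that nbrs_A[OF xj] M_inj(1)[OF e] j L.FX e by (metis fst_conv image_eqI)
    show "u = v" if "(v, y) \<in> F" "{y, u} \<in> edges J" for v y u
    proof -
      have "y \<in> A" "{y, v} \<in> edges J" using that L.F by (auto simp: edge_J S_def)
      then show ?thesis using nbrs_core that(2) by blast
    qed
  qed (use adj in auto)
  \<comment> \<open>The same argument from the other end of the path.\<close>
  define ys where "ys = rev xs"
  define k where "k = length xs - Suc i"
  have k: "ys ! k = xs ! i" "ys ! Suc k = xs ! j" "Suc k < length ys" "Suc k = length xs - i"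
    using i j jl unfolding ys_def k_def by (auto simp: rev_nth Suc_diff_Suc)
  have B1: "take (Suc k) ys = R.arm (ys ! k)"
  proof (rule R.arm_is_prefix[where adj="\<lambda>u v. {u, v} \<in> edges J"])
    show "distinct ys" "Suc k < length ys" using d k unfolding ys_def by auto
    show "ys ! 0 \<in> B" using l ne unfolding ys_def by (simp add: last_conv_nth rev_nth)
    show "ys ! k \<in> snd ` M" using e k by force
    show "{v, u} \<in> edges J" if "{u, v} \<in> edges J" for u v using that by (simp add: insert_commute)
    show "u = ys ! Suc k \<or> (ys ! k, u) \<in> F'" if "{ys ! k, u} \<in> edges J" for u
      using that nbrs_B[of "xs ! i" u] i M_inj(2)[OF e, of u] R.FX e k by (metis snd_conv image_eqI)
    show "u = v" if "(v, y) \<in> F'" "{y, u} \<in> edges J" for v y u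
    proof -
      have "y \<in> B" "{y, v} \<in> edges J" using that R.F by (auto simp: edge_J S_def)
      then show ?thesis using nbrs_core that(2) by blast
    qed
    fix n assume n: "Suc n < length ys"
    then have "ys ! n = xs ! Suc (length xs - Suc (Suc n))" "ys ! Suc n = xs ! (length xs - Suc (Suc n))"
      unfolding ys_def by (auto simp: rev_nth Suc_diff_Suc)
    then show "{ys ! n, ys ! Suc n} \<in> edges J"
      using adj[of "length xs - Suc (Suc n)"] n unfolding ys_def by (auto simp: insert_commute)
  qed
  have "take (Suc k) ys = rev (drop i xs)" using k(4) i unfolding ys_def by (simp add: take_rev)
  then have "drop (Suc j) xs = rev (R.arm (xs ! i))" using B1 k(1) j by (metis rev_rev_ident)
  then have "xs = pth (xs ! j, xs ! i)" using A1 unfolding pth_def by (metis append_take_drop_id fst_conv snd_conv)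
  then show ?thesis using e by blast
qed

lemma card_AB_paths: "card (AB_paths A B J) = card M"
proof -
  have "AB_paths A B J = (\<lambda>e. path_graph (pth e)) ` M"
  proof
    show "AB_paths A B J \<subseteq> (\<lambda>e. path_graph (pth e)) ` M"
    proof
      fix P assume "P \<in> AB_paths A B J"
      then obtain xs where xs: "subgraph P J" "xs \<noteq> []" "distinct xs" "P = path_graph xs" "hd xs \<in> A" "last xs \<in> B"
        unfolding AB_paths_def by blast
      then have "edges (path_graph xs) \<subseteq> edges J" "set xs \<subseteq> verts J"
        unfolding subgraph_def by (auto simp: verts_path_graph)
      then show "P \<in> (\<lambda>e. path_graph (pth e)) ` M" using AB_path_is_pth[OF xs(3,2) _ _ xs(5,6)] xs(4) by blast
    qed
    show "(\<lambda>e. path_graph (pth e)) ` M \<subseteq> AB_paths A B J"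
      using subgraph_pth pth(1-4) unfolding AB_paths_def by blast
  qed
  moreover have "inj_on (\<lambda>e. path_graph (pth e)) M"
  proof (rule inj_onI)
    fix e f assume ef: "e \<in> M" "f \<in> M" "path_graph (pth e) = path_graph (pth f)"
    then have s: "set (pth e) = set (pth f)" by (metis verts_path_graph)
    have fe: "fst e \<in> set (pth e)" unfolding pth_def L.arm_def by auto
    have "fst e \<in> A0 \<union> A" using L.X ef by auto
    then have "fst e \<in> set (L.arm (fst f))"
      using fe s R.set_arm(1)[of "snd f"] ef(2) sides unfolding pth_def by auto
    then have "L.root (fst e) = fst f" using L.set_arm(2) ef(2) by blast
    moreover have "L.root (fst e) = fst e" using ef(1) unfolding L.root_def by auto
    ultimately show "e = f" using M_inj(1) ef by (metis prod.collapse)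
  qed
  ultimately show ?thesis by (simp add: card_image)
qed

lemma cross_edges_J: "num_edges_between J (A0 \<union> A) (B0 \<union> B) = card M"
proof -
  have "{e \<in> edges J. \<exists>x\<in>A0 \<union> A. \<exists>y\<in>B0 \<union> B. e = {x, y}} = (\<lambda>e. {fst e, snd e}) ` M" (is "?L = ?R")
  proof
    show "?L \<subseteq> ?R"
    proof
      fix e assume "e \<in> ?L"
      then obtain x y where xy: "e \<in> edges J" "x \<in> A0 \<union> A" "y \<in> B0 \<union> B" "e = {x, y}" by auto
      then have "(x, y) \<in> M" using nbrs_A[OF xy(2), of y] L.F sides by blast
      then show "e \<in> ?R" using xy(4) by force
    qed
    show "?R \<subseteq> ?L"
    proof
      fix d assume "d \<in> ?R"
      then obtain e where e: "e \<in> M" "d = {fst e, snd e}" by auto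
      then have "fst e \<in> A0 \<union> A" "snd e \<in> B0 \<union> B" using Msides[of "fst e" "snd e"] by auto
      moreover have "d \<in> edges J" using e unfolding J_def S_def by auto
      ultimately show "d \<in> ?L" using e(2) by blast
    qed
  qed
  moreover have "inj_on (\<lambda>e. {fst e, snd e}) M"
  proof (rule inj_onI)
    fix e f assume ef: "e \<in> M" "f \<in> M" "{fst e, snd e} = {fst f, snd f}"
    have "fst e \<in> A0 \<union> A" "snd f \<in> B0 \<union> B"
      using Msides[of "fst e" "snd e"] Msides[of "fst f" "snd f"] ef(1,2) by simp_all
    then have "fst e \<noteq> snd f" using not_both_sides by metis
    then have "fst e = fst f" using ef(3) by (auto simp: doubleton_eq_iff)
    then show "e = f" using M_eqI[OF ef(1,2)] by blast
  qed
  ultimately show ?thesis unfolding num_edges_between_def by (simp add: card_image)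
qed

lemma exceptional_J:
  assumes "\<epsilon>0 \<ge> 0" "2 \<le> sqrt \<epsilon>0 * real (card (A0 \<union> A \<union> B0 \<union> B))"
  shows "exceptional_system \<epsilon>0 A0 A B0 B J"
    "(hamilton_ES \<epsilon>0 A0 A B0 B J \<and> num_edges_between J (A0 \<union> A) (B0 \<union> B) = 2) \<or> matching_ES \<epsilon>0 A0 A B0 B J"
proof -
  consider "card M = 0" | "card M = 2" using M(1) by auto
  then have "exceptional_system \<epsilon>0 A0 A B0 B J \<and> ((hamilton_ES \<epsilon>0 A0 A B0 B J \<and> num_edges_between J (A0 \<union> A) (B0 \<union> B) = 2) \<or> matching_ES \<epsilon>0 A0 A B0 B J)"
  proof cases
    case 1
    then show ?thesis
      using exceptional_cover_J cross_edges_J card_AB_paths assms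
      unfolding matching_ES_def exceptional_system_def MES_condition_def by simp
  next
    case 2
    then show ?thesis
      using exceptional_cover_J cross_edges_J card_AB_paths assms
      unfolding hamilton_ES_def exceptional_system_def HES_condition_def by simp
  qed
  then show "exceptional_system \<epsilon>0 A0 A B0 B J"
    "(hamilton_ES \<epsilon>0 A0 A B0 B J \<and> num_edges_between J (A0 \<union> A) (B0 \<union> B) = 2) \<or> matching_ES \<epsilon>0 A0 A B0 B J" by auto
qed

end

section \<open>Decomposing the graph\<close>

text \<open>The index of the part that contains \<open>x\<close>. Since the parts are disjoint, \<open>LEAST\<close> only serves to
  name this index.\<close>

definition idx :: "(nat \<Rightarrow> 'a set) \<Rightarrow> 'a \<Rightarrow> nat" where
  "idx A x = (LEAST i. x \<in> A i)"

lemma idx_eq: assumes "disjoint_family_on A {0..K}" "x \<in> A i" "i \<le> K" shows "idx A x = i"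
proof -
  have "x \<in> A (idx A x)" "idx A x \<le> i" unfolding idx_def
    using assms(2) by (auto intro: LeastI Least_le)
  then show ?thesis using assms unfolding disjoint_family_on_def by fastforce
qed

lemma idx_whole:
  assumes "disjoint_family_on A {0..K}" "x \<in> whole K A"
  shows idx_le: "idx A x \<le> K" and mem_idx_iff: "i \<le> K \<Longrightarrow> x \<in> A i \<longleftrightarrow> idx A x = i"
    and mem_core_idx_iff: "x \<in> core K A \<longleftrightarrow> idx A x > 0"
proof -
  obtain j where j: "j \<le> K" "x \<in> A j" using assms(2) unfolding whole_def core_def by auto
  then have e: "idx A x = j" using idx_eq[OF assms(1)] by auto
  show "idx A x \<le> K" "i \<le> K \<Longrightarrow> x \<in> A i \<longleftrightarrow> idx A x = i"
    using e j idx_eq[OF assms(1)] by auto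
  show "x \<in> core K A \<longleftrightarrow> idx A x > 0"
  proof
    assume "x \<in> core K A"
    then obtain i where "i \<in> {1..K}" "x \<in> A i" unfolding core_def by auto
    then show "idx A x > 0" using idx_eq[OF assms(1)] by auto
  next
    assume "idx A x > 0"
    then show "x \<in> core K A" using e j unfolding core_def by force
  qed
qed

lemma mem_part_iff:
  assumes "disjoint_family_on A {0..K}" "i \<in> {1..K}"
  shows "x \<in> A i \<longleftrightarrow> x \<in> core K A \<and> idx A x = i"
proof -
  have "x \<in> whole K A" if "x \<in> core K A" using that unfolding whole_def by simp
  moreover have "x \<in> core K A" if "x \<in> A i" using that assms(2) unfolding core_def by blast
  ultimately show ?thesis using mem_idx_iff[OF assms(1), of x i] assms(2) by auto
qed

text \<open>The colouring of the edges on one side, where \<open>\<pi>\<close> and \<open>q\<close> select this side from the ends of a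
  cross edge and from a pair of clusters. At an exceptional vertex \<open>v\<close> the colours in a set \<open>Q\<close>
  need \<open>2 * card Q\<close> edges, less the number of cross edges at \<open>v\<close> with a colour in \<open>Q\<close>. So \<open>tot\<close>
  says that all colours together need all edges from \<open>v\<close> to the core, and \<open>share\<close> bounds the
  need of the colours reserved for a cluster by the number of edges from \<open>v\<close> to this cluster.\<close>

lemma side_colouring:
  fixes G :: "'a graph" and K :: nat and H :: "('a \<times> 'a) set" and \<pi> :: "'a \<times> 'a \<Rightarrow> 'a" and q :: "nat \<times> nat \<Rightarrow> nat"
    and mc :: "'a \<times> 'a \<Rightarrow> nat" and C :: "nat \<Rightarrow> 'a set" and ty :: "nat \<Rightarrow> (nat \<times> nat) option"
  defines "P \<equiv> \<lambda>k. \<pi> ` {e\<in>H. mc e = k}" and "Y \<equiv> \<lambda>v. {y\<in>core K C. {v, y} \<in> edges G}"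
  assumes fH: "finite H" and fin: "finite (whole K C)" and dis: "disjoint_family_on C {0..K}"
    and ends: "\<And>e. e \<in> H \<Longrightarrow> \<pi> e \<in> whole K C" and q: "q = fst \<or> q = snd"
    and mc: "\<And>e. e \<in> H \<Longrightarrow> mc e < N"
      "\<And>e f. e \<in> H \<Longrightarrow> f \<in> H \<Longrightarrow> mc e = mc f \<Longrightarrow> \<pi> e = \<pi> f \<Longrightarrow> e = f"
      "\<And>k. k < N \<Longrightarrow> card {e\<in>H. mc e = k} \<le> 2"
      "\<And>\<tau>. \<tau> \<in> cells K \<Longrightarrow> {e\<in>H. ty (mc e) = Some \<tau>} = E \<tau>"
    and K: "K > 0" and N: "N = K^2 * L + \<Lambda>"
    and ty: "\<And>k. k < N \<Longrightarrow> ty k \<in> insert None (Some ` cells K)"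
      "\<And>\<tau>. \<tau> \<in> cells K \<Longrightarrow> card {k. k < N \<and> ty k = Some \<tau>} = L" "card {k. k < N \<and> ty k = None} = \<Lambda>"
    and tot: "\<And>v. v \<in> C 0 \<Longrightarrow> deg_in G v (core K C) + incid \<pi> H v = 2 * N"
    and bal: "\<And>v i. v \<in> C 0 \<Longrightarrow> i \<in> {1..K} \<Longrightarrow> deg_in G v (core K C) \<le> K * deg_in G v (C i) + \<sigma>"
    and share: "\<And>v i. v \<in> C 0 \<Longrightarrow> i \<in> {1..K} \<Longrightarrow>
        incid \<pi> H v \<le> K * (\<Sum>\<tau>\<in>{\<tau>\<in>cells K. q \<tau> = i}. incid \<pi> (E \<tau>) v) + \<Lambda>"
    and \<sigma>: "\<sigma> \<le> \<Lambda>" and z: "\<And>y. y \<in> core K C \<Longrightarrow> incid \<pi> H y \<le> z" and x: "card (C 0) \<le> x"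
    and large: "4 * x + 2 * z + 2 < K * L" "4 * x + 2 * z + 2 < \<Lambda>"
  shows "\<exists>F. (\<forall>k<N. half_system (C 0) (core K C) (P k) (F k))
      \<and> (\<Union>k<N. F k) = {e. fst e \<in> C 0 \<and> snd e \<in> Y (fst e)} \<and> (\<forall>e k l. e \<in> F k \<longrightarrow> e \<in> F l \<longrightarrow> k = l)
      \<and> (\<forall>k. \<forall>\<tau>\<in>cells K. ty k = Some \<tau> \<longrightarrow> snd ` F k \<subseteq> C (q \<tau>))"
proof -
  define ct where "ct k = (case ty k of None \<Rightarrow> 0 | Some \<tau> \<Rightarrow> q \<tau>)" for k
  have fin0: "finite (C 0)" "finite (core K C)" using fin unfolding whole_def by auto
  have ctK: "ct k \<le> K" "ct k = 0 \<longleftrightarrow> ty k = None" if "k < N" for k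
    using ty(1)[OF that] q unfolding ct_def by auto
  have lines: "card {\<tau>\<in>cells K. q \<tau> = i} = K" if "i \<in> {1..K}" for i by (rule card_cells_line[OF q that])
  have ct_iff: "ct k = i \<longleftrightarrow> (\<exists>\<tau>\<in>{\<tau>\<in>cells K. q \<tau> = i}. ty k = Some \<tau>)" if "k < N" "i \<in> {1..K}" for k i
    using ty(1)[OF that(1)] that(2) unfolding ct_def by (auto split: option.splits)
  have ct_card: "card {k. k < N \<and> ct k = i} = K * L" if i: "i \<in> {1..K}" for i
  proof -
    have "{k. k < N \<and> ct k = i} = (\<Union>\<tau>\<in>{\<tau>\<in>cells K. q \<tau> = i}. {k. k < N \<and> ty k = Some \<tau>})"
      using ct_iff[OF _ i] by blast
    also have "card \<dots> = (\<Sum>\<tau>\<in>{\<tau>\<in>cells K. q \<tau> = i}. card {k. k < N \<and> ty k = Some \<tau>})"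
      by (intro card_UN_disjoint) auto
    also have "\<dots> = K * L" using ty(2) lines[OF i] by simp
    finally show ?thesis .
  qed
  have sh: "(\<Sum>\<tau>\<in>{\<tau>\<in>cells K. q \<tau> = i}. incid \<pi> (E \<tau>) v) = card {e\<in>H. \<pi> e = v \<and> ct (mc e) = i}"
    if i: "i \<in> {1..K}" for v i
  proof -
    have "incid \<pi> (E \<tau>) v = card {e\<in>H. \<pi> e = v \<and> ty (mc e) = Some \<tau>}" if "\<tau> \<in> cells K" for \<tau>
      unfolding incid_def mc(4)[OF that, symmetric] by (rule arg_cong[of _ _ card]) auto
    then have "(\<Sum>\<tau>\<in>{\<tau>\<in>cells K. q \<tau> = i}. incid \<pi> (E \<tau>) v)
        = (\<Sum>\<tau>\<in>{\<tau>\<in>cells K. q \<tau> = i}. card {e\<in>H. \<pi> e = v \<and> ty (mc e) = Some \<tau>})" by simp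
    also have "\<dots> = card (\<Union>\<tau>\<in>{\<tau>\<in>cells K. q \<tau> = i}. {e\<in>H. \<pi> e = v \<and> ty (mc e) = Some \<tau>})"
      using fH by (intro card_UN_disjoint[symmetric]) auto
    also have "(\<Union>\<tau>\<in>{\<tau>\<in>cells K. q \<tau> = i}. {e\<in>H. \<pi> e = v \<and> ty (mc e) = Some \<tau>}) = {e\<in>H. \<pi> e = v \<and> ct (mc e) = i}"
      using ct_iff[OF mc(1) i] by blast
    finally show ?thesis .
  qed
  have hit: "card {k\<in>Q. v \<in> P k} = card {e\<in>H. \<pi> e = v \<and> mc e \<in> Q}" for v Q
  proof -
    have "{k\<in>Q. v \<in> P k} = mc ` {e\<in>H. \<pi> e = v \<and> mc e \<in> Q}" unfolding P_def by auto
    moreover have "inj_on mc {e\<in>H. \<pi> e = v \<and> mc e \<in> Q}" using mc(2) by (intro inj_onI) auto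
    ultimately show ?thesis by (simp add: card_image)
  qed
  have slots: "(\<Sum>k\<in>Q. if v \<in> P k then 1 else 2 :: nat) + card {e\<in>H. \<pi> e = v \<and> mc e \<in> Q} = 2 * card Q"
    if "finite Q" for v Q
  proof -
    have "(\<Sum>k\<in>Q. if v \<in> P k then 1 else 2 :: nat) = card {k\<in>Q. v \<in> P k} + 2 * card {k\<in>Q. v \<notin> P k}"
      using that by (simp add: sum.If_cases Int_def)
    moreover have "card {k\<in>Q. v \<in> P k} + card {k\<in>Q. v \<notin> P k} = card Q"
      using that card_Un_disjoint[of "{k\<in>Q. v \<in> P k}" "{k\<in>Q. v \<notin> P k}"]
      by (simp add: Int_def Un_def) (metis (mono_tags, lifting) Collect_cong Collect_mem_eq)
    ultimately show ?thesis using hit[of Q v] by simp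
  qed
  have slots': "card Q \<le> (\<Sum>k\<in>Q. if v \<in> P k then 1 else 2 :: nat)" if "finite Q" for v Q
  proof -
    have "(\<Sum>k\<in>Q. 1::nat) \<le> (\<Sum>k\<in>Q. if v \<in> P k then 1 else 2)" by (intro sum_mono) auto
    then show ?thesis by simp
  qed
  have Yi: "{y\<in>Y v. idx C y = i} = {y\<in>C i. {v, y} \<in> edges G}" if "i \<in> {1..K}" for v i
    unfolding Y_def mem_part_iff[OF dis that] by auto
  have cY: "card (Y v) = deg_in G v (core K C)" for v unfolding Y_def deg_in_def ..
  have "\<exists>col. (\<forall>v\<in>C 0. (\<forall>y\<in>Y v. col v y < N \<and> y \<notin> P (col v y) \<and> ct (col v y) \<in> {0, idx C y})
              \<and> (\<forall>k<N. card {y\<in>Y v. col v y = k} = (if v \<in> P k then 1 else 2)))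
           \<and> (\<forall>v\<in>C 0. \<forall>w\<in>C 0. \<forall>y. v \<noteq> w \<longrightarrow> y \<in> Y v \<longrightarrow> y \<in> Y w \<longrightarrow> col v y \<noteq> col w y)"
  proof (rule extend_colouring[where z=z and K=K])
    show "finite (C 0)" "\<And>v. finite (Y v)" using fin0 unfolding Y_def by auto
    show "idx C y \<in> {1..K}" if "y \<in> Y v" for v y
      using that idx_whole(1,3)[OF dis, of y] unfolding Y_def whole_def by auto
    show "ct k \<le> K" if "k < N" for k by (rule ctK[OF that])
  next
    fix v assume v: "v \<in> C 0"
    have "{e\<in>H. \<pi> e = v \<and> mc e \<in> {..<N}} = {e\<in>H. \<pi> e = v}" using mc(1) by auto
    then show "(\<Sum>k<N. if v \<in> P k then 1 else 2 :: nat) = card (Y v)"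
      using slots[of "{..<N}" v] tot[OF v] by (simp add: cY incid_def)
  next
    fix v i assume v: "v \<in> C 0" and i: "i \<in> {1..K}"
    let ?Q = "{k. k < N \<and> ct k = i}"
    let ?r = "\<Sum>k\<in>?Q. if v \<in> P k then 1 else 2 :: nat"
    have "{e\<in>H. \<pi> e = v \<and> mc e \<in> ?Q} = {e\<in>H. \<pi> e = v \<and> ct (mc e) = i}" using mc(1) by auto
    then have "?r + card {e\<in>H. \<pi> e = v \<and> ct (mc e) = i} = 2 * (K * L)"
      using slots[of ?Q v] ct_card[OF i] by simp
    then have "K * ?r + K * card {e\<in>H. \<pi> e = v \<and> ct (mc e) = i} = 2 * (K^2 * L)"
      by (metis (no_types, lifting) distrib_left mult.assoc mult.left_commute power2_eq_square)
    then have "K * ?r \<le> K * deg_in G v (C i)"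
      using share[OF v i] bal[OF v i] tot[OF v] N \<sigma> unfolding sh[OF i] by linarith
    then show "?r \<le> card {y\<in>Y v. idx C y = i}" using K unfolding Yi[OF i] deg_in_def by simp
  next
    fix k assume k: "k < N"
    show "finite (P k) \<and> card (P k) \<le> 2"
      using mc(3)[OF k] fH card_image_le[of "{e\<in>H. mc e = k}" \<pi>] unfolding P_def by auto
  next
    fix v y assume v: "v \<in> C 0" "y \<in> Y v"
    have "{e\<in>H. \<pi> e = y \<and> mc e \<in> {..<N}} = {e\<in>H. \<pi> e = y}" using mc(1) by auto
    then show "card {k. k < N \<and> y \<in> P k} \<le> z"
      using z[of y] v hit[of "{..<N}" y] unfolding Y_def by (simp add: incid_def)
  next
    fix v i assume i: "i \<le> K"
    have "{k. k < N \<and> ct k = 0} = {k. k < N \<and> ty k = None}" using ctK(2) by auto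
    then have "4 * card (C 0) + 2 * z + 2 < card {k. k < N \<and> ct k = i}"
      using ct_card[of i] ty(3) large x i by (cases "i = 0") auto
    then show "4 * card (C 0) + 2 * z + 2 < (\<Sum>k\<in>{k. k < N \<and> ct k = i}. if v \<in> P k then 1 else 2 :: nat)"
      using slots'[of "{k. k < N \<and> ct k = i}" v] by simp
  qed
  then obtain col where col0: "\<forall>v\<in>C 0. (\<forall>y\<in>Y v. col v y < N \<and> y \<notin> P (col v y) \<and> ct (col v y) \<in> {0, idx C y})
              \<and> (\<forall>k<N. card {y\<in>Y v. col v y = k} = (if v \<in> P k then 1 else 2))"
    and col3: "\<forall>v\<in>C 0. \<forall>w\<in>C 0. \<forall>y. v \<noteq> w \<longrightarrow> y \<in> Y v \<longrightarrow> y \<in> Y w \<longrightarrow> col v y \<noteq> col w y"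
    by (elim exE conjE)
  have col1: "col v y < N \<and> y \<notin> P (col v y) \<and> ct (col v y) \<in> {0, idx C y}" if "v \<in> C 0" "y \<in> Y v" for v y
    using col0 that by blast
  have col2: "card {y\<in>Y v. col v y = k} = (if v \<in> P k then 1 else 2)" if "v \<in> C 0" "k < N" for v k
    using col0 that by blast
  define F where "F k = {e. fst e \<in> C 0 \<and> snd e \<in> Y (fst e) \<and> col (fst e) (snd e) = k}" for k
  have half: "half_system (C 0) (core K C) (P k) (F k)" if k: "k < N" for k
  proof
    show "F k \<subseteq> C 0 \<times> core K C" unfolding F_def Y_def by auto
    show "C 0 \<inter> core K C = {}"
      using idx_eq[OF dis, of _ 0] mem_core_idx_iff[OF dis] unfolding whole_def by fastforce
    show "P k \<subseteq> C 0 \<union> core K C" using ends unfolding P_def whole_def by auto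
    show "card {y. (v, y) \<in> F k} = (if v \<in> P k then 1 else 2)" if "v \<in> C 0" for v
      using col2[OF that k] that unfolding F_def by simp
    show "y \<notin> P k" if "(v, y) \<in> F k" for v y using that col1[of v y] unfolding F_def by auto
    show "v = w" if "(v, y) \<in> F k" "(w, y) \<in> F k" for v w y
      using that col3[rule_format, of v w y] unfolding F_def by auto
  qed
  have "(\<Union>k<N. F k) = {e. fst e \<in> C 0 \<and> snd e \<in> Y (fst e)}"
    using col1 unfolding F_def by blast
  moreover have "\<forall>e k l. e \<in> F k \<longrightarrow> e \<in> F l \<longrightarrow> k = l" unfolding F_def by auto
  moreover have loc: "snd e \<in> C (q \<tau>)" if \<tau>: "\<tau> \<in> cells K" "ty k = Some \<tau>" and e: "e \<in> F k" for k \<tau> e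
  proof -
    have q\<tau>: "q \<tau> \<in> {1..K}" using \<tau>(1) q by auto
    have "snd e \<in> core K C" "ct k \<in> {0, idx C (snd e)}" using e col1[of "fst e" "snd e"] unfolding F_def Y_def by auto
    moreover have "ct k = q \<tau>" using \<tau>(2) unfolding ct_def by simp
    ultimately show ?thesis unfolding mem_part_iff[OF dis q\<tau>] using q\<tau> by auto
  qed
  moreover have "\<forall>k<N. half_system (C 0) (core K C) (P k) (F k)" using half by blast
  moreover have "\<forall>k. \<forall>\<tau>\<in>cells K. ty k = Some \<tau> \<longrightarrow> snd ` F k \<subseteq> C (q \<tau>)"
    by (intro allI ballI impI image_subsetI) (rule loc)
  ultimately show ?thesis by (intro exI[of _ F] conjI)
qed

definition cross :: "'a graph \<Rightarrow> 'a set \<Rightarrow> 'a set \<Rightarrow> ('a \<times> 'a) set" where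
  "cross G X Y = {e. fst e \<in> X \<and> snd e \<in> Y \<and> {fst e, snd e} \<in> edges G}"

lemma deg_in_cross_fst:
  assumes "v \<in> X'" "Y \<subseteq> Y'"
  shows "deg_in G v Y = card {e\<in>cross G X' Y'. fst e = v \<and> snd e \<in> Y}"
proof -
  have "{e\<in>cross G X' Y'. fst e = v \<and> snd e \<in> Y} = Pair v ` {u \<in> Y. {v, u} \<in> edges G}"
    using assms unfolding cross_def by force
  moreover have "inj_on (Pair v) {u \<in> Y. {v, u} \<in> edges G}" by (auto simp: inj_on_def)
  ultimately show ?thesis unfolding deg_in_def by (simp add: card_image)
qed

lemma deg_in_cross_snd:
  assumes "w \<in> Y'" "X \<subseteq> X'"
  shows "deg_in G w X = card {e\<in>cross G X' Y'. snd e = w \<and> fst e \<in> X}"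
proof -
  have "{e\<in>cross G X' Y'. snd e = w \<and> fst e \<in> X} = (\<lambda>u. (u, w)) ` {u \<in> X. {w, u} \<in> edges G}"
    using assms unfolding cross_def by (force simp: insert_commute)
  moreover have "inj_on (\<lambda>u. (u, w)) {u \<in> X. {w, u} \<in> edges G}" by (auto simp: inj_on_def)
  ultimately show ?thesis unfolding deg_in_def by (simp add: card_image)
qed

lemma fdeg_cross: "v \<in> X' \<Longrightarrow> fdeg (cross G X' Y') v = deg_in G v Y'"
  unfolding deg_in_cross_fst[of v X' Y' Y' G, OF _ order_refl] incid_def
  by (rule arg_cong[of _ _ card]) (auto simp: cross_def)

lemma sdeg_cross: "w \<in> Y' \<Longrightarrow> sdeg (cross G X' Y') w = deg_in G w X'"
  unfolding deg_in_cross_snd[of w Y' X' X' G, OF _ order_refl] incid_def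
  by (rule arg_cong[of _ _ card]) (auto simp: cross_def)

lemma deg_exceptional_vertex:
  assumes G: "simple_graph G" "verts G = whole K C \<union> O'" "whole K C \<inter> O' = {}" and v: "v \<in> C 0"
    and inner: "\<And>e. e \<in> edges G \<Longrightarrow> \<not> e \<subseteq> C 0"
  shows "deg G v = deg_in G v (core K C) + deg_in G v O'"
proof -
  have "u \<in> core K C \<union> O'" if u: "{v, u} \<in> edges G" for u
  proof -
    have "u \<in> verts G" using u G(1) unfolding simple_graph_def by blast
    then show ?thesis using inner[OF u] v G(2) unfolding whole_def by auto
  qed
  then have e: "{u. {v, u} \<in> edges G} = {u \<in> core K C. {v, u} \<in> edges G} \<union> {u \<in> O'. {v, u} \<in> edges G}" by auto
  have "finite (whole K C \<union> O')" using G(1) unfolding simple_graph_def G(2)[symmetric] by blast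
  then have "finite (core K C)" "finite O'" unfolding whole_def by auto
  moreover have "core K C \<inter> O' = {}" using G(3) unfolding whole_def by auto
  ultimately show ?thesis unfolding deg_def deg_in_def e by (intro card_Un_disjoint) auto
qed

text \<open>The exceptional systems that are sought, \<open>N\<close> in all and \<open>l\<close> for each pair of clusters. The
  number \<open>l\<close> is real because it is given by a formula in real numbers.\<close>

definition local_decomposition ::
    "real \<Rightarrow> nat \<Rightarrow> (nat \<Rightarrow> 'a set) \<Rightarrow> (nat \<Rightarrow> 'a set) \<Rightarrow> 'a graph \<Rightarrow> nat \<Rightarrow> real \<Rightarrow> (nat \<Rightarrow> 'a graph) \<Rightarrow> bool" where
  "local_decomposition \<epsilon>0 K A B G N l J \<longleftrightarrow>
      (\<forall>k<N. subgraph (J k) G \<and> exceptional_system \<epsilon>0 (A 0) (core K A) (B 0) (core K B) (J k))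
      \<and> disjoint_family_on (\<lambda>k. edges (J k)) {..<N} \<and> (\<Union>k<N. edges (J k)) = edges G
      \<and> (\<forall>k<N. (hamilton_ES \<epsilon>0 (A 0) (core K A) (B 0) (core K B) (J k)
                      \<and> num_edges_between (J k) (whole K A) (whole K B) = 2)
                  \<or> matching_ES \<epsilon>0 (A 0) (core K A) (B 0) (core K B) (J k))
      \<and> (\<forall>i\<in>{1..K}. \<forall>i'\<in>{1..K}. \<exists>S \<subseteq> {..<N}. real (card S) = l \<and> (\<forall>k\<in>S. local_ES \<epsilon>0 K A B i i' (J k)))"

text \<open>The colour classes are handled as sets of oriented edges: cross edges point from \<open>A'\<close> to \<open>B'\<close>,
  the others from the exceptional vertex to the core. As each edge gets only one orientation,
  disjointness of the classes carries over to the graphs.\<close>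

lemma exceptional_decomposition:
  fixes G :: "'a graph" and A B :: "nat \<Rightarrow> 'a set" and K N L \<Lambda> h t r \<sigma> x z :: nat
  defines "H \<equiv> cross G (whole K A) (whole K B)"
  assumes G: "simple_graph G" and V: "verts G = whole K A \<union> whole K B"
    and disA: "disjoint_family_on A {0..K}" and disB: "disjoint_family_on B {0..K}"
    and sides: "whole K A \<inter> whole K B = {}"
    and K: "K > 0" and N: "N = K^2 * L + \<Lambda>"
    and inner: "\<And>e. e \<in> edges G \<Longrightarrow> \<not> e \<subseteq> core K A \<and> \<not> e \<subseteq> core K B \<and> \<not> e \<subseteq> A 0 \<and> \<not> e \<subseteq> B 0"
    and degs: "\<And>v. v \<in> A 0 \<union> B 0 \<Longrightarrow> deg G v = 2 * N"
    and cH: "card H = 2 * h" and h: "h = K^2 * t + r" and tr: "t \<le> L" "r \<le> \<Lambda>"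
    and balA: "\<And>v i. v \<in> A 0 \<Longrightarrow> i \<in> {1..K} \<Longrightarrow> deg_in G v (core K A) \<le> K * deg_in G v (A i) + \<sigma>"
    and balB: "\<And>v i. v \<in> B 0 \<Longrightarrow> i \<in> {1..K} \<Longrightarrow> deg_in G v (core K B) \<le> K * deg_in G v (B i) + \<sigma>"
    and \<sigma>: "\<sigma> \<le> \<Lambda>"
    and sh: "sharing K (idx A) (idx B) (A 0) (B 0) H t r \<Lambda> E"
    and z: "\<And>y. y \<in> core K A \<Longrightarrow> fdeg H y \<le> z" "\<And>y. y \<in> core K B \<Longrightarrow> sdeg H y \<le> z"
    and x: "card (A 0) \<le> x" "card (B 0) \<le> x"
    and large: "4 * x + 2 * z + 2 < K * L" "4 * x + 2 * z + 2 < \<Lambda>"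
    and \<epsilon>0: "\<epsilon>0 \<ge> 0" "2 \<le> sqrt \<epsilon>0 * real (card (verts G))"
  shows "\<exists>J. local_decomposition \<epsilon>0 K A B G N (real L) J"
proof -
  have finV: "finite (verts G)" using G unfolding simple_graph_def by auto
  have sub: "core K A \<subseteq> whole K A" "core K B \<subseteq> whole K B" "A 0 \<subseteq> whole K A" "B 0 \<subseteq> whole K B"
    unfolding whole_def by auto
  have fin: "finite (A 0)" "finite (B 0)" "finite (core K A)" "finite (core K B)" "finite (whole K A)" "finite (whole K B)"
    using finV V sub by (auto intro: finite_subset)
  have AA: "A 0 \<inter> core K A = {}" "B 0 \<inter> core K B = {}"
    using idx_whole(2)[OF disA, of _ 0] idx_whole(3)[OF disA] idx_whole(2)[OF disB, of _ 0] idx_whole(3)[OF disB] sub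
    by auto
  have HAB: "H \<subseteq> whole K A \<times> whole K B" unfolding H_def cross_def by auto
  have HM: "fst e \<in> whole K A \<and> snd e \<in> whole K B" if "e \<in> H" for e using HAB that by auto
  have wAB: "v \<notin> whole K B" if "v \<in> whole K A" for v using sides that by blast
  have fH: "finite H" using HAB fin by (meson finite_SigmaI finite_subset)
  obtain ty where ty: "\<And>k. k < N \<Longrightarrow> ty k \<in> insert None (Some ` cells K)"
    "\<And>\<tau>. \<tau> \<in> cells K \<Longrightarrow> card {k. k < N \<and> ty k = Some \<tau>} = L" "card {k. k < N \<and> ty k = None} = \<Lambda>"
  proof -
    have "(\<Sum>o1\<in>insert None (Some ` cells K). case o1 of None \<Rightarrow> \<Lambda> | Some _ \<Rightarrow> L) = card {..<N}"
      using card_cells[of K] N by (simp add: sum.reindex)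
    from fibre_function[OF finite_lessThan _ this]
    obtain ty where c: "\<forall>x\<in>{..<N}. ty x \<in> insert None (Some ` cells K)"
      "\<forall>k\<in>insert None (Some ` cells K). card {x \<in> {..<N}. ty x = k} = (case k of None \<Rightarrow> \<Lambda> | Some _ \<Rightarrow> L)"
      by auto
    have "card {k. k < N \<and> ty k = Some \<tau>} = L" if "\<tau> \<in> cells K" for \<tau> using c(2) that by auto
    moreover have "card {k. k < N \<and> ty k = None} = \<Lambda>" using c(2) by auto
    ultimately show ?thesis using that c(1) by blast
  qed
  obtain mc where mc: "\<forall>e\<in>H. mc e < N" "\<forall>k<N. card {e\<in>H. mc e = k} \<in> {0, 2} \<and> matched fst snd {e\<in>H. mc e = k}"
    "\<forall>\<tau>\<in>cells K. {e\<in>H. ty (mc e) = Some \<tau>} = E \<tau>"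
    using cross_colouring[OF fH cH h ty(2,3) tr sh] by blast
  have mcinj: "e = f" if "e \<in> H" "f \<in> H" "mc e = mc f" "fst e = fst f \<or> snd e = snd f" for e f
    using mc(1,2) that unfolding matched_def by blast
  define YA where "YA v = {y\<in>core K A. {v, y} \<in> edges G}" for v
  define YB where "YB v = {y\<in>core K B. {v, y} \<in> edges G}" for v
  have edge_verts: "u \<in> verts G \<and> v \<in> verts G \<and> u \<noteq> v" if "{u, v} \<in> edges G" for u v
    using that G unfolding simple_graph_def by fastforce
  have totA: "deg_in G v (core K A) + fdeg H v = 2 * N" if v: "v \<in> A 0" for v
  proof -
    have "fdeg H v = deg_in G v (whole K B)" unfolding H_def using fdeg_cross[of v] v sub by blast
    then show ?thesis
      using deg_exceptional_vertex[OF G V sides v] inner degs[of v] v by simp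
  qed
  have totB: "deg_in G v (core K B) + sdeg H v = 2 * N" if v: "v \<in> B 0" for v
  proof -
    have "sdeg H v = deg_in G v (whole K A)" unfolding H_def using sdeg_cross[of v] v sub by blast
    then show ?thesis
      using deg_exceptional_vertex[of G K B "whole K A" v] G V sides inner degs[of v] v by (simp add: Un_commute Int_commute)
  qed
  have mcE: "{e\<in>H. ty (mc e) = Some \<tau>} = E \<tau>" if "\<tau> \<in> cells K" for \<tau> using mc(3) that by blast
  define M where "M k = {e\<in>H. mc e = k}" for k
  have M2: "card {e\<in>H. mc e = k} \<le> 2" if "k < N" for k using mc(2) that by auto
  have shA: "fdeg H v \<le> K * (\<Sum>\<tau>\<in>{\<tau>\<in>cells K. fst \<tau> = i}. fdeg (E \<tau>) v) + \<Lambda>" if "v \<in> A 0" "i \<in> {1..K}" for v i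
    using sh that unfolding sharing_def by blast
  have shB: "sdeg H v \<le> K * (\<Sum>\<tau>\<in>{\<tau>\<in>cells K. snd \<tau> = i}. sdeg (E \<tau>) v) + \<Lambda>" if "v \<in> B 0" "i \<in> {1..K}" for v i
    using sh that unfolding sharing_def by blast
  have "\<exists>F. (\<forall>k<N. half_system (A 0) (core K A) (fst ` M k) (F k))
      \<and> (\<Union>k<N. F k) = {e. fst e \<in> A 0 \<and> snd e \<in> YA (fst e)}
      \<and> (\<forall>e k l. e \<in> F k \<longrightarrow> e \<in> F l \<longrightarrow> k = l)
      \<and> (\<forall>k. \<forall>\<tau>\<in>cells K. ty k = Some \<tau> \<longrightarrow> snd ` F k \<subseteq> A (fst \<tau>))"
    unfolding M_def YA_def
    by (rule side_colouring[OF fH fin(5) disA _ _ _ _ M2 mcE K N ty totA balA shA \<sigma> z(1) x(1) large])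
      (use HM mc(1) mcinj in auto)
  then obtain FA where FA1: "\<forall>k<N. half_system (A 0) (core K A) (fst ` M k) (FA k)"
    and FA2: "(\<Union>k<N. FA k) = {e. fst e \<in> A 0 \<and> snd e \<in> YA (fst e)}"
    and FA3: "\<forall>e k l. e \<in> FA k \<longrightarrow> e \<in> FA l \<longrightarrow> k = l"
    and FA4: "\<forall>k. \<forall>\<tau>\<in>cells K. ty k = Some \<tau> \<longrightarrow> snd ` FA k \<subseteq> A (fst \<tau>)"
    by (elim exE conjE)
  have "\<exists>F. (\<forall>k<N. half_system (B 0) (core K B) (snd ` M k) (F k))
      \<and> (\<Union>k<N. F k) = {e. fst e \<in> B 0 \<and> snd e \<in> YB (fst e)}
      \<and> (\<forall>e k l. e \<in> F k \<longrightarrow> e \<in> F l \<longrightarrow> k = l)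
      \<and> (\<forall>k. \<forall>\<tau>\<in>cells K. ty k = Some \<tau> \<longrightarrow> snd ` F k \<subseteq> B (snd \<tau>))"
    unfolding M_def YB_def
    by (rule side_colouring[OF fH fin(6) disB _ _ _ _ M2 mcE K N ty totB balB shB \<sigma> z(2) x(2) large])
      (use HM mc(1) mcinj in auto)
  then obtain FB where FB1: "\<forall>k<N. half_system (B 0) (core K B) (snd ` M k) (FB k)"
    and FB2: "(\<Union>k<N. FB k) = {e. fst e \<in> B 0 \<and> snd e \<in> YB (fst e)}"
    and FB3: "\<forall>e k l. e \<in> FB k \<longrightarrow> e \<in> FB l \<longrightarrow> k = l"
    and FB4: "\<forall>k. \<forall>\<tau>\<in>cells K. ty k = Some \<tau> \<longrightarrow> snd ` FB k \<subseteq> B (snd \<tau>)"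
    by (elim exE conjE)
  have pieces: "exc_pieces (A 0) (core K A) (B 0) (core K B) (M k) (FA k) (FB k)" if k: "k < N" for k
  proof -
    have "exc_pieces_axioms (A 0) (core K A) (B 0) (core K B) (M k)"
      unfolding exc_pieces_axioms_def
      using sides fin mc(2) k fH unfolding whole_def M_def by auto
    then show ?thesis using FA1[rule_format, OF k] FB1[rule_format, OF k] unfolding exc_pieces_def by blast
  qed
  define J where "J k = exc_pieces.J (A 0) (B 0) (M k) (FA k) (FB k)" for k
  define S where "S k = M k \<union> FA k \<union> FB k" for k
  have Jdef: "verts (J k) = A 0 \<union> B 0 \<union> fst ` S k \<union> snd ` S k" "edges (J k) = (\<lambda>e. {fst e, snd e}) ` S k" if "k < N" for k
    unfolding J_def S_def exc_pieces.J_def[OF pieces[OF that]] exc_pieces.S_def[OF pieces[OF that]] by auto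
  define P where "P = H \<union> {e. fst e \<in> A 0 \<and> snd e \<in> YA (fst e)} \<union> {e. fst e \<in> B 0 \<and> snd e \<in> YB (fst e)}"
  have MH: "M k \<subseteq> H" for k unfolding M_def by auto
  have SP: "S k \<subseteq> P" if "k < N" for k using FA2 FB2 MH that unfolding S_def P_def by blast
  have Pkind: "(fst e \<in> whole K A \<and> snd e \<in> whole K B \<and> e \<in> H) \<or> (fst e \<in> A 0 \<and> snd e \<in> core K A \<and> e \<notin> H)
      \<or> (fst e \<in> B 0 \<and> snd e \<in> core K B \<and> e \<notin> H)" if eP: "e \<in> P" for e
  proof -
    consider "e \<in> H" | "fst e \<in> A 0" "snd e \<in> core K A" | "fst e \<in> B 0" "snd e \<in> core K B"
      using eP unfolding P_def YA_def YB_def by blast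
    then show ?thesis
    proof cases
      case 1
      then show ?thesis using HM[OF 1] by simp
    next
      case 2
      then have "snd e \<notin> whole K B" using wAB sub by blast
      then show ?thesis using HM[of e] 2 by blast
    next
      case 3
      then have "fst e \<notin> whole K A" using wAB sub by blast
      then show ?thesis using HM[of e] 3 by blast
    qed
  qed
  have Pinj: "e = f" if "e \<in> P" "f \<in> P" "{fst e, snd e} = {fst f, snd f}" for e f
  proof (rule ccontr)
    assume "e \<noteq> f"
    then have "fst e = snd f" "snd e = fst f" using that(3) by (auto simp: doubleton_eq_iff prod_eq_iff)
    moreover have "v \<notin> core K A" if "v \<in> A 0" for v using AA(1) that by blast
    moreover have "v \<notin> core K B" if "v \<in> B 0" for v using AA(2) that by blast
    moreover have "v \<in> whole K A" if "v \<in> A 0 \<or> v \<in> core K A" for v using sub that by blast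
    moreover have "v \<in> whole K B" if "v \<in> B 0 \<or> v \<in> core K B" for v using sub that by blast
    ultimately show False using Pkind[OF that(1)] Pkind[OF that(2)] wAB by metis
  qed
  have Sdisj: "k = l" if e: "e \<in> S k" "e \<in> S l" and kl: "k < N" "l < N" for e k l
  proof -
    have side: "(e \<in> M n \<longrightarrow> e \<in> H) \<and> (e \<in> FA n \<longrightarrow> fst e \<in> A 0 \<and> snd e \<in> core K A)
        \<and> (e \<in> FB n \<longrightarrow> fst e \<in> B 0 \<and> snd e \<in> core K B)" if "n < N" for n
      using MH FA2 FB2 that unfolding YA_def YB_def by blast
    have "e \<in> M k \<and> e \<in> M l \<or> e \<in> FA k \<and> e \<in> FA l \<or> e \<in> FB k \<and> e \<in> FB l"
      using e side[OF kl(1)] side[OF kl(2)] HM[of e] wAB sub unfolding S_def by blast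
    then show ?thesis using FA3 FB3 unfolding M_def by blast
  qed
  have Pcover: "\<exists>k<N. e \<in> S k" if "e \<in> P" for e
  proof -
    have "e \<in> H \<or> e \<in> (\<Union>k<N. FA k) \<or> e \<in> (\<Union>k<N. FB k)" using that unfolding P_def FA2 FB2 by blast
    then show ?thesis using mc(1) unfolding S_def M_def by blast
  qed
  have Pedges: "(\<lambda>e. {fst e, snd e}) ` P = edges G"
  proof
    show "(\<lambda>e. {fst e, snd e}) ` P \<subseteq> edges G" unfolding P_def H_def cross_def YA_def YB_def by auto
    show "edges G \<subseteq> (\<lambda>e. {fst e, snd e}) ` P"
    proof
      fix d assume d: "d \<in> edges G"
      then have "card d = 2" using G unfolding simple_graph_def by blast
      then obtain u v where uv: "d = {u, v}" by (auto simp: card_2_iff)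
      have V2: "u \<in> whole K A \<union> whole K B" "v \<in> whole K A \<union> whole K B" using edge_verts d uv V by auto
      have nin: "\<not> {u, v} \<subseteq> core K A" "\<not> {u, v} \<subseteq> core K B" "\<not> {u, v} \<subseteq> A 0" "\<not> {u, v} \<subseteq> B 0"
        using inner[OF d] uv by auto
      have "(u, v) \<in> P \<or> (v, u) \<in> P"
        using V2 nin d uv unfolding P_def H_def cross_def YA_def YB_def whole_def
        by (auto simp: insert_commute)
      then show "d \<in> (\<lambda>e. {fst e, snd e}) ` P" using uv by (force simp: insert_commute)
    qed
  qed
  have wh: "A 0 \<union> core K A \<union> B 0 \<union> core K B = verts G" "A 0 \<union> core K A = whole K A" "B 0 \<union> core K B = whole K B"
    using V unfolding whole_def by auto
  have exJ: "exceptional_system \<epsilon>0 (A 0) (core K A) (B 0) (core K B) (J k)"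
    "(hamilton_ES \<epsilon>0 (A 0) (core K A) (B 0) (core K B) (J k) \<and> num_edges_between (J k) (whole K A) (whole K B) = 2)
       \<or> matching_ES \<epsilon>0 (A 0) (core K A) (B 0) (core K B) (J k)" if "k < N" for k
    using exc_pieces.exceptional_J[OF pieces[OF that], of \<epsilon>0] \<epsilon>0 wh unfolding J_def by auto
  have sgJ: "subgraph (J k) G" if k: "k < N" for k
  proof -
    have "simple_graph (J k)" using exc_pieces.simple_J[OF pieces[OF k]] unfolding J_def .
    moreover have "verts (J k) \<subseteq> verts G" using exc_pieces.verts_J(2)[OF pieces[OF k]] wh unfolding J_def by auto
    moreover have "edges (J k) \<subseteq> edges G" 
      unfolding Jdef(2)[OF k] Pedges[symmetric] by (rule image_mono[OF SP[OF k]])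
    ultimately show ?thesis unfolding subgraph_def by blast
  qed
  have disJ: "disjoint_family_on (\<lambda>k. edges (J k)) {..<N}"
    unfolding disjoint_family_on_def
  proof (intro ballI impI)
    fix k l assume kl: "k \<in> {..<N}" "l \<in> {..<N}" "k \<noteq> l"
    have False if d: "d \<in> edges (J k)" "d \<in> edges (J l)" for d
    proof -
      obtain e f where ef: "e \<in> S k" "f \<in> S l" "{fst e, snd e} = d" "{fst f, snd f} = d"
        using d kl Jdef(2) by auto
      have "e \<in> P" "f \<in> P" using ef(1,2) SP kl by blast+
      then have "e = f" using Pinj[of e f] ef(3,4) by simp
      then show False using Sdisj[of e k l] ef(1,2) kl by simp
    qed
    then show "edges (J k) \<inter> edges (J l) = {}" by blast
  qed
  have UJ: "(\<Union>k<N. edges (J k)) = edges G"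
  proof
    show "(\<Union>k<N. edges (J k)) \<subseteq> edges G" using sgJ unfolding subgraph_def by blast
    show "edges G \<subseteq> (\<Union>k<N. edges (J k))"
    proof
      fix d assume "d \<in> edges G"
      then have "d \<in> (\<lambda>e. {fst e, snd e}) ` P" unfolding Pedges .
      then obtain e where e: "e \<in> P" "d = {fst e, snd e}" by auto
      obtain k where k: "k < N" "e \<in> S k" using Pcover[OF e(1)] by auto
      then have "d \<in> edges (J k)" unfolding Jdef(2)[OF k(1)] e(2) by simp
      then show "d \<in> (\<Union>k<N. edges (J k))" using k(1) by blast
    qed
  qed
  have loc: "\<exists>S \<subseteq> {..<N}. real (card S) = real L \<and> (\<forall>k\<in>S. local_ES \<epsilon>0 K A B i i' (J k))"
    if i: "i \<in> {1..K}" "i' \<in> {1..K}" for i i'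
  proof (intro exI[of _ "{k. k < N \<and> ty k = Some (i, i')}"] conjI ballI)
    have T: "(i, i') \<in> cells K" using i by auto
    show "{k. k < N \<and> ty k = Some (i, i')} \<subseteq> {..<N}" by auto
    show "real (card {k. k < N \<and> ty k = Some (i, i')}) = real L" using ty(2)[OF T] by simp
    fix k assume k: "k \<in> {k. k < N \<and> ty k = Some (i, i')}"
    have MA: "fst e \<in> A 0 \<union> A i \<and> snd e \<in> B 0 \<union> B i'" if "e \<in> M k" for e
    proof -
      have "e \<in> E (i, i')" "e \<in> H" using that k mcE[OF T] unfolding M_def by auto
      then have "idx A (fst e) \<in> {0, i}" "idx B (snd e) \<in> {0, i'}" "fst e \<in> whole K A" "snd e \<in> whole K B"
        using sharing_part(3)[OF sh T] HAB unfolding fits_def by auto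
      then show ?thesis using idx_whole(2)[OF disA, of "fst e"] idx_whole(2)[OF disB, of "snd e"] i by auto
    qed
    have FAk: "fst e \<in> A 0 \<and> snd e \<in> A i" if "e \<in> FA k" for e
      using that FA2 FA4 T k by fastforce
    have FBk: "fst e \<in> B 0 \<and> snd e \<in> B i'" if "e \<in> FB k" for e
      using that FB2 FB4 T k by fastforce
    have "verts (J k) \<subseteq> A 0 \<union> B 0 \<union> A i \<union> B i'"
      using Jdef(1)[of k] k MA FAk FBk unfolding S_def by auto
    then show "local_ES \<epsilon>0 K A B i i' (J k)" using exJ(1)[of k] k unfolding local_ES_def by auto
  qed
  have "local_decomposition \<epsilon>0 K A B G N (real L) J"
    unfolding local_decomposition_def
  proof (intro conjI allI impI ballI)
    fix k assume k: "k < N"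
    show "subgraph (J k) G" by (rule sgJ[OF k])
    show "exceptional_system \<epsilon>0 (A 0) (core K A) (B 0) (core K B) (J k)" by (rule exJ(1)[OF k])
    show "(hamilton_ES \<epsilon>0 (A 0) (core K A) (B 0) (core K B) (J k) \<and> num_edges_between (J k) (whole K A) (whole K B) = 2)
       \<or> matching_ES \<epsilon>0 (A 0) (core K A) (B 0) (core K B) (J k)" by (rule exJ(2)[OF k])
  qed (use disJ UJ loc in simp_all)
  then show ?thesis by blast
qed

section \<open>Counting in the exceptional scheme\<close>

lemma num_edges_between_commute: "num_edges_between G X Y = num_edges_between G Y X"
proof -
  have "{e \<in> edges G. \<exists>x\<in>X. \<exists>y\<in>Y. e = {x, y}} = {e \<in> edges G. \<exists>y\<in>Y. \<exists>x\<in>X. e = {y, x}}"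
    by (auto simp: insert_commute)
  then show ?thesis unfolding num_edges_between_def by simp
qed

lemma num_edges_between_cross:
  assumes "X \<subseteq> X'" "Y \<subseteq> Y'" "X' \<inter> Y' = {}"
  shows "num_edges_between G X Y = card {e\<in>cross G X' Y'. fst e \<in> X \<and> snd e \<in> Y}"
proof -
  have "{e \<in> edges G. \<exists>x\<in>X. \<exists>y\<in>Y. e = {x, y}} = (\<lambda>e. {fst e, snd e}) ` {e\<in>cross G X' Y'. fst e \<in> X \<and> snd e \<in> Y}"
    (is "?L = ?R")
  proof
    show "?L \<subseteq> ?R"
    proof
      fix d assume "d \<in> ?L"
      then obtain x y where xy: "d \<in> edges G" "x \<in> X" "y \<in> Y" "d = {x, y}" by auto
      then have "(x, y) \<in> {e\<in>cross G X' Y'. fst e \<in> X \<and> snd e \<in> Y}" using assms unfolding cross_def by auto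
      then show "d \<in> ?R" using xy(4) by force
    qed
  qed (auto simp: cross_def)
  moreover have "inj_on (\<lambda>e. {fst e, snd e}) {e\<in>cross G X' Y'. fst e \<in> X \<and> snd e \<in> Y}"
  proof (rule inj_onI)
    fix e f assume e: "e \<in> {e\<in>cross G X' Y'. fst e \<in> X \<and> snd e \<in> Y}" "f \<in> {e\<in>cross G X' Y'. fst e \<in> X \<and> snd e \<in> Y}"
      and eq: "{fst e, snd e} = {fst f, snd f}"
    have "fst e \<in> X'" "snd f \<in> Y'" using e unfolding cross_def by auto
    then have "fst e \<noteq> snd f" using assms(3) by (metis disjoint_iff)
    then show "e = f" using eq by (auto simp: doubleton_eq_iff prod_eq_iff)
  qed
  ultimately show ?thesis unfolding num_edges_between_def by (simp add: card_image)
qed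

lemma card_large_degrees:
  assumes "finite S" "finite U"
  shows "card {v\<in>U. incid \<pi> S v > \<theta>} * (\<theta> + 1) \<le> card S"
proof -
  let ?U = "{v\<in>U. incid \<pi> S v > \<theta>}"
  have "card ?U * (\<theta> + 1) \<le> (\<Sum>v\<in>?U. card {e\<in>S. \<pi> e = v \<and> True})"
    using sum_bounded_below[of ?U "\<theta> + 1" "\<lambda>v. card {e\<in>S. \<pi> e = v \<and> True}"] unfolding incid_def by auto
  also have "\<dots> = card {e\<in>S. \<pi> e \<in> ?U \<and> True}" using card_vertex_fibres[of S ?U \<pi> "\<lambda>_. True"] assms by simp
  also have "\<dots> \<le> card S" using assms by (intro card_mono) auto
  finally show ?thesis .
qed

text \<open>If there are at most \<open>2 * \<Lambda>\<close> cross edges, the free colours accommodate all of them and the parts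
  are empty. Otherwise \<open>type_assignment\<close> applies; by \<open>nb\<close> there are at most \<open>nb\<close> vertices of
  degree above \<open>\<theta>\<close>.\<close>

lemma cross_types:
  fixes G :: "'a graph" and A B :: "nat \<Rightarrow> 'a set" and K L \<Lambda> h \<sigma> \<theta> x nb :: nat
  defines "H \<equiv> cross G (whole K A) (whole K B)"
  assumes fin: "finite (whole K A)" "finite (whole K B)"
    and disA: "disjoint_family_on A {0..K}" and disB: "disjoint_family_on B {0..K}"
    and sides: "whole K A \<inter> whole K B = {}" and K: "K > 0"
    and cH: "card H = 2 * h" and dh: "\<And>v. fdeg H v \<le> h" "\<And>v. sdeg H v \<le> h"
    and balA: "\<And>v j. v \<in> A 0 \<Longrightarrow> j \<in> {1..K} \<Longrightarrow> deg_in G v (core K B) \<le> K * deg_in G v (B j) + \<sigma>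
        \<and> K * deg_in G v (B j) \<le> deg_in G v (core K B) + \<sigma>"
    and balB: "\<And>v j. v \<in> B 0 \<Longrightarrow> j \<in> {1..K} \<Longrightarrow> deg_in G v (core K A) \<le> K * deg_in G v (A j) + \<sigma>
        \<and> K * deg_in G v (A j) \<le> deg_in G v (core K A) + \<sigma>"
    and bal0B: "\<And>j. j \<in> {1..K} \<Longrightarrow> num_edges_between G (A 0) (core K B) \<le> K * num_edges_between G (A 0) (B j) + \<sigma>"
    and balA0: "\<And>i. i \<in> {1..K} \<Longrightarrow> num_edges_between G (B 0) (core K A) \<le> K * num_edges_between G (B 0) (A i) + \<sigma>"
    and balAB: "\<And>i j. i \<in> {1..K} \<Longrightarrow> j \<in> {1..K} \<Longrightarrow>
        num_edges_between G (core K A) (core K B) \<le> K^2 * num_edges_between G (A i) (B j) + \<sigma>"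
    and small: "\<And>v. v \<in> core K A \<Longrightarrow> deg_in G v (whole K B) \<le> \<theta>" "\<And>v. v \<in> core K B \<Longrightarrow> deg_in G v (whole K A) \<le> \<theta>"
    and x: "card (A 0) \<le> x" "card (B 0) \<le> x"
    and nb: "4 * h < (nb + 1) * (\<theta> + 1)"
    and num: "\<Lambda> < h \<Longrightarrow> \<exists>t r. h = K^2 * t + r \<and> t \<le> L \<and> r \<le> \<Lambda> \<and> \<theta> \<le> t \<and> \<theta> \<le> r
        \<and> (nb + 4) * ((nb + 1) * \<sigma> + K^2 + x) + nb * x + 3 * K^2 \<le> r"
  shows "\<exists>t r E. h = K^2 * t + r \<and> t \<le> L \<and> r \<le> \<Lambda> \<and> sharing K (idx A) (idx B) (A 0) (B 0) H t r \<Lambda> E"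
proof (cases "h \<le> \<Lambda>")
  case True
  then show ?thesis using dh
    by (intro exI[of _ 0] exI[of _ h] exI[of _ "\<lambda>_. {}"])
      (auto simp: sharing_def incid_def disjoint_family_on_def intro: le_trans)
next
  case False
  then obtain t r where tr: "h = K^2 * t + r" "t \<le> L" "r \<le> \<Lambda>" "\<theta> \<le> t" "\<theta> \<le> r"
    "(nb + 4) * ((nb + 1) * \<sigma> + K^2 + x) + nb * x + 3 * K^2 \<le> r" using num by auto
  have sub: "core K A \<subseteq> whole K A" "core K B \<subseteq> whole K B" "A 0 \<subseteq> whole K A" "B 0 \<subseteq> whole K B"
    unfolding whole_def by auto
  have subi: "A i \<subseteq> whole K A" "B i \<subseteq> whole K B" if "i \<in> {1..K}" for i
    using that unfolding whole_def core_def by auto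
  have fin0: "finite (A 0)" "finite (B 0)" using fin sub finite_subset by blast+
  have HM: "fst e \<in> whole K A" "snd e \<in> whole K B" if "e \<in> H" for e
    using that unfolding H_def cross_def by auto
  have fH: "finite H" using fin HM by (intro finite_subset[of H "whole K A \<times> whole K B"]) auto
  have a: "fst e \<in> A i \<longleftrightarrow> idx A (fst e) = i" "fst e \<in> core K A \<longleftrightarrow> idx A (fst e) > 0"
    and b: "snd e \<in> B i \<longleftrightarrow> idx B (snd e) = i" "snd e \<in> core K B \<longleftrightarrow> idx B (snd e) > 0"
    if "e \<in> H" "i \<le> K" for e i
    using mem_idx_iff[OF disA HM(1)[OF that(1)] that(2)] mem_idx_iff[OF disB HM(2)[OF that(1)] that(2)]
      mem_core_idx_iff[OF disA HM(1)[OF that(1)]] mem_core_idx_iff[OF disB HM(2)[OF that(1)]] by auto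
  have b0: "{e\<in>H. fst e = v \<and> idx B (snd e) > 0} = {e\<in>H. fst e = v \<and> snd e \<in> core K B}"
    "{e\<in>H. snd e = v \<and> idx A (fst e) > 0} = {e\<in>H. snd e = v \<and> fst e \<in> core K A}"
    "{e\<in>H. fst e \<in> A 0 \<and> idx B (snd e) > 0} = {e\<in>H. fst e \<in> A 0 \<and> snd e \<in> core K B}"
    "{e\<in>H. snd e \<in> B 0 \<and> idx A (fst e) > 0} = {e\<in>H. fst e \<in> core K A \<and> snd e \<in> B 0}"
    "{e\<in>H. idx A (fst e) > 0 \<and> idx B (snd e) > 0} = {e\<in>H. fst e \<in> core K A \<and> snd e \<in> core K B}" for v
    using a(2) b(2) by blast+
  have bj: "{e\<in>H. fst e = v \<and> idx B (snd e) = j} = {e\<in>H. fst e = v \<and> snd e \<in> B j}"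
    "{e\<in>H. snd e = v \<and> idx A (fst e) = j} = {e\<in>H. snd e = v \<and> fst e \<in> A j}"
    "{e\<in>H. fst e \<in> A 0 \<and> idx B (snd e) = j} = {e\<in>H. fst e \<in> A 0 \<and> snd e \<in> B j}"
    "{e\<in>H. snd e \<in> B 0 \<and> idx A (fst e) = j} = {e\<in>H. fst e \<in> A j \<and> snd e \<in> B 0}" if "j \<in> {1..K}" for v j
    using a(1)[where i=j] b(1)[where i=j] that by auto
  have bij: "{e\<in>H. idx A (fst e) = i \<and> idx B (snd e) = j} = {e\<in>H. fst e \<in> A i \<and> snd e \<in> B j}"
    if "i \<in> {1..K}" "j \<in> {1..K}" for i j
    using a(1)[where i=i] b(1)[where i=j] that by auto
  have "\<exists>E. sharing K (idx A) (idx B) (A 0) (B 0) H t r \<Lambda> E"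
  proof (rule type_assignment[OF fH K fin0(1) _ _ x(1) fin0(2) _ _ x(2) cH dh tr(1) _ _ _ _ _ _ _ tr(4,5,3) _ tr(6)])
    show "fst e \<in> A 0 \<longleftrightarrow> idx A (fst e) = 0" "snd e \<in> B 0 \<longleftrightarrow> idx B (snd e) = 0" if "e \<in> H" for e
      using a(1) b(1) that by auto
    show "idx A v = 0" if "v \<in> A 0" for v using idx_eq[OF disA that] by simp
    show "idx B v = 0" if "v \<in> B 0" for v using idx_eq[OF disB that] by simp
  next
    fix v j assume vj: "v \<in> A 0" "j \<in> {1..K}"
    then have v: "v \<in> whole K A" using sub by blast
    show "card {e\<in>H. fst e = v \<and> idx B (snd e) > 0} \<le> K * card {e\<in>H. fst e = v \<and> idx B (snd e) = j} + \<sigma>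
      \<and> K * card {e\<in>H. fst e = v \<and> idx B (snd e) = j} \<le> card {e\<in>H. fst e = v \<and> idx B (snd e) > 0} + \<sigma>"
      using balA[OF vj] unfolding b0 bj[OF vj(2)] unfolding H_def
        deg_in_cross_fst[OF v sub(2)] deg_in_cross_fst[OF v subi(2)[OF vj(2)]] .
  next
    fix w j assume wj: "w \<in> B 0" "j \<in> {1..K}"
    then have w: "w \<in> whole K B" using sub by blast
    show "card {e\<in>H. snd e = w \<and> idx A (fst e) > 0} \<le> K * card {e\<in>H. snd e = w \<and> idx A (fst e) = j} + \<sigma>
      \<and> K * card {e\<in>H. snd e = w \<and> idx A (fst e) = j} \<le> card {e\<in>H. snd e = w \<and> idx A (fst e) > 0} + \<sigma>"
      using balB[OF wj] unfolding b0 bj[OF wj(2)] unfolding H_def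
        deg_in_cross_snd[OF w sub(1)] deg_in_cross_snd[OF w subi(1)[OF wj(2)]] .
  next
    fix j assume j: "j \<in> {1..K}"
    show "card {e\<in>H. fst e \<in> A 0 \<and> idx B (snd e) > 0} \<le> K * card {e\<in>H. fst e \<in> A 0 \<and> idx B (snd e) = j} + \<sigma>"
      using bal0B[OF j] unfolding b0 bj[OF j] unfolding H_def
        num_edges_between_cross[OF sub(3) sub(2) sides] num_edges_between_cross[OF sub(3) subi(2)[OF j] sides] .
    show "card {e\<in>H. snd e \<in> B 0 \<and> idx A (fst e) > 0} \<le> K * card {e\<in>H. snd e \<in> B 0 \<and> idx A (fst e) = j} + \<sigma>"
      using balA0[OF j] unfolding b0 bj[OF j] unfolding H_def num_edges_between_commute[of G "B 0"]
        num_edges_between_cross[OF sub(1) sub(4) sides] num_edges_between_cross[OF subi(1)[OF j] sub(4) sides] .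
  next
    fix i j assume ij: "i \<in> {1..K}" "j \<in> {1..K}"
    show "card {e\<in>H. idx A (fst e) > 0 \<and> idx B (snd e) > 0} \<le> K^2 * card {e\<in>H. idx A (fst e) = i \<and> idx B (snd e) = j} + \<sigma>"
      using balAB[OF ij] unfolding b0 bij[OF ij] unfolding H_def
        num_edges_between_cross[OF sub(1,2) sides] num_edges_between_cross[OF subi(1)[OF ij(1)] subi(2)[OF ij(2)] sides] .
  next
    fix v assume v: "v \<notin> A 0"
    show "fdeg H v \<le> \<theta>"
    proof (cases "v \<in> core K A")
      case True
      then show ?thesis using small(1) fdeg_cross[of v] sub unfolding H_def by (metis subsetD)
    next
      case False
      then have e: "{e\<in>H. fst e = v} = {}" using v HM(1) unfolding whole_def by blast
      show ?thesis unfolding incid_def e by simp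
    qed
  next
    fix v assume v: "v \<notin> B 0"
    show "sdeg H v \<le> \<theta>"
    proof (cases "v \<in> core K B")
      case True
      then show ?thesis using small(2) sdeg_cross[of v] sub unfolding H_def by (metis subsetD)
    next
      case False
      then have e: "{e\<in>H. snd e = v} = {}" using v HM(2) unfolding whole_def by blast
      show ?thesis unfolding incid_def e by simp
    qed
  next
    have "(card {v\<in>A 0. fdeg H v > \<theta>} + card {w\<in>B 0. sdeg H w > \<theta>}) * (\<theta> + 1) < (nb + 1) * (\<theta> + 1)"
      using card_large_degrees[OF fH fin0(1), of \<theta> fst] card_large_degrees[OF fH fin0(2), of \<theta> snd] cH nb
      by (simp only: distrib_right)
    then have "card {v\<in>A 0. fdeg H v > \<theta>} + card {w\<in>B 0. sdeg H w > \<theta>} < nb + 1"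
      by (metis mult_less_cancel2)
    then show "card {v\<in>A 0. fdeg H v > \<theta>} + card {w\<in>B 0. sdeg H w > \<theta>} \<le> nb" by simp
  qed
  then show ?thesis using tr(1,2,3) by blast
qed

text \<open>With \<open>\<rho> = \<lambda> / K\<close>, the vertices of degree above \<open>\<theta> \<approx> \<rho>\<^sup>2 n / 2\<close> count as large, and there are at
  most \<open>nb \<approx> 2 / \<rho>\<^sup>2\<close> of them. The two bounds on \<open>\<epsilon>\<close> multiply to \<open>\<epsilon>\<^sup>2 \<le> \<rho>\<^sup>1\<^sup>6\<close>, that is,
  \<open>\<epsilon> \<le> \<rho>\<^sup>8\<close>. The total error is of order \<open>nb\<^sup>2 * \<epsilon> n\<close>, hence at most a constant times \<open>\<rho>\<^sup>4 n\<close>,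
  while \<open>r\<close> can be chosen above \<open>3 * \<rho>\<^sup>2 n\<close> if \<open>h\<close> exceeds \<open>\<Lambda>\<close>.\<close>

lemma constants_fit:
  fixes n K h N L \<Lambda> :: nat and lam \<epsilon> \<epsilon>0 :: real
  assumes pos: "0 < n" "0 < K" "0 < \<epsilon>0" "0 < \<epsilon>" "0 < lam"
    and lam: "lam \<le> 1 / 100" and e1: "\<epsilon> \<le> lam ^ 16" and e2: "\<epsilon> \<le> (1 / real K) ^ 16"
    and e0: "\<epsilon>0 \<le> \<epsilon>" and n: "1 / real n \<le> \<epsilon>0^2 / 100"
    and N: "real N \<ge> real n / 8" "real N \<le> real n / 4" "N = K^2 * L + \<Lambda>" "real \<Lambda> = lam * real n"
    and h: "h \<le> N"
  defines "\<rho> \<equiv> lam / real K"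
  defines "\<theta> \<equiv> nat \<lfloor>\<rho>^2 * real n / 2\<rfloor>" and "nb \<equiv> nat \<lceil>2 / \<rho>^2\<rceil>"
    and "\<sigma> \<equiv> nat \<lceil>\<epsilon> * real n\<rceil>" and "x \<equiv> nat \<lfloor>\<epsilon>0 * real n\<rfloor>" and "z \<equiv> nat \<lceil>\<epsilon>0 * real n\<rceil>"
  shows "4 * h < (nb + 1) * (\<theta> + 1)" "\<epsilon>0 * real n \<le> real \<theta>" "\<sigma> \<le> \<Lambda>" "2 \<le> sqrt \<epsilon>0 * real n"
    "4 * x + 2 * z + 2 < K * L" "4 * x + 2 * z + 2 < \<Lambda>"
    "\<Lambda> < h \<Longrightarrow> \<exists>t r. h = K^2 * t + r \<and> t \<le> L \<and> r \<le> \<Lambda> \<and> \<theta> \<le> t \<and> \<theta> \<le> r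
        \<and> (nb + 4) * ((nb + 1) * \<sigma> + K^2 + x) + nb * x + 3 * K^2 \<le> r"
proof -
  have rn: "real n > 0" and rK: "real K \<ge> 1" using pos by auto
  have \<rho>: "0 < \<rho>" "\<rho> \<le> lam" "\<rho> \<le> 1 / 100" "\<rho> \<le> 1 / (100 * real K)"
    using pos rK lam unfolding \<rho>_def by (auto simp: field_simps)
  have \<epsilon>\<rho>: "\<epsilon> \<le> \<rho> ^ 8"
  proof -
    have "\<epsilon> * \<epsilon> \<le> lam ^ 16 * (1 / real K) ^ 16" using e1 e2 pos by (intro mult_mono) auto
    also have "\<dots> = (\<rho> ^ 8) ^ 2" unfolding \<rho>_def by (simp add: power_divide flip: power_mult)
    finally have "\<epsilon> ^ 2 \<le> (\<rho> ^ 8) ^ 2" by (simp add: power2_eq_square)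
    then show ?thesis by (rule power2_le_imp_le) (use \<rho> in auto)
  qed
  have \<rho>2: "\<rho>^2 \<le> 1 / 10000" using power_mono[OF \<rho>(3), of 2] \<rho>(1) by (simp add: power2_eq_square)
  have \<rho>4: "\<rho>^4 \<le> \<rho>^2 / 10000"
  proof -
    have "\<rho>^4 = \<rho>^2 * \<rho>^2" by (simp flip: power_add)
    also have "\<dots> \<le> \<rho>^2 * (1 / 10000)" using \<rho>2 \<rho>(1) by (intro mult_left_mono) auto
    finally show ?thesis by simp
  qed
  have \<epsilon>4: "\<epsilon> / \<rho>^4 \<le> \<rho>^2 / 10000"
  proof -
    have "\<epsilon> / \<rho>^4 \<le> \<rho>^8 / \<rho>^4" using \<epsilon>\<rho> \<rho> by (intro divide_right_mono) auto
    also have "\<dots> = \<rho>^4" using \<rho> by (simp add: field_simps flip: power_add)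
    finally show ?thesis using \<rho>4 by linarith
  qed
  have \<rho>41: "\<rho>^4 \<le> 1" and \<rho>21: "\<rho>^2 \<le> 1" using \<rho> by (auto intro: power_le_one)
  have \<epsilon>2: "\<epsilon> \<le> \<rho>^2 / 10000"
  proof -
    have "\<epsilon> * 1 \<le> \<epsilon> * (1 / \<rho>^4)" using \<rho>41 \<rho> pos by (intro mult_left_mono) auto
    then have "\<epsilon> \<le> \<epsilon> / \<rho>^4" by simp
    then show ?thesis using \<epsilon>4 by linarith
  qed
  have \<rho>\<rho>: "\<rho>^2 \<le> \<rho> / 100" using \<rho> by (simp add: power2_eq_square mult_left_mono[of \<rho> "1/100" \<rho>, simplified])
  have \<epsilon>1: "\<epsilon> \<le> 1" using \<epsilon>2 \<rho>21 by linarith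
  have e0n: "\<epsilon>0 * real n \<ge> 100 / \<epsilon>0"
  proof -
    have "100 \<le> \<epsilon>0^2 * real n" using n rn by (simp add: field_simps)
    then show ?thesis using pos by (simp add: field_simps power2_eq_square)
  qed
  have e0n': "\<epsilon>0 * real n \<ge> 100 / \<epsilon>"
    using e0n e0 pos by (meson divide_left_mono mult_pos_pos order_trans zero_le_numeral)
  have en0: "\<epsilon>0 * real n \<le> \<epsilon> * real n" using e0 rn by simp
  have en: "\<epsilon> * real n \<ge> 100 / \<epsilon>" using e0n' en0 by linarith
  have "100 \<le> 100 / \<epsilon>" using pos \<epsilon>1 by (simp add: le_divide_eq)
  then have en1: "\<epsilon> * real n \<ge> 100" and e0n1: "\<epsilon>0 * real n \<ge> 100"
    using en e0n' by linarith+
  have eK: "\<epsilon> * real n \<ge> real K ^ 2"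
  proof -
    have "\<epsilon> * real K ^ 16 \<le> 1" using e2 rK by (simp add: field_simps power_divide)
    then have "real K ^ 16 \<le> 1 / \<epsilon>" using pos by (simp add: field_simps)
    moreover have "real K ^ 2 \<le> real K ^ 16" using rK by (intro power_increasing) auto
    moreover have "1 / \<epsilon> \<le> 100 / \<epsilon>" using pos by (simp add: divide_right_mono)
    ultimately show ?thesis using en by linarith
  qed
  have x: "real x \<le> \<epsilon> * real n" and \<sigma>: "real \<sigma> \<le> 2 * (\<epsilon> * real n)" and z: "real z \<le> 2 * (\<epsilon> * real n)"
    unfolding x_def \<sigma>_def z_def using en0 en1 e0n1 by linarith+
  have \<theta>: "\<rho>^2 * real n / 2 < real \<theta> + 1" "real \<theta> \<le> \<rho>^2 * real n / 2"
    unfolding \<theta>_def using \<rho> rn by (auto simp: algebra_simps) linarith+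
  have nbl: "2 / \<rho>^2 \<le> real nb" unfolding nb_def using \<rho> by linarith
  have nbu: "real nb \<le> 2 / \<rho>^2 + 1" unfolding nb_def using \<rho> by (simp add: of_nat_ceiling)
  have \<epsilon>n: "\<epsilon> * real n \<le> \<rho>^2 * real n / 10000" using \<epsilon>2 rn by (simp add: mult_right_mono[of \<epsilon> "\<rho>^2/10000" "real n", simplified])
  show "4 * h < (nb + 1) * (\<theta> + 1)"
  proof -
    have "real (4 * h) \<le> real n" using h N(2) by simp
    also have "\<dots> = (2 / \<rho>^2) * (\<rho>^2 * real n / 2)" using \<rho> by simp
    also have "\<dots> \<le> (2 / \<rho>^2) * (real \<theta> + 1)" using \<theta> \<rho> by (intro mult_left_mono) auto
    also have "\<dots> < (real nb + 1) * (real \<theta> + 1)" using nbl by (intro mult_strict_right_mono) auto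
    finally have "real (4 * h) < real ((nb + 1) * (\<theta> + 1))" by (simp add: algebra_simps)
    then show ?thesis by (simp only: of_nat_less_iff)
  qed
  show "\<epsilon>0 * real n \<le> real \<theta>" using \<theta> \<epsilon>n en0 en1 by linarith
  have \<rho>l: "\<rho>^2 * real n \<le> lam * real n / 100"
    using \<rho>\<rho> \<rho>(2) rn by (simp add: mult_right_mono[of "\<rho>^2" "lam/100" "real n", simplified])
  have "0 \<le> lam * real n" using pos by simp
  then have \<epsilon>\<Lambda>: "\<epsilon> * real n * 10000 \<le> real \<Lambda>" using \<epsilon>n \<rho>l N(4) by linarith
  show "\<sigma> \<le> \<Lambda>" using \<sigma> \<epsilon>\<Lambda> en1 by linarith
  show "2 \<le> sqrt \<epsilon>0 * real n"
  proof -
    have "\<epsilon>0 \<le> 1" using e0 \<epsilon>1 by linarith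
    then have "\<epsilon>0 \<le> sqrt \<epsilon>0" using pos by (simp add: real_le_rsqrt power2_eq_square mult_left_le)
    then have "\<epsilon>0 * real n \<le> sqrt \<epsilon>0 * real n" using rn by simp
    then show ?thesis using e0n1 by linarith
  qed
  have big: "real (4 * x + 2 * z + 2) \<le> 10 * (\<epsilon> * real n)" using x z en1 by simp
  show "4 * x + 2 * z + 2 < \<Lambda>"
  proof -
    have "real (4 * x + 2 * z + 2) < real \<Lambda>" using big \<epsilon>\<Lambda> en1 by linarith
    then show ?thesis by (simp only: of_nat_less_iff)
  qed
  have NR: "real N = real K ^ 2 * real L + real \<Lambda>" using N(3) by simp
  have \<Lambda>n: "real \<Lambda> \<le> real n / 100" using N(4) lam rn by simp
  have KL: "real K ^ 2 * real L \<ge> real n / 10" using NR N(1) \<Lambda>n by linarith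
  show "4 * x + 2 * z + 2 < K * L"
  proof -
    have "\<rho>^2 * real n \<le> \<rho> / 100 * real n" using \<rho>\<rho> by (rule mult_right_mono) simp
    then have "\<epsilon> * real n \<le> \<rho> / 100 * real n / 10000" using \<epsilon>n by linarith
    also have "\<dots> \<le> (1 / (100 * real K)) / 100 * real n / 10000"
      using \<rho>(4) rn by (intro divide_right_mono mult_right_mono) auto
    finally have "real K * (\<epsilon> * real n) \<le> real n / 100000000" using rK by (simp add: field_simps)
    moreover have "real K * real (4 * x + 2 * z + 2) \<le> real K * (10 * (\<epsilon> * real n))"
      using big rK by (intro mult_left_mono) auto
    moreover have "real K * (10 * (\<epsilon> * real n)) = 10 * (real K * (\<epsilon> * real n))"
      "real K * (real K * real L) = real K ^ 2 * real L"
      by (simp_all add: power2_eq_square)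
    ultimately have "real K * real (4 * x + 2 * z + 2) < real K * (real K * real L)"
      using KL rn by linarith
    then have "real (4 * x + 2 * z + 2) < real (K * L)" using rK by simp
    then show ?thesis by (simp only: of_nat_less_iff)
  qed
  assume hL: "\<Lambda> < h"
  define q where "q = real L * real h / real N"
  \<comment> \<open>Reserved and free colours receive cross edges in proportion to their numbers, so that both \<open>t\<close> and \<open>r\<close> are linear in \<open>n\<close>.\<close>
  define t where "t = nat \<lceil>q\<rceil>"
  have Npos: "real N > 0" using N(1) rn by linarith
  have q0: "q \<ge> 0" unfolding q_def by simp
  have t: "q \<le> real t" "real t < q + 1" unfolding t_def using q0 by linarith+
  have qL: "q \<le> real L" unfolding q_def using h Npos by (simp add: field_simps mult_left_mono)
  then have tL: "t \<le> L" unfolding t_def using q0 by (simp add: ceiling_le_iff nat_le_iff)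
  have Kq: "real K ^ 2 * q = real h - real \<Lambda> * real h / real N"
  proof -
    have "real K ^ 2 * q = (real N - real \<Lambda>) * real h / real N" unfolding q_def NR by simp
    then show ?thesis using Npos by (simp add: field_simps)
  qed
  have Lh: "real \<Lambda> * real h / real N \<ge> 4 * (lam * lam * real n)"
  proof -
    have "real \<Lambda> * real \<Lambda> / (real n / 4) \<le> real \<Lambda> * real h / real N"
      using hL N(2) Npos rn by (intro frac_le mult_left_mono) auto
    moreover have "real \<Lambda> * real \<Lambda> / (real n / 4) = 4 * (lam * lam * real n)"
      using N(4) rn by (simp add: field_simps)
    ultimately show ?thesis by simp
  qed
  have \<rho>lam: "\<rho>^2 * real n \<le> lam * lam * real n"
    using \<rho>(1,2) rn by (simp add: power2_eq_square mult_mono)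
  have Kt: "real K ^ 2 * real t \<le> real K ^ 2 * q + real K ^ 2" "real K ^ 2 * q \<le> real K ^ 2 * real t"
    using mult_left_mono[of "real t" "q + 1" "real K ^ 2"] mult_left_mono[OF t(1), of "real K ^ 2"] t
    by (simp_all add: algebra_simps)
  have Kth: "real (K^2 * t) \<le> real h"
  proof -
    have "0 \<le> \<rho>^2 * real n" by simp
    then have "real K ^ 2 * real t \<le> real h" using Kt Kq Lh \<rho>lam eK \<epsilon>n by linarith
    then show ?thesis by simp
  qed
  then have Kth': "K^2 * t \<le> h" by (simp only: of_nat_le_iff)
  define r where "r = h - K^2 * t"
  have r: "real r = real h - real K ^ 2 * real t" 
    using of_nat_diff[of "K^2 * t" h, where 'a=real] Kth' unfolding r_def by simp
  have r3: "real r \<ge> 3 * (\<rho>^2 * real n)" using r Kt Kq Lh \<rho>lam eK \<epsilon>n en1 by linarith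
  have rL: "r \<le> \<Lambda>"
  proof -
    have "real \<Lambda> * real h / real N \<le> real \<Lambda>" 
      using h Npos mult_left_mono[of "real h" "real N" "real \<Lambda>"] by (simp add: pos_divide_le_eq)
    then have "real r \<le> real \<Lambda>" using r Kt Kq by linarith
    then show ?thesis by simp
  qed
  have \<theta>r: "\<theta> \<le> r" using \<theta>(2) r3 en1 \<epsilon>n by linarith
  have \<theta>t: "\<theta> \<le> t"
  proof -
    have "real K ^ 2 * real \<theta> \<le> real K ^ 2 * (\<rho>^2 * real n / 2)" using \<theta>(2) by (intro mult_left_mono) auto
    also have "\<dots> = lam * lam * real n / 2" unfolding \<rho>_def using rK by (simp add: field_simps power2_eq_square)
    also have "\<dots> \<le> lam * real n / 200" using lam pos rn by (simp add: field_simps)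
    also have "\<dots> \<le> (real n / 10) * (real \<Lambda> / (real n / 4))" using N(4) rn pos by (simp add: field_simps)
    also have "\<dots> \<le> (real K ^ 2 * real L) * (real h / real N)"
      using KL hL N(2) Npos rn by (intro mult_mono frac_le) auto
    also have "\<dots> = real K ^ 2 * q" unfolding q_def by simp
    finally have "real \<theta> \<le> q" using rK by simp
    then show ?thesis using t by linarith
  qed
  have slack: "(nb + 4) * ((nb + 1) * \<sigma> + K^2 + x) + nb * x + 3 * K^2 \<le> r"
  proof -
    define E where "E = \<epsilon> * real n"
    define w where "w = 1 / \<rho>^2"
    have w: "w \<ge> 10000" unfolding w_def using \<rho>2 \<rho> by (simp add: field_simps)
    have E0: "E \<ge> 0" unfolding E_def using pos by simp
    have nb3: "real nb + 4 \<le> 3 * w" "real nb + 1 \<le> 3 * w" "real nb \<le> 3 * w"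
      using nbu w unfolding w_def by linarith+
    have "(real nb + 1) * real \<sigma> + real K ^ 2 + real x \<le> (3 * w) * (2 * E) + E + E"
      using nb3 \<sigma> eK x w E0 unfolding E_def by (intro add_mono mult_mono) auto
    also have "\<dots> \<le> 7 * (w * E)" using mult_right_mono[OF w E0] by (simp add: algebra_simps) (use E0 in linarith)
    finally have "(real nb + 4) * ((real nb + 1) * real \<sigma> + real K ^ 2 + real x) \<le> (3 * w) * (7 * (w * E))"
      using nb3 w E0 by (intro mult_mono) auto
    moreover have "real nb * real x \<le> (3 * w) * E" using nb3 x w E0 unfolding E_def by (intro mult_mono) auto
    moreover have "w * E \<le> w * (w * E)" "E \<le> w * (w * E)"
    proof -
      have a: "1 * E \<le> w * E" using w E0 by (intro mult_right_mono) auto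
      have b: "1 * (w * E) \<le> w * (w * E)" using w E0 by (intro mult_right_mono) auto
      show "w * E \<le> w * (w * E)" "E \<le> w * (w * E)" using a b by linarith+
    qed
    moreover have "w * (w * E) \<le> \<rho>^2 * real n / 10000"
    proof -
      have "w * (w * E) = \<epsilon> / \<rho>^4 * real n" unfolding w_def E_def by (simp add: field_simps flip: power_add)
      also have "\<dots> \<le> \<rho>^2 / 10000 * real n" using \<epsilon>4 rn by (intro mult_right_mono) auto
      finally show ?thesis by simp
    qed
    moreover have "real K ^ 2 \<le> E" using eK unfolding E_def .
    ultimately have "(real nb + 4) * ((real nb + 1) * real \<sigma> + real K ^ 2 + real x) + real nb * real x + 3 * real K ^ 2
        \<le> 27 * (\<rho>^2 * real n / 10000)" by linarith
    also have "\<dots> \<le> real r"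
    proof -
      have "0 \<le> \<rho>^2 * real n" by simp
      then show ?thesis using r3 by linarith
    qed
    finally have "real ((nb + 4) * ((nb + 1) * \<sigma> + K^2 + x) + nb * x + 3 * K^2) \<le> real r"
      by (simp add: algebra_simps)
    then show ?thesis by (simp only: of_nat_le_iff)
  qed
  have "h = K^2 * t + r" unfolding r_def using Kth' by simp
  then show "\<exists>t r. h = K^2 * t + r \<and> t \<le> L \<and> r \<le> \<Lambda> \<and> \<theta> \<le> t \<and> \<theta> \<le> r
        \<and> (nb + 4) * ((nb + 1) * \<sigma> + K^2 + x) + nb * x + 3 * K^2 \<le> r"
    using tL rL \<theta>t \<theta>r slack by blast
qed

section \<open>The decomposition of an exceptional scheme\<close>

lemma balance_of_pm:
  fixes d d' k \<sigma> n :: nat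
  assumes "pm (real d') (real d / real k) (\<epsilon> * real n / real k)" "k > 0"
  shows "d \<le> k * d' + nat \<lceil>\<epsilon> * real n\<rceil> \<and> k * d' \<le> d + nat \<lceil>\<epsilon> * real n\<rceil>"
proof -
  have k: "real k > 0" using assms(2) by simp
  have "real d / real k - \<epsilon> * real n / real k \<le> real d'" "real d' \<le> real d / real k + \<epsilon> * real n / real k"
    using assms(1) unfolding pm_def by auto
  then have "real d - \<epsilon> * real n \<le> real d' * real k" "real d' * real k \<le> real d + \<epsilon> * real n"
    using k by (simp_all add: divide_le_eq le_divide_eq flip: diff_divide_distrib add_divide_distrib)
  moreover have "\<epsilon> * real n \<le> real (nat \<lceil>\<epsilon> * real n\<rceil>)" by linarith
  moreover have "real d' * real k = real (k * d')" by simp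
  ultimately have "real d \<le> real (k * d' + nat \<lceil>\<epsilon> * real n\<rceil>)" "real (k * d') \<le> real (d + nat \<lceil>\<epsilon> * real n\<rceil>)"
    by linarith+
  then show ?thesis by (simp only: of_nat_le_iff)
qed

lemma deg_bip_induced_le:
  assumes "real (max_deg (bip_induced G X Y)) \<le> c" "finite X" "finite Y" "X \<inter> Y = {}"
  shows "v \<in> X \<Longrightarrow> real (deg_in G v Y) \<le> c" "v \<in> Y \<Longrightarrow> real (deg_in G v X) \<le> c"
proof -
  have m: "deg (bip_induced G X Y) v \<le> max_deg (bip_induced G X Y)" if "v \<in> X \<union> Y" for v
    using that assms(2,3) unfolding max_deg_def by (auto simp: bip_induced_def)
  show "real (deg_in G v Y) \<le> c" if "v \<in> X"
  proof -
    have "{u. {v, u} \<in> edges (bip_induced G X Y)} = {u \<in> Y. {v, u} \<in> edges G}"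
      using that assms(4) unfolding bip_induced_def by (auto simp: doubleton_eq_iff)
    then show ?thesis using m[of v] that assms(1) unfolding deg_def deg_in_def by simp
  qed
  show "real (deg_in G v X) \<le> c" if "v \<in> Y"
  proof -
    have "{u. {v, u} \<in> edges (bip_induced G X Y)} = {u \<in> X. {v, u} \<in> edges G}"
      using that assms(4) unfolding bip_induced_def by (auto simp: doubleton_eq_iff)
    then show ?thesis using m[of v] that assms(1) unfolding deg_def deg_in_def by simp
  qed
qed

text \<open>Here \<open>D\<close> is the common degree \<open>2 * N\<close> of the exceptional vertices. All numbers of edges between
  parts are at most \<open>n\<close>, so that the maxima in the definition of an exceptional scheme are equal
  to \<open>n\<close>.\<close>

lemma decomposition_of_scheme:
  fixes G :: "'a graph" and A B :: "nat \<Rightarrow> 'a set" and n K m :: nat and \<epsilon>0 \<epsilon> lam D :: real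
  assumes pos: "0 < n" "0 < K" "0 < \<epsilon>0" "0 < \<epsilon>" "0 < lam"
    and lam: "lam \<le> 1 / 100" and e1: "\<epsilon> \<le> lam ^ 16" and e2: "\<epsilon> \<le> (1 / real K) ^ 16"
    and e0: "\<epsilon>0 \<le> \<epsilon>" and n: "1 / real n \<le> \<epsilon>0^2 / 100"
    and D: "real n / 4 \<le> D" "D \<le> real n / 2"
    and nats: "lam * real n / real K ^ 2 \<in> \<nat>" "D / (2 * real K ^ 2) \<in> \<nat>"
    and G: "simple_graph G" and cV: "card (verts G) = n"
    and inner: "\<And>e. e \<in> edges G \<Longrightarrow> \<not> e \<subseteq> core K A \<and> \<not> e \<subseteq> core K B \<and> \<not> e \<subseteq> A 0 \<and> \<not> e \<subseteq> B 0"
    and degs: "\<And>v. v \<in> A 0 \<union> B 0 \<Longrightarrow> real (deg G v) = D"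
    and ev: "even (num_edges_between G (whole K A) (whole K B))"
    and sch: "exceptional_scheme K m \<epsilon>0 \<epsilon> G A B"
    and md: "real (max_deg (bip_induced G (whole K A) (whole K B))) \<le> real (num_edges_between G (whole K A) (whole K B)) / 2"
    and eD: "real (num_edges_between G (whole K A) (whole K B)) / 2 \<le> D / 2"
  shows "\<exists>N J. real N = D / 2 \<and> local_decomposition \<epsilon>0 K A B G N ((D - 2 * lam * real n) / (2 * real K ^ 2)) J"
proof -
  let ?A = "whole K A" and ?B = "whole K B"
  let ?d = "\<lambda>v X. deg_in G v X" and ?e = "\<lambda>X Y. num_edges_between G X Y"
  define H where "H = cross G ?A ?B"
  obtain p where p: "D / (2 * real K ^ 2) = real p" using nats(2) by (auto elim: Nats_cases)
  obtain q where q: "lam * real n / real K ^ 2 = real q" using nats(1) by (auto elim: Nats_cases)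
  have rK: "real K > 0" and rn: "real n > 0" using pos by auto
  define N where "N = K^2 * p"
  define \<Lambda> where "\<Lambda> = K^2 * q"
  define L where "L = p - q"
  have N: "real N = D / 2" unfolding N_def using p rK by (simp add: field_simps)
  have \<Lambda>: "real \<Lambda> = lam * real n" unfolding \<Lambda>_def using q rK by (simp add: field_simps)
  have "lam * real n \<le> 1 / 100 * real n" using lam by (rule mult_right_mono) simp
  then have "real \<Lambda> \<le> real N" using N \<Lambda> D rn by linarith
  then have "K^2 * q \<le> K^2 * p" unfolding N_def \<Lambda>_def by (simp only: of_nat_le_iff)
  then have qp: "q \<le> p" using pos by simp
  have NL: "N = K^2 * L + \<Lambda>" unfolding N_def L_def \<Lambda>_def using qp by (simp add: diff_mult_distrib2)
  have L: "real L = (D - 2 * lam * real n) / (2 * real K ^ 2)"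
  proof -
    have "real L = real p - real q" unfolding L_def using qp by (simp add: of_nat_diff)
    then show ?thesis unfolding p[symmetric] q[symmetric] using rK by (simp add: field_simps)
  qed
  obtain h where h: "?e ?A ?B = 2 * h" using ev by (auto elim: evenE)
  have hN: "h \<le> N" using eD h N by simp
  define \<rho> where "\<rho> = lam / real K"
  define \<theta> where "\<theta> = nat \<lfloor>\<rho>^2 * real n / 2\<rfloor>"
  define nb where "nb = nat \<lceil>2 / \<rho>^2\<rceil>"
  define \<sigma> where "\<sigma> = nat \<lceil>\<epsilon> * real n\<rceil>"
  define x where "x = nat \<lfloor>\<epsilon>0 * real n\<rfloor>"
  define z where "z = nat \<lceil>\<epsilon>0 * real n\<rceil>"
  have "real n / 8 \<le> real N" "real N \<le> real n / 4" using N D by auto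
  note fit = constants_fit[OF pos lam e1 e2 e0 n this NL \<Lambda> hN,
      folded \<rho>_def, folded \<theta>_def nb_def \<sigma>_def x_def z_def]
  have sch': "is_partition K m \<epsilon>0 (verts G) A B"
    "\<And>v. v \<in> core K A \<Longrightarrow> real (?d v ?B) < \<epsilon>0 * real n" "\<And>v. v \<in> core K B \<Longrightarrow> real (?d v ?A) < \<epsilon>0 * real n"
    "\<And>v i. v \<in> verts G \<Longrightarrow> i \<in> {1..K} \<Longrightarrow> pm (real (?d v (A i))) (real (?d v (core K A)) / real K) (\<epsilon> * real n / real K)"
    "\<And>v i. v \<in> verts G \<Longrightarrow> i \<in> {1..K} \<Longrightarrow> pm (real (?d v (B i))) (real (?d v (core K B)) / real K) (\<epsilon> * real n / real K)"
    "\<And>i. i \<in> {1..K} \<Longrightarrow> pm (real (?e (B 0) (A i))) (real (?e (B 0) (core K A)) / real K) (\<epsilon> * max (real (?e (B 0) (core K A))) (real n) / real K)"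
    "\<And>i. i \<in> {1..K} \<Longrightarrow> pm (real (?e (A 0) (B i))) (real (?e (A 0) (core K B)) / real K) (\<epsilon> * max (real (?e (A 0) (core K B))) (real n) / real K)"
    "\<And>i j. i \<in> {1..K} \<Longrightarrow> j \<in> {1..K} \<Longrightarrow> pm (real (?e (A i) (B j))) (real (?e (core K A) (core K B)) / real (K^2)) (\<epsilon> * max (real (?e (core K A) (core K B))) (real n) / real (K^2))"
    using sch unfolding exceptional_scheme_def Let_def cV by auto
  have V: "verts G = ?A \<union> ?B" and disA: "disjoint_family_on A {0..K}" and disB: "disjoint_family_on B {0..K}"
    and sides: "?A \<inter> ?B = {}" and small0: "real (card (A 0 \<union> B 0)) \<le> \<epsilon>0 * real n"
    using sch'(1) cV unfolding is_partition_def by auto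
  have finV: "finite (verts G)" using G unfolding simple_graph_def by auto
  then have fin: "finite ?A" "finite ?B" using V by auto
  have sub: "core K A \<subseteq> ?A" "core K B \<subseteq> ?B" "A 0 \<subseteq> ?A" "B 0 \<subseteq> ?B"
    unfolding whole_def by auto
  have fin0: "finite (A 0)" "finite (B 0)" using fin sub finite_subset by blast+
  have fH: "finite H" unfolding H_def cross_def
    by (rule finite_subset[of _ "?A \<times> ?B"]) (use fin in auto)
  have x: "card (A 0) \<le> x" "card (B 0) \<le> x"
  proof -
    have "card (A 0 \<union> B 0) \<le> x" unfolding x_def using small0 by linarith
    then show "card (A 0) \<le> x" "card (B 0) \<le> x"
      using card_mono[of "A 0 \<union> B 0" "A 0"] card_mono[of "A 0 \<union> B 0" "B 0"] fin0 by auto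
  qed
  have cH: "card H = 2 * h"
    using h num_edges_between_cross[OF order_refl order_refl sides, of G]
    unfolding H_def by (simp add: cross_def conj_ac cong: conj_cong)
  have e_le: "real (?e X Y) \<le> real n" if "X \<subseteq> ?A" "Y \<subseteq> ?B" for X Y
  proof -
    have "?e X Y \<le> card H"
      unfolding num_edges_between_cross[OF that sides] H_def[symmetric] using fH by (intro card_mono) auto
    then have "real (?e X Y) \<le> 2 * real N" using cH hN by simp
    then show ?thesis using N D rn by linarith
  qed
  have md': "real (max_deg (bip_induced G ?A ?B)) \<le> real h" using md h by simp
  have dh: "fdeg H v \<le> h" "sdeg H v \<le> h" for v
  proof -
    show "fdeg H v \<le> h"
    proof (cases "v \<in> ?A")
      case True
      then show ?thesis using deg_bip_induced_le(1)[OF md' fin sides] fdeg_cross[OF True] unfolding H_def by simp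
    next
      case False
      then have "{e\<in>H. fst e = v} = {}" unfolding H_def cross_def by auto
      then show ?thesis unfolding incid_def by (simp only: card.empty)
    qed
    show "sdeg H v \<le> h"
    proof (cases "v \<in> ?B")
      case True
      then show ?thesis using deg_bip_induced_le(2)[OF md' fin sides] sdeg_cross[OF True] unfolding H_def by simp
    next
      case False
      then have "{e\<in>H. snd e = v} = {}" unfolding H_def cross_def by auto
      then show ?thesis unfolding incid_def by (simp only: card.empty)
    qed
  qed
  have vV: "v \<in> verts G" if "v \<in> A 0 \<or> v \<in> B 0" for v using that sub V by blast
  have core_small: "deg_in G v ?B \<le> \<theta>" "deg_in G v ?B \<le> z" if "v \<in> core K A" for v
    using sch'(2)[OF that] fit(2) unfolding z_def by linarith+
  have core_small': "deg_in G v ?A \<le> \<theta>" "deg_in G v ?A \<le> z" if "v \<in> core K B" for v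
    using sch'(3)[OF that] fit(2) unfolding z_def by linarith+
  have bal: "?e (A 0) (core K B) \<le> K * ?e (A 0) (B j) + \<sigma>" "?e (B 0) (core K A) \<le> K * ?e (B 0) (A j) + \<sigma>"
    if "j \<in> {1..K}" for j
  proof -
    have "max (real (?e (A 0) (core K B))) (real n) = real n" using e_le sub by simp
    then show "?e (A 0) (core K B) \<le> K * ?e (A 0) (B j) + \<sigma>"
      using balance_of_pm[OF _ pos(2)] sch'(7)[OF that] unfolding \<sigma>_def by metis
    have "max (real (?e (B 0) (core K A))) (real n) = real n"
      using e_le[OF sub(1,4)] unfolding num_edges_between_commute[of G "B 0"] by simp
    then show "?e (B 0) (core K A) \<le> K * ?e (B 0) (A j) + \<sigma>"
      using balance_of_pm[OF _ pos(2)] sch'(6)[OF that] unfolding \<sigma>_def by metis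
  qed
  have balAB: "?e (core K A) (core K B) \<le> K^2 * ?e (A i) (B j) + \<sigma>" if "i \<in> {1..K}" "j \<in> {1..K}" for i j
  proof -
    have "max (real (?e (core K A) (core K B))) (real n) = real n" using e_le[OF sub(1,2)] by simp
    moreover have "K^2 > 0" using pos by simp
    ultimately show ?thesis using balance_of_pm sch'(8)[OF that] unfolding \<sigma>_def by metis
  qed
  have "\<exists>t r E. h = K^2 * t + r \<and> t \<le> L \<and> r \<le> \<Lambda> \<and> sharing K (idx A) (idx B) (A 0) (B 0) (cross G ?A ?B) t r \<Lambda> E"
  proof (rule cross_types[OF fin disA disB sides pos(2), where \<theta>=\<theta> and \<sigma>=\<sigma> and x=x and nb=nb])
    fix v j assume "v \<in> A 0" "j \<in> {1..K}"
    then show "deg_in G v (core K B) \<le> K * deg_in G v (B j) + \<sigma> \<and> K * deg_in G v (B j) \<le> deg_in G v (core K B) + \<sigma>"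
      using balance_of_pm[OF sch'(5) pos(2)] vV unfolding \<sigma>_def by blast
  next
    fix v j assume "v \<in> B 0" "j \<in> {1..K}"
    then show "deg_in G v (core K A) \<le> K * deg_in G v (A j) + \<sigma> \<and> K * deg_in G v (A j) \<le> deg_in G v (core K A) + \<sigma>"
      using balance_of_pm[OF sch'(4) pos(2)] vV unfolding \<sigma>_def by blast
  qed (fact cH[unfolded H_def] dh[unfolded H_def] bal balAB core_small core_small' x fit(1) fit(7) | assumption)+
  then obtain t r E where tr: "h = K^2 * t + r" "t \<le> L" "r \<le> \<Lambda>"
    and sh: "sharing K (idx A) (idx B) (A 0) (B 0) (cross G ?A ?B) t r \<Lambda> E" by blast
  have deg2N: "deg G v = 2 * N" if "v \<in> A 0 \<union> B 0" for v
  proof -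
    have "real (deg G v) = real (2 * N)" using degs[OF that] N by simp
    then show ?thesis by (simp only: of_nat_eq_iff)
  qed
  have bA: "deg_in G v (core K A) \<le> K * deg_in G v (A i) + \<sigma>" if "v \<in> A 0" "i \<in> {1..K}" for v i
    using balance_of_pm[OF sch'(4) pos(2)] vV that unfolding \<sigma>_def by blast
  have bB: "deg_in G v (core K B) \<le> K * deg_in G v (B i) + \<sigma>" if "v \<in> B 0" "i \<in> {1..K}" for v i
    using balance_of_pm[OF sch'(5) pos(2)] vV that unfolding \<sigma>_def by blast
  have zA: "fdeg (cross G ?A ?B) y \<le> z" if "y \<in> core K A" for y
    using core_small(2)[OF that] fdeg_cross[of y ?A G ?B] sub(1) that by auto
  have zB: "sdeg (cross G ?A ?B) y \<le> z" if "y \<in> core K B" for y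
    using core_small'(2)[OF that] sdeg_cross[of y ?B G ?A] sub(2) that by auto
  have e0': "\<epsilon>0 \<ge> 0" "2 \<le> sqrt \<epsilon>0 * real (card (verts G))" using pos fit(4) cV by auto
  have "\<exists>J. local_decomposition \<epsilon>0 K A B G N (real L) J"
    by (rule exceptional_decomposition[OF G V disA disB sides pos(2) NL inner deg2N cH[unfolded H_def] tr bA bB fit(3)
      sh zA zB x fit(5,6) e0'])
  then show ?thesis unfolding L using N by blast
qed

lemma hierarchy_fun_power: "hierarchy_fun (\<lambda>x. x ^ k)"
  unfolding hierarchy_fun_def
proof
  show "mono_on {0<..1} (\<lambda>x::real. x ^ k)" by (intro mono_onI power_mono) auto
  show "(\<lambda>x::real. x ^ k) ` {0<..1} \<subseteq> {0<..1}" by (auto simp: power_le_one)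
qed

lemma hierarchy_fun_scaled_square: "hierarchy_fun (\<lambda>x. x\<^sup>2 / 100)"
  unfolding hierarchy_fun_def
proof
  show "mono_on {0<..1} (\<lambda>x::real. x\<^sup>2 / 100)"
    by (intro mono_onI divide_right_mono power_mono) auto
  have "x\<^sup>2 \<le> 100" if "0 < x" "x \<le> 1" for x :: real using power_le_one[of x 2] that by simp
  then show "(\<lambda>x::real. x\<^sup>2 / 100) ` {0<..1} \<subseteq> {0<..1}" by auto
qed

theorem lemma4p14:
  shows "\<exists>c_phi c_lam c_K :: real. \<exists>f_lam f_K g h :: real \<Rightarrow> real.
    c_phi \<in> {0<..1} \<and> c_lam \<in> {0<..1} \<and> c_K \<in> {0<..1}
    \<and> hierarchy_fun f_lam \<and> hierarchy_fun f_K \<and> hierarchy_fun g \<and> hierarchy_fun h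
    \<and> (\<forall>(n :: nat) (K :: nat) (m :: nat) (\<epsilon>0 :: real) (\<epsilon> :: real) (lam :: real) (\<phi> :: real)
         (G :: 'a graph) (G0 :: 'a graph) (A :: nat \<Rightarrow> 'a set) (B :: nat \<Rightarrow> 'a set).
       let A' = whole K A; B' = whole K B;
           Gd = graph_minus (graph_minus (graph_minus G
                  (induced G (core K A))) (induced G (core K B))) G0
       in
         0 < n \<longrightarrow> 0 < K \<longrightarrow> 0 < \<epsilon>0 \<longrightarrow> 0 < \<epsilon> \<longrightarrow> 0 < lam \<longrightarrow>
         lam \<le> c_lam \<longrightarrow> 1 / real K \<le> c_K \<longrightarrow> \<epsilon> \<le> f_lam lam \<longrightarrow> \<epsilon> \<le> f_K (1 / real K) \<longrightarrow>
         \<epsilon>0 \<le> g \<epsilon> \<longrightarrow> 1 / real n \<le> h \<epsilon>0 \<longrightarrow>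
         0 \<le> \<phi> \<longrightarrow> \<phi> \<le> c_phi \<longrightarrow>
         real n / 4 \<in> \<nat> \<longrightarrow> lam * real n / real K ^ 2 \<in> \<nat> \<longrightarrow>
         (real n / 2 - 1 - \<phi> * real n) / (2 * real K ^ 2) \<in> \<nat> \<longrightarrow>
         simple_graph G \<longrightarrow> card (verts G) = n \<longrightarrow>
         (\<forall>v\<in>verts G. real (deg G v) = real n / 2 - 1) \<longrightarrow>
         is_partition K m \<epsilon>0 (verts G) A B \<longrightarrow>
         real (max_deg (bip_induced G A' B')) \<le> real n / 4 \<longrightarrow>
         real (card A') = real n / 2 \<longrightarrow> real (card B') = real n / 2 \<longrightarrow>
         subgraph G0 G \<longrightarrow>
         subgraph (graph_plus (induced G (A 0)) (induced G (B 0))) G0 \<longrightarrow>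
         (\<forall>v\<in>A 0 \<union> B 0. real (deg G0 v) = \<phi> * real n) \<longrightarrow>
         even (num_edges_between Gd A' B') \<longrightarrow>
         exceptional_scheme K m \<epsilon>0 \<epsilon> Gd A B \<longrightarrow>
         real (max_deg (bip_induced Gd A' B')) \<le> real (num_edges_between Gd A' B') / 2 \<longrightarrow>
         real (num_edges_between Gd A' B') / 2 \<le> (real n / 2 - 1 - \<phi> * real n) / 2 \<longrightarrow>
         (\<exists>(N :: nat) (J :: nat \<Rightarrow> 'a graph).
            real N = (real n / 2 - 1 - \<phi> * real n) / 2
          \<and> (\<forall>k<N. subgraph (J k) Gd
                \<and> exceptional_system \<epsilon>0 (A 0) (core K A) (B 0) (core K B) (J k))
          \<and> disjoint_family_on (\<lambda>k. edges (J k)) {..<N}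
          \<and> (\<Union>k<N. edges (J k)) = edges Gd
          \<and> (\<forall>k<N. (hamilton_ES \<epsilon>0 (A 0) (core K A) (B 0) (core K B) (J k)
                      \<and> num_edges_between (J k) A' B' = 2)
                  \<or> matching_ES \<epsilon>0 (A 0) (core K A) (B 0) (core K B) (J k))
          \<and> (\<forall>i\<in>{1..K}. \<forall>i'\<in>{1..K}. \<exists>S \<subseteq> {..<N}.
                real (card S) = (real n / 2 - 1 - (\<phi> + 2 * lam) * real n) / (2 * real K ^ 2)
              \<and> (\<forall>k\<in>S. local_ES \<epsilon>0 K A B i i' (J k)))))"
proof -
  have main: "\<exists>N J. real N = (real n / 2 - 1 - \<phi> * real n) / 2
      \<and> local_decomposition \<epsilon>0 K A B Gd N ((real n / 2 - 1 - (\<phi> + 2 * lam) * real n) / (2 * real K ^ 2)) J"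
    if pos: "0 < n" "0 < K" "0 < \<epsilon>0" "0 < \<epsilon>" "0 < lam"
      and lam: "lam \<le> 1 / 100" and e1: "\<epsilon> \<le> lam ^ 16" and e2: "\<epsilon> \<le> (1 / real K) ^ 16"
      and e0: "\<epsilon>0 \<le> \<epsilon> ^ 1" and n: "1 / real n \<le> \<epsilon>0^2 / 100"
      and \<phi>: "0 \<le> \<phi>" "\<phi> \<le> 1 / 8"
      and nats: "lam * real n / real K ^ 2 \<in> \<nat>" "(real n / 2 - 1 - \<phi> * real n) / (2 * real K ^ 2) \<in> \<nat>"
      and G: "simple_graph G" and cV: "card (verts G) = n"
      and reg: "\<forall>v\<in>verts G. real (deg G v) = real n / 2 - 1"
      and part: "is_partition K m \<epsilon>0 (verts G) A B"
      and G0: "subgraph G0 G" "subgraph (graph_plus (induced G (A 0)) (induced G (B 0))) G0"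
      and degG0: "\<forall>v\<in>A 0 \<union> B 0. real (deg G0 v) = \<phi> * real n"
      and Gd: "Gd = graph_minus (graph_minus (graph_minus G (induced G (core K A))) (induced G (core K B))) G0"
      and ev: "even (num_edges_between Gd (whole K A) (whole K B))"
      and sch: "exceptional_scheme K m \<epsilon>0 \<epsilon> Gd A B"
      and md: "real (max_deg (bip_induced Gd (whole K A) (whole K B))) \<le> real (num_edges_between Gd (whole K A) (whole K B)) / 2"
      and eD: "real (num_edges_between Gd (whole K A) (whole K B)) / 2 \<le> (real n / 2 - 1 - \<phi> * real n) / 2"
    for n K m :: nat and \<epsilon>0 \<epsilon> lam \<phi> :: real and G G0 Gd :: "'a graph" and A B :: "nat \<Rightarrow> 'a set"
  proof -
    define D where "D = real n / 2 - 1 - \<phi> * real n"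
    have edges_Gd: "edges Gd = {e \<in> edges G. \<not> e \<subseteq> core K A \<and> \<not> e \<subseteq> core K B \<and> e \<notin> edges G0}"
      and verts_Gd: "verts Gd = verts G"
      unfolding Gd graph_minus_def induced_def by auto
    have G0e: "edges G0 \<subseteq> edges G" "\<And>e. e \<in> edges G \<Longrightarrow> e \<subseteq> A 0 \<or> e \<subseteq> B 0 \<Longrightarrow> e \<in> edges G0"
      using G0 unfolding subgraph_def graph_plus_def induced_def by auto
    have "\<epsilon> \<le> 1" using e1 lam pos power_le_one[of lam 16] by simp
    then have "\<epsilon>0 \<le> 1" using e0 by simp
    then have "\<epsilon>0\<^sup>2 \<le> 1" using pos by (simp add: power_le_one)
    then have "1 / real n \<le> 1 / 100" using n by linarith
    then have n100: "real n \<ge> 100" using pos by (simp add: field_simps)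
    have "\<phi> * real n \<le> 1 / 8 * real n" using \<phi>(2) by (rule mult_right_mono) simp
    moreover have "0 \<le> \<phi> * real n" using \<phi>(1) by simp
    ultimately have D: "real n / 4 \<le> D" "D \<le> real n / 2" using n100 unfolding D_def by linarith+
    have sG: "simple_graph Gd" using G unfolding simple_graph_def edges_Gd verts_Gd by auto
    have dis: "A 0 \<inter> core K A = {}" "B 0 \<inter> core K B = {}" "A 0 \<union> B 0 \<subseteq> verts G"
        "A 0 \<inter> core K B = {}" "B 0 \<inter> core K A = {}"
    proof -
      have p: "disjoint_family_on A {0..K}" "disjoint_family_on B {0..K}" "whole K A \<union> whole K B = verts G" "whole K A \<inter> whole K B = {}"
        using part unfolding is_partition_def by auto
      have "x \<notin> core K A" if "x \<in> A 0" for x using that idx_eq[OF p(1), of x 0] mem_core_idx_iff[OF p(1), of x] unfolding whole_def by auto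
      moreover have "x \<notin> core K B" if "x \<in> B 0" for x using that idx_eq[OF p(2), of x 0] mem_core_idx_iff[OF p(2), of x] unfolding whole_def by auto
      ultimately show "A 0 \<inter> core K A = {}" "B 0 \<inter> core K B = {}" by blast+
      show "A 0 \<union> B 0 \<subseteq> verts G" "A 0 \<inter> core K B = {}" "B 0 \<inter> core K A = {}" using p(3,4) unfolding whole_def by blast+
    qed
    have degGd: "real (deg Gd v) = D" if v: "v \<in> A 0 \<union> B 0" for v
    proof -
      have vc: "v \<notin> core K A" "v \<notin> core K B" using v dis by blast+
      have "{u. {v, u} \<in> edges Gd} = {u. {v, u} \<in> edges G} - {u. {v, u} \<in> edges G0}"
        unfolding edges_Gd using vc by auto
      moreover have "{u. {v, u} \<in> edges G0} \<subseteq> {u. {v, u} \<in> edges G}" using G0e by auto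
      moreover have f: "finite {u. {v, u} \<in> edges G}"
        by (rule finite_subset[of _ "verts G"]) (use G in \<open>auto simp: simple_graph_def\<close>)
      ultimately have "deg Gd v = deg G v - deg G0 v" "deg G0 v \<le> deg G v"
        unfolding deg_def by (simp_all add: card_Diff_subset finite_subset card_mono)
      then have "real (deg Gd v) = real (deg G v) - real (deg G0 v)" by (simp add: of_nat_diff)
      then show ?thesis using reg degG0 v dis(3) unfolding D_def by auto
    qed
    have inner: "\<not> e \<subseteq> core K A \<and> \<not> e \<subseteq> core K B \<and> \<not> e \<subseteq> A 0 \<and> \<not> e \<subseteq> B 0" if "e \<in> edges Gd" for e
      using that G0e(2) unfolding edges_Gd by auto
    have target: "real n / 2 - 1 - (\<phi> + 2 * lam) * real n = D - 2 * lam * real n"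
      unfolding D_def by (simp add: algebra_simps)
    have e0': "\<epsilon>0 \<le> \<epsilon>" and cV': "card (verts Gd) = n" using e0 cV verts_Gd by simp_all
    show ?thesis
      unfolding target D_def[symmetric]
      by (rule decomposition_of_scheme[OF pos lam e1 e2 e0' n D nats[folded D_def] sG cV' inner degGd ev sch md eD[folded D_def]])
  qed
  show ?thesis
    unfolding Let_def
    apply (rule exI[of _ "1/8"], rule exI[of _ "1/100"], rule exI[of _ 1], rule exI[of _ "\<lambda>x. x ^ 16"],
        rule exI[of _ "\<lambda>x. x ^ 16"], rule exI[of _ "\<lambda>x. x ^ 1"], rule exI[of _ "\<lambda>x. x\<^sup>2 / 100"])
    apply (intro conjI hierarchy_fun_power hierarchy_fun_scaled_square allI impI)
       apply (simp, simp, simp)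
    apply (rule main[unfolded local_decomposition_def], assumption+, rule refl, assumption+)
    done
qed

end
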